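(* Let $\mathbf{A}$ be a reduced commutative ring. Then $\mathbf{A}$ is seminormal if and only if the natural group homomorphism $\mathrm{Pic}(\mathbf{A})\to\mathrm{Pic}(\mathbf{A}[X])$ is an isomorphism, where $X$ is a single indeterminate.
   Context: Rings are commutative with $1$. A ring $\mathbf{A}$ is called seminormal if whenever $b,c\in\mathbf{A}$ satisfy $b^2=c^3$, there exists $a\in\mathbf{A}$ such that $a^3=b$ and $a^2=c$. $\mathrm{Pic}(\mathbf{A})$ is the group (under $\otimes$) of isomorphism classes of finitely generated projective $\mathbf{A}$-modules of constant rank $1$. The natural homomorphism $\mathrm{Pic}(\mathbf{A})\to\mathrm{Pic}(\mathbf{A}[X])$ is given by extension of scalars, $M\mapsto M\otimes_{\mathbf{A}}\mathbf{A}[X]$. *)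

theory Defs
  imports "HOL-Algebra.Algebra"
begin

section \<open>Reduced and seminormal rings\<close>

definition reduced_ring :: "('a, 'r) ring_scheme \<Rightarrow> bool" where
  "reduced_ring R \<longleftrightarrow>
     (\<forall>x\<in>carrier R. \<forall>n::nat. x [^]\<^bsub>R\<^esub> n = \<zero>\<^bsub>R\<^esub> \<longrightarrow> x = \<zero>\<^bsub>R\<^esub>)"

definition seminormal :: "('a, 'r) ring_scheme \<Rightarrow> bool" where
  "seminormal R \<longleftrightarrow>
     (\<forall>b\<in>carrier R. \<forall>c\<in>carrier R. b [^]\<^bsub>R\<^esub> (2::nat) = c [^]\<^bsub>R\<^esub> (3::nat) \<longrightarrow>
        (\<exists>a\<in>carrier R. a [^]\<^bsub>R\<^esub> (3::nat) = b \<and> a [^]\<^bsub>R\<^esub> (2::nat) = c))"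


section \<open>Modules\<close>

text \<open>
  The record of a module over \<open>R\<close> extends that of a ring; its fields \<^const>\<open>monoid.mult\<close> and
  \<^const>\<open>monoid.one\<close> are irrelevant to the locale \<^locale>\<open>module\<close>, and they are left \<^term>\<open>undefined\<close>
  in the constructions below.
\<close>

definition module_hom ::
    "('a, 'r) ring_scheme \<Rightarrow> ('a, 'b, 'm) module_scheme \<Rightarrow> ('a, 'c, 'n) module_scheme \<Rightarrow> ('b \<Rightarrow> 'c) set" where
  "module_hom R M N =
     {f \<in> hom (add_monoid M) (add_monoid N).
        \<forall>a\<in>carrier R. \<forall>x\<in>carrier M. f (a \<odot>\<^bsub>M\<^esub> x) = a \<odot>\<^bsub>N\<^esub> f x}"

definition module_isomorphic ::
    "('a, 'r) ring_scheme \<Rightarrow> ('a, 'b, 'm) module_scheme \<Rightarrow> ('a, 'c, 'n) module_scheme \<Rightarrow> bool" where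
  "module_isomorphic R M N \<longleftrightarrow>
     (\<exists>f\<in>module_hom R M N. bij_betw f (carrier M) (carrier N))"

definition free_module :: "('a, 'r) ring_scheme \<Rightarrow> nat \<Rightarrow> ('a, nat \<Rightarrow> 'a) module" where
  "free_module R n =
     \<lparr>carrier = {..<n} \<rightarrow>\<^sub>E carrier R,
      monoid.mult = undefined,
      monoid.one = undefined,
      ring.zero = (\<lambda>i\<in>{..<n}. \<zero>\<^bsub>R\<^esub>),
      ring.add = (\<lambda>x y. \<lambda>i\<in>{..<n}. x i \<oplus>\<^bsub>R\<^esub> y i),
      smult = (\<lambda>a x. \<lambda>i\<in>{..<n}. a \<otimes>\<^bsub>R\<^esub> x i)\<rparr>"

definition direct_summand ::
    "('a, 'r) ring_scheme \<Rightarrow> ('a, 'b, 'm) module_scheme \<Rightarrow> 'b set \<Rightarrow> bool" where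
  "direct_summand R M P \<longleftrightarrow>
     submodule P R M \<and>
     (\<exists>Q. submodule Q R M \<and> P <+>\<^bsub>M\<^esub> Q = carrier M \<and> P \<inter> Q = {\<zero>\<^bsub>M\<^esub>})"

definition fg_projective :: "('a, 'r) ring_scheme \<Rightarrow> ('a, 'b, 'm) module_scheme \<Rightarrow> bool" where
  "fg_projective R M \<longleftrightarrow>
     module R M \<and>
     (\<exists>n P. direct_summand R (free_module R n) P \<and>
            module_isomorphic R M ((free_module R n)\<lparr>carrier := P\<rparr>))"


section \<open>Tensor products and extension of scalars\<close>

definition tensor_relators ::
    "('a, 'r) ring_scheme \<Rightarrow> ('a, 'b, 'm) module_scheme \<Rightarrow> ('a, 'c, 'n) module_scheme
      \<Rightarrow> ('b \<times> 'c \<Rightarrow>\<^sub>0 int) set" where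
  "tensor_relators R M N =
     {frag_of (x \<oplus>\<^bsub>M\<^esub> x', y) - frag_of (x, y) - frag_of (x', y) | x x' y.
        x \<in> carrier M \<and> x' \<in> carrier M \<and> y \<in> carrier N}
   \<union> {frag_of (x, y \<oplus>\<^bsub>N\<^esub> y') - frag_of (x, y) - frag_of (x, y') | x y y'.
        x \<in> carrier M \<and> y \<in> carrier N \<and> y' \<in> carrier N}
   \<union> {frag_of (a \<odot>\<^bsub>M\<^esub> x, y) - frag_of (x, a \<odot>\<^bsub>N\<^esub> y) | a x y.
        a \<in> carrier R \<and> x \<in> carrier M \<and> y \<in> carrier N}"

definition tensor_kernel ::
    "('a, 'r) ring_scheme \<Rightarrow> ('a, 'b, 'm) module_scheme \<Rightarrow> ('a, 'c, 'n) module_scheme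
      \<Rightarrow> ('b \<times> 'c \<Rightarrow>\<^sub>0 int) set" where
  "tensor_kernel R M N =
     generate (free_Abelian_group (carrier M \<times> carrier N)) (tensor_relators R M N)"

definition tensor_group ::
    "('a, 'r) ring_scheme \<Rightarrow> ('a, 'b, 'm) module_scheme \<Rightarrow> ('a, 'c, 'n) module_scheme
      \<Rightarrow> ('b \<times> 'c \<Rightarrow>\<^sub>0 int) set monoid" where
  "tensor_group R M N = free_Abelian_group (carrier M \<times> carrier N) Mod tensor_kernel R M N"

text \<open>
  The endomorphism \<open>id \<otimes> h\<close> of the tensor product, for an \<open>R\<close>-linear endomorphism \<open>h\<close> of \<open>N\<close>. The
  image of a coset of the kernel only lies in a coset, whence the addition of the kernel.
\<close>

definition tensor_map_right ::
    "('a, 'r) ring_scheme \<Rightarrow> ('a, 'b, 'm) module_scheme \<Rightarrow> ('a, 'c, 'n) module_scheme \<Rightarrow> ('c \<Rightarrow> 'c)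
      \<Rightarrow> ('b \<times> 'c \<Rightarrow>\<^sub>0 int) set \<Rightarrow> ('b \<times> 'c \<Rightarrow>\<^sub>0 int) set" where
  "tensor_map_right R M N h C =
     tensor_kernel R M N <#>\<^bsub>free_Abelian_group (carrier M \<times> carrier N)\<^esub>
       (frag_extend (\<lambda>(x, y). frag_of (x, h y)) ` C)"

definition tensor_product ::
    "('a, 'r) ring_scheme \<Rightarrow> ('a, 'b, 'm) module_scheme \<Rightarrow> ('a, 'c, 'n) module_scheme
      \<Rightarrow> ('a, ('b \<times> 'c \<Rightarrow>\<^sub>0 int) set) module" where
  "tensor_product R M N =
     \<lparr>carrier = carrier (tensor_group R M N),
      monoid.mult = undefined,
      monoid.one = undefined,
      ring.zero = monoid.one (tensor_group R M N),
      ring.add = monoid.mult (tensor_group R M N),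
      smult = (\<lambda>a. tensor_map_right R M N (\<lambda>y. a \<odot>\<^bsub>N\<^esub> y))\<rparr>"

text \<open>The ring \<open>S\<close> as a module over \<open>R\<close>, along a ring homomorphism \<open>\<phi> : R \<rightarrow> S\<close>.\<close>

definition ring_as_module :: "('s, 't) ring_scheme \<Rightarrow> ('a \<Rightarrow> 's) \<Rightarrow> ('a, 's) module" where
  "ring_as_module S \<phi> =
     \<lparr>carrier = carrier S,
      monoid.mult = undefined,
      monoid.one = undefined,
      ring.zero = \<zero>\<^bsub>S\<^esub>,
      ring.add = (\<oplus>\<^bsub>S\<^esub>),
      smult = (\<lambda>a s. \<phi> a \<otimes>\<^bsub>S\<^esub> s)\<rparr>"

text \<open>The \<open>S\<close>-module \<open>M \<otimes>\<^sub>R S\<close>, on which \<open>S\<close> acts by \<open>s \<cdot> (x \<otimes> t) = x \<otimes> (s t)\<close>.\<close>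

definition extend_scalars ::
    "('a, 'r) ring_scheme \<Rightarrow> ('s, 't) ring_scheme \<Rightarrow> ('a \<Rightarrow> 's) \<Rightarrow> ('a, 'b, 'm) module_scheme
      \<Rightarrow> ('s, ('b \<times> 's \<Rightarrow>\<^sub>0 int) set) module" where
  "extend_scalars R S \<phi> M = (let N = ring_as_module S \<phi> in
     \<lparr>carrier = carrier (tensor_group R M N),
      monoid.mult = undefined,
      monoid.one = undefined,
      ring.zero = monoid.one (tensor_group R M N),
      ring.add = monoid.mult (tensor_group R M N),
      smult = (\<lambda>s. tensor_map_right R M N (\<lambda>t. s \<otimes>\<^bsub>S\<^esub> t))\<rparr>)"


section \<open>Localization and constant rank\<close>

definition fraction_rel :: "('a, 'r) ring_scheme \<Rightarrow> 'a set \<Rightarrow> (('a \<times> 'a) \<times> ('a \<times> 'a)) set" where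
  "fraction_rel R S =
     {((a, s), (b, t)). a \<in> carrier R \<and> s \<in> S \<and> b \<in> carrier R \<and> t \<in> S \<and>
        (\<exists>u\<in>S. u \<otimes>\<^bsub>R\<^esub> (a \<otimes>\<^bsub>R\<^esub> t) = u \<otimes>\<^bsub>R\<^esub> (b \<otimes>\<^bsub>R\<^esub> s))}"

definition fraction :: "('a, 'r) ring_scheme \<Rightarrow> 'a set \<Rightarrow> 'a \<Rightarrow> 'a \<Rightarrow> ('a \<times> 'a) set" where
  "fraction R S a s = fraction_rel R S `` {(a, s)}"

definition localization :: "('a, 'r) ring_scheme \<Rightarrow> 'a set \<Rightarrow> ('a \<times> 'a) set ring" where
  "localization R S =
     \<lparr>carrier = (carrier R \<times> S) // fraction_rel R S,
      monoid.mult = (\<lambda>C D. \<Union>(a, s)\<in>C. \<Union>(b, t)\<in>D. fraction R S (a \<otimes>\<^bsub>R\<^esub> b) (s \<otimes>\<^bsub>R\<^esub> t)),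
      monoid.one = fraction R S \<one>\<^bsub>R\<^esub> \<one>\<^bsub>R\<^esub>,
      ring.zero = fraction R S \<zero>\<^bsub>R\<^esub> \<one>\<^bsub>R\<^esub>,
      ring.add = (\<lambda>C D. \<Union>(a, s)\<in>C. \<Union>(b, t)\<in>D.
               fraction R S ((a \<otimes>\<^bsub>R\<^esub> t) \<oplus>\<^bsub>R\<^esub> (b \<otimes>\<^bsub>R\<^esub> s)) (s \<otimes>\<^bsub>R\<^esub> t))\<rparr>"

text \<open>\<open>M\<close> has constant rank \<open>k\<close> if \<open>M\<^sub>p\<close> is free of rank \<open>k\<close> over \<open>R\<^sub>p\<close> for every prime ideal \<open>p\<close>.\<close>

definition constant_rank :: "('a, 'r) ring_scheme \<Rightarrow> nat \<Rightarrow> ('a, 'b, 'm) module_scheme \<Rightarrow> bool" where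
  "constant_rank R k M \<longleftrightarrow>
     (\<forall>p. primeideal p R \<longrightarrow>
        (let S = carrier R - p; Rp = localization R S in
           module_isomorphic Rp
             (extend_scalars R Rp (\<lambda>a. fraction R S a \<one>\<^bsub>R\<^esub>) M)
             (free_module Rp k)))"


section \<open>The Picard group\<close>

definition rank_one_projective :: "('a, 'r) ring_scheme \<Rightarrow> ('a, 'b, 'm) module_scheme \<Rightarrow> bool" where
  "rank_one_projective R M \<longleftrightarrow> fg_projective R M \<and> constant_rank R 1 M"

text \<open>
  A finitely generated projective module is isomorphic to a submodule of some \<open>R\<^sup>n\<close>, that is, to a
  module with elements of type \<^typ>\<open>nat \<Rightarrow> 'a\<close>. Isomorphism classes are therefore represented by
  their members of this type; the module \<open>M\<close> itself may have elements of any type.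
\<close>

definition pic_class ::
    "('a, 'r) ring_scheme \<Rightarrow> ('a, 'b, 'm) module_scheme \<Rightarrow> ('a, nat \<Rightarrow> 'a) module set" where
  "pic_class R M = {P. rank_one_projective R P \<and> module_isomorphic R P M}"

definition Pic :: "('a, 'r) ring_scheme \<Rightarrow> ('a, nat \<Rightarrow> 'a) module set monoid" where
  "Pic R =
     \<lparr>carrier = pic_class R ` {M :: ('a, nat \<Rightarrow> 'a) module. rank_one_projective R M},
      monoid.mult = (\<lambda>C D. \<Union>M\<in>C. \<Union>N\<in>D. pic_class R (tensor_product R M N)),
      monoid.one = pic_class R (ring_as_module R id)\<rparr>"

definition Pic_map ::
    "('a, 'r) ring_scheme \<Rightarrow> ('s, 't) ring_scheme \<Rightarrow> ('a \<Rightarrow> 's)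
      \<Rightarrow> ('a, nat \<Rightarrow> 'a) module set \<Rightarrow> ('s, nat \<Rightarrow> 's) module set" where
  "Pic_map R S \<phi> C = (\<Union>M\<in>C. pic_class S (extend_scalars R S \<phi> M))"

end

theory Submission
  imports Defs "HOL-Computational_Algebra.Polynomial" "HOL-Library.Function_Algebras"
begin

text \<open>
  A module with a finite dual basis \<open>e, l\<close> (elements \<open>e i\<close> and linear forms \<open>l i\<close> with \<open>x\<close> the sum of
  the \<open>l i x \<odot> e i\<close>) is determined up to isomorphism by the idempotent matrix of the \<open>l i (e j)\<close>, and having
  such a basis is the same as being finitely generated projective (\<open>fg_projective_iff\<close>). Extension of
  scalars and tensor product act on these matrices entrywise and by Kronecker product
  (\<open>represents_extend\<close>, \<open>represents_tensor\<close>), and constant rank one means that the 2 x 2 minors vanish and the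
  trace is 1 (\<open>rank_one_projective_iff\<close>). Two such matrices \<open>P\<close> and \<open>Q\<close> have isomorphic images exactly
  when their product family \<open>P i j \<otimes> Q l k\<close> factors as \<open>x i k \<otimes> y l j\<close> (\<open>represents_of_factorization\<close>,
  \<open>factorization_of_iso\<close>). So every question about the Picard group becomes a question about matrices.

  Evaluation at 0 is a retraction of the inclusion of \<open>R\<close> into \<open>R[X]\<close>, hence \<open>Pic R \<rightarrow> Pic R[X]\<close> is always
  injective, and a class in its image must be the extension of its own value at 0. The theorem thus
  says that \<open>R\<close> is seminormal iff, for every rank one matrix \<open>M\<close> over \<open>R[X]\<close>, the matrix
  \<open>N = M(X) \<otimes> M(0)\<^sup>t\<close>, which has factorized constant term by construction, factorizes over \<open>R[X]\<close>.

  If all these matrices factorize and \<open>b\<^sup>2 = c\<^sup>3\<close>, apply this to Schanuel's matrix, which over \<open>R[u]\<close> with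
  \<open>u\<^sup>2 = c\<close> and \<open>u\<^sup>3 = b\<close> is the product of a column starting with \<open>1 + u T\<close> and a row. In a factorization over
  \<open>R\<close> the coefficient of \<open>T\<close> in the same entry then has to be a solution (\<open>schanuel_descent\<close>); reducedness
  enters through the lemma of Armendariz: if a product of polynomials is constant, the products of a nonconstant coefficient
  of one with any coefficient of the other vanish.

  Conversely let \<open>R\<close> be seminormal. Over a field, \<open>N\<close> factorizes because \<open>K[X]\<close> is a principal ideal
  domain (\<open>factor_mod_prime\<close>). Being reduced, \<open>R\<close> embeds into a product of fields, and there the
  factorizations \<open>f, g\<close> with constant terms prescribed by \<open>M(0)\<close> can be glued coefficientwise. By the theorem
  of Dedekind and Mertens (\<open>dedekind_mertens\<close>) their coefficients lie in an extension \<open>E\<close> of \<open>R\<close> such that every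
  \<open>s\<close> in \<open>R\<close> that carries the coefficients of \<open>f\<close> into \<open>R\<close> has a power in the conductor \<open>c\<close> of \<open>R\<close> in \<open>E\<close>; and since \<open>R\<close> is
  seminormal, \<open>c\<close> is a radical ideal of \<open>E\<close>. If \<open>c\<close> were proper, localize at a multiplicative set that is maximal
  among those avoiding \<open>c\<close>. Modulo the resulting ideal \<open>Q\<close>, the ring \<open>R\<close> becomes a domain in which the
  factorization exists up to a denominator \<open>t\<close>; comparing it with \<open>f, g\<close>, the two differ by a factor that
  divides \<open>t\<^sup>2\<close> and has constant term \<open>t\<close>, and in a reduced ring such a factor is constant. Hence some element \<open>s\<close> of the
  multiplicative set carries all coefficients of \<open>f\<close> into \<open>R\<close>, so a power of \<open>s\<close> lies in \<open>c\<close>, a contradiction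
  (\<open>descends\<close>). So \<open>E = R\<close> and \<open>N\<close> factorizes over \<open>R\<close> (\<open>seminormal_factorization\<close>).

  The algebra of the last two paragraphs takes place in rings given by a type class, modulo an ideal. It applies to a
  ring given by a carrier because every such ring is the quotient of the free commutative ring on its
  elements; equality in \<open>R\<close> becomes congruence modulo the kernel.
\<close>

section \<open>Ideals, polynomials with restricted coefficients, and radical ideals\<close>

hide_const (open) up_ring.coeff up_ring.monom

text \<open>Rings are handled as subrings \<open>E\<close> of a type, and quotients as congruence modulo an ideal \<open>I\<close> of \<open>E\<close>: the
  argument varies both inside one ring, so quotient types would get in the way.\<close>

locale csubring =
  fixes E :: "'r::comm_ring_1 set"
  assumes one_mem: "1 \<in> E"
    and diff_mem: "x \<in> E \<Longrightarrow> y \<in> E \<Longrightarrow> x - y \<in> E"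
    and mult_mem: "x \<in> E \<Longrightarrow> y \<in> E \<Longrightarrow> x * y \<in> E"
begin

lemma zero_mem: "0 \<in> E"
  using diff_mem[OF one_mem one_mem] by simp

lemma minus_mem: "x \<in> E \<Longrightarrow> - x \<in> E"
  using diff_mem[OF zero_mem] by simp

lemma add_mem: "x \<in> E \<Longrightarrow> y \<in> E \<Longrightarrow> x + y \<in> E"
  using diff_mem[of x "- y"] minus_mem by simp

lemma sum_mem: "(\<And>i. i \<in> A \<Longrightarrow> f i \<in> E) \<Longrightarrow> sum f A \<in> E"
  by (induction A rule: infinite_finite_induct) (auto intro: zero_mem add_mem)

lemma power_mem: "x \<in> E \<Longrightarrow> x ^ n \<in> E"
  by (induction n) (auto intro: one_mem mult_mem)

end

locale cideal = csubring E for E :: "'r::comm_ring_1 set" +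
  fixes I :: "'r set"
  assumes subset: "I \<subseteq> E"
    and zero_ideal: "0 \<in> I"
    and add_ideal: "x \<in> I \<Longrightarrow> y \<in> I \<Longrightarrow> x + y \<in> I"
    and mult_ideal: "e \<in> E \<Longrightarrow> x \<in> I \<Longrightarrow> e * x \<in> I"
begin

lemma mult_ideal': "e \<in> E \<Longrightarrow> x \<in> I \<Longrightarrow> x * e \<in> I"
  using mult_ideal[of e x] by (simp add: mult.commute)

lemma minus_ideal: "x \<in> I \<Longrightarrow> - x \<in> I"
  using mult_ideal[OF minus_mem[OF one_mem]] by simp

lemma diff_ideal: "x \<in> I \<Longrightarrow> y \<in> I \<Longrightarrow> x - y \<in> I"
  using add_ideal[of x "- y"] minus_ideal by simp

lemma sum_ideal: "(\<And>i. i \<in> A \<Longrightarrow> f i \<in> I) \<Longrightarrow> sum f A \<in> I"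
  by (induction A rule: infinite_finite_induct) (auto intro: zero_ideal add_ideal)

lemma cong_trans: "x - y \<in> I \<Longrightarrow> y - z \<in> I \<Longrightarrow> x - z \<in> I"
  using add_ideal[of "x - y" "y - z"] by simp

lemma cong_sym: "x - y \<in> I \<Longrightarrow> y - x \<in> I"
  using minus_ideal[of "x - y"] by simp

lemma cong_mult:
  assumes "x - x' \<in> I" "y - y' \<in> I" "y \<in> E" "x' \<in> E"
  shows "x * y - x' * y' \<in> I"
proof -
  have "y * (x - x') + x' * (y - y') \<in> I"
    using assms by (intro add_ideal mult_ideal)
  then show ?thesis
    by (simp add: algebra_simps)
qed

lemma cong_sum: "(\<And>i. i \<in> A \<Longrightarrow> f i - g i \<in> I) \<Longrightarrow> sum f A - sum g A \<in> I"
  using sum_ideal[of A "\<lambda>i. f i - g i"] by (simp add: sum_subtractf)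

end

definition polys :: "'r::comm_ring_1 set \<Rightarrow> 'r poly set" where
  "polys I = {p. \<forall>k. poly.coeff p k \<in> I}"

lemma polysI: "(\<And>k. poly.coeff p k \<in> I) \<Longrightarrow> p \<in> polys I"
  and polysD: "p \<in> polys I \<Longrightarrow> poly.coeff p k \<in> I"
  by (auto simp: polys_def)

lemma polys_UNIV [simp]: "polys UNIV = UNIV"
  by (auto simp: polys_def)

lemma csubring_polys:
  assumes "csubring E" shows "csubring (polys E)"
proof -
  interpret csubring E by fact
  show ?thesis
  proof
    show "1 \<in> polys E"
      by (auto intro!: polysI simp: zero_mem one_mem coeff_1)
  next
    fix x y assume xy: "x \<in> polys E" "y \<in> polys E"
    show "x - y \<in> polys E"
      using xy by (auto intro!: polysI diff_mem dest: polysD)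
    show "x * y \<in> polys E"
      using xy by (auto intro!: polysI sum_mem mult_mem dest: polysD simp: coeff_mult)
  qed
qed

lemma cideal_polys:
  assumes "cideal E I" shows "cideal (polys E) (polys I)"
proof -
  interpret cideal E I by fact
  interpret P: csubring "polys E" by (rule csubring_polys) unfold_locales
  show ?thesis
  proof
    show "polys I \<subseteq> polys E" "0 \<in> polys I"
      using subset zero_ideal by (auto simp: polys_def)
  next
    fix x y assume xy: "x \<in> polys I" "y \<in> polys I"
    then show "x + y \<in> polys I"
      by (auto intro!: polysI add_ideal dest: polysD)
  next
    fix e x assume ex: "e \<in> polys E" "x \<in> polys I"
    then show "e * x \<in> polys I"
      by (auto intro!: polysI sum_ideal mult_ideal dest: polysD simp: coeff_mult)
  qed
qed

lemma csubring_UNIV [simp]: "csubring UNIV"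
  by standard auto

definition radical_in :: "'r::comm_ring_1 set \<Rightarrow> 'r set \<Rightarrow> bool" where
  "radical_in E I \<longleftrightarrow> (\<forall>e\<in>E. e * e \<in> I \<longrightarrow> e \<in> I)"

lemma radical_inD: "radical_in E I \<Longrightarrow> e \<in> E \<Longrightarrow> e * e \<in> I \<Longrightarrow> e \<in> I"
  by (auto simp: radical_in_def)

lemma (in cideal) radical_power:
  assumes "radical_in E I" "e \<in> E" "e ^ n \<in> I" 
  shows "e \<in> I"
  using assms(3)
proof (induction n rule: less_induct)
  case (less n)
  consider "n = 0" | "n = 1" | "n \<ge> 2" by linarith
  then show ?case
  proof cases
    case 1
    then have "e * 1 \<in> I" using less.prems assms(2) by (intro mult_ideal) simp_all
    then show ?thesis by simp
  next
    case 2
    then show ?thesis using less.prems by simp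
  next
    case 3
    then obtain m where m: "n = Suc (Suc m)"
      using 3 by (metis add_2_eq_Suc le_Suc_ex)
    have sq: "e ^ (n - 1) * e ^ (n - 1) = e ^ m * e ^ n"
      by (simp add: m ac_simps)
    have "e ^ (n - 1) * e ^ (n - 1) \<in> I"
      unfolding sq using assms less.prems by (intro mult_ideal power_mem)
    then have "e ^ (n - 1) \<in> I"
      by (rule radical_inD[OF assms(1) power_mem[OF assms(2)]])
    then show ?thesis using less.IH[of "n - 1"] 3 by auto
  qed
qed

text \<open>Modulo a prime the degrees of \<open>f\<close> and \<open>g\<close> add up to less than \<open>N\<close>, and a radical ideal is an intersection of
  primes. A descending induction on \<open>i + j\<close> replaces the primes: multiplied by \<open>f\<^sub>i g\<^sub>j\<close>, the coefficient of the product
  at \<open>i + j\<close> becomes the square of \<open>f\<^sub>i g\<^sub>j\<close> plus terms containing a product that is already known to lie in \<open>I\<close>.\<close>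

lemma (in cideal) armendariz:
  assumes rad: "radical_in E I" and f: "f \<in> polys E" and g: "g \<in> polys E"
    and fg: "\<And>k. N \<le> k \<Longrightarrow> poly.coeff (f * g) k \<in> I"
    and ij: "N \<le> i + j"
  shows "poly.coeff f i * poly.coeff g j \<in> I"
  using ij
proof (induction "Polynomial.degree f + Polynomial.degree g + 1 - (i + j)" arbitrary: i j rule: less_induct)
  case less
  define k where "k = i + j"
  show ?case
  proof (cases "k > Polynomial.degree f + Polynomial.degree g")
    case True
    then have "Polynomial.degree f < i \<or> Polynomial.degree g < j"
      by (auto simp: k_def)
    then have "poly.coeff f i * poly.coeff g j = 0"
      by (auto simp: coeff_eq_0)
    then show ?thesis using zero_ideal by simp
  next
    case False
    let ?t = "poly.coeff f i * poly.coeff g j"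
    have larger: "poly.coeff f a * poly.coeff g b \<in> I" if "a + b > k" for a b
      by (rule less.hyps) (use that False less.prems k_def in auto)
    have mem: "poly.coeff f a \<in> E" "poly.coeff g a \<in> E" for a
      using f g by (auto intro: polysD)
    have cross: "?t * (poly.coeff f l * poly.coeff g (k - l)) \<in> I" if "l \<in> {..k} - {i}" for l
    proof (cases "l < i")
      case True
      have "(poly.coeff g j * poly.coeff f l) * (poly.coeff f i * poly.coeff g (k - l)) \<in> I"
        using True k_def by (intro mult_ideal[OF mult_mem larger] mem) simp
      then show ?thesis by (simp add: algebra_simps)
    next
      case False
      then have "i < l" "l \<le> k" using that by auto
      have "(poly.coeff f i * poly.coeff g (k - l)) * (poly.coeff f l * poly.coeff g j) \<in> I"
        using \<open>i < l\<close> k_def by (intro mult_ideal[OF mult_mem larger] mem) simp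
      then show ?thesis by (simp add: algebra_simps)
    qed
    have "?t * poly.coeff (f * g) k - (\<Sum>l\<in>{..k} - {i}. ?t * (poly.coeff f l * poly.coeff g (k - l))) \<in> I"
      using fg[of k] less.prems k_def
      by (intro diff_ideal mult_ideal mult_mem mem sum_ideal cross) simp_all
    also have "?t * poly.coeff (f * g) k - (\<Sum>l\<in>{..k} - {i}. ?t * (poly.coeff f l * poly.coeff g (k - l)))
       = ?t * ?t"
    proof -
      have "poly.coeff (f * g) k = ?t + (\<Sum>l\<in>{..k} - {i}. poly.coeff f l * poly.coeff g (k - l))"
        unfolding coeff_mult by (subst sum.remove[of _ i]) (auto simp: k_def)
      then show ?thesis by (simp add: sum_distrib_left distrib_left)
    qed
    finally show ?thesis
      by (rule radical_inD[OF rad mult_mem[OF mem]])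
  qed
qed

section \<open>Schanuel's matrix and factorization modulo a prime ideal\<close>

text \<open>Let \<open>u\<^sup>2 = c\<close>, \<open>u\<^sup>3 = b\<close> and \<open>f0 = 1 + u T\<close>, \<open>f1 = u\<^sup>2 T\<^sup>2\<close>, with the matching \<open>g0, g1\<close>. Then both factors on
  the left equal \<open>u\<^sup>2\<close>. For an arbitrary factorization only their product is \<open>c\<^sup>2\<close>, up to the relations.\<close>

lemma schanuel_identity:
  fixes b c T f0 f1 g0 g1 :: "'q::comm_ring_1"
  shows "((c - b*T) * (1 + c*T^2) * f0 + c^2*T^2*f1) * (g0 * (c + b*T) + g1 * c^2*T^2) - c^2
    = (c - b*T) * (1 + c*T^2) * (c + b*T) * (f0 * g0 - (1 - c^2*T^4))
      + (c - b*T) * (1 + c*T^2) * c^2*T^2 * (f0 * g1 - T^2 * (c + b*T))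
      + c^2*T^2*(c + b*T) * (f1 * g0 - T^2 * (c - b*T) * (1 + c*T^2))
      + c^4*T^4 * (f1 * g1 - c^2*T^4)
      - T^2*(1 + c*T^2)*(1 + c^2*T^4) * (b^2 - c^3)"
  by (simp add: algebra_simps power2_eq_square power3_eq_cube power4_eq_xxxx)

text \<open>The candidate is the coefficient of \<open>T\<close> in \<open>f0\<close>, since \<open>f0 = 1 + u T\<close> in the model factorization. As the
  product of \<open>U\<close> and \<open>V\<close> is a constant, the linear coefficient of \<open>U\<close> is killed by the constant
  coefficient of \<open>V\<close>, which gives \<open>c * (c * a - b) = 0\<close> and then, in a reduced ring, everything else.\<close>

lemma schanuel_descent:
  fixes I :: "'r::comm_ring_1 set" and f0 f1 g0 g1 T :: "'r poly"
  assumes "cideal UNIV I" and rad: "radical_in UNIV I" and bc: "b^2 - c^3 \<in> I"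
  defines "T \<equiv> [:0, 1:]"
  assumes r00: "f0 * g0 - (1 - [:c:]^2*T^4) \<in> polys I"
    and r01: "f0 * g1 - T^2 * ([:c:] + [:b:]*T) \<in> polys I"
    and r10: "f1 * g0 - T^2 * ([:c:] - [:b:]*T) * (1 + [:c:]*T^2) \<in> polys I"
    and r11: "f1 * g1 - [:c:]^2*T^4 \<in> polys I"
    and f00: "poly.coeff f0 0 - 1 \<in> I" and g00: "poly.coeff g0 0 - 1 \<in> I"
  shows "\<exists>a. a^3 - b \<in> I \<and> a^2 - c \<in> I"
proof -
  interpret cideal UNIV I by fact
  interpret P: cideal UNIV "polys I"
    using cideal_polys[OF assms(1)] by simp
  define a where "a = poly.coeff f0 1"
  (* in the model factorization both U and V are the constant c *)
  define U where "U = ([:c:] - [:b:]*T) * (1 + [:c:]*T^2) * f0 + [:c:]^2*T^2*f1"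
  define V where "V = g0 * ([:c:] + [:b:]*T) + g1*[:c:]^2*T^2"
  have const: "r \<in> I \<Longrightarrow> [:r:] \<in> polys I" for r
    by (auto simp: polys_def coeff_pCons zero_ideal split: nat.splits)
  have e: "[:b:]^2 - [:c:]^3 \<in> polys I"
    using const[OF bc] by (simp add: power2_eq_square power3_eq_cube mult.assoc)
  have "U * V - [:c:]^2 \<in> polys I"
    unfolding U_def V_def schanuel_identity
    by (intro P.diff_ideal P.add_ideal P.mult_ideal r00 r01 r10 r11 e UNIV_I)
  then have UV: "poly.coeff (U * V) k \<in> I" if "1 \<le> k" for k
    using that polysD[of "U * V - [:c:]^2" I k]
    by (auto simp: power2_eq_square coeff_pCons split: nat.splits)
  have "poly.coeff U 1 * poly.coeff V 0 \<in> I"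
    by (rule armendariz[OF rad, where N = 1]) (use UV in auto)
  also have "poly.coeff U 1 = c * a - b * poly.coeff f0 0"
    by (simp add: U_def T_def a_def coeff_mult power2_eq_square coeff_pCons algebra_simps)
  also have "poly.coeff V 0 = poly.coeff g0 0 * c"
    by (simp add: V_def T_def coeff_mult power2_eq_square)
  finally have s: "(c * a - b * poly.coeff f0 0) * (poly.coeff g0 0 * c) \<in> I" .
  define z where "z = c * a - b"
  have "c * z = (c * a - b * poly.coeff f0 0) * (poly.coeff g0 0 * c)
     - (c * z) * (poly.coeff g0 0 - 1) + (b * c * poly.coeff g0 0) * (poly.coeff f0 0 - 1)"
    unfolding z_def by (simp add: algebra_simps)
  also have "\<dots> \<in> I"
    by (intro add_ideal diff_ideal mult_ideal s f00 g00 UNIV_I)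
  finally have cz: "c * z \<in> I" .
  have "z^3 = (a * z - a * b + c^2) * (c * z) + z * (b^2 - c^3)"
    unfolding z_def by (simp add: algebra_simps power2_eq_square power3_eq_cube)
  also have "\<dots> \<in> I"
    by (intro add_ideal mult_ideal cz bc UNIV_I)
  finally have z: "z \<in> I"
    using radical_power[OF rad] by blast
  define y where "y = a^2 - c"
  have "(c * y) * (c * y) = (y * (c * a + b)) * z + y * (b^2 - c^3)"
    unfolding y_def z_def by (simp add: algebra_simps power2_eq_square power3_eq_cube)
  also have "\<dots> \<in> I"
    by (intro add_ideal mult_ideal z bc UNIV_I)
  finally have cy: "c * y \<in> I"
    using radical_inD[OF rad] by blast
  have "smult y f0 * g0 - [:y:] = [:y:] * (f0 * g0 - (1 - [:c:]^2*T^4)) - ([:c:]*T^4) * [:c * y:]"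
  proof -
    have "smult y f0 = [:y:] * f0" "[:c * y:] = [:c:] * [:y:]" by simp_all
    moreover have "s * f * g - s = s * (f * g - (1 - C^2*Z)) - (C * Z) * (C * s)" for s f g C Z :: "'r poly"
      by (simp add: algebra_simps power2_eq_square)
    ultimately show ?thesis by metis
  qed
  also have "\<dots> \<in> polys I"
    by (intro P.diff_ideal P.mult_ideal r00 const cy UNIV_I)
  finally have yf: "poly.coeff (smult y f0 * g0) k \<in> I" if "1 \<le> k" for k
    using that polysD[of "smult y f0 * g0 - [:y:]" I k]
    by (auto simp: coeff_pCons split: nat.splits)
  have "poly.coeff (smult y f0) 1 * poly.coeff g0 0 \<in> I"
    by (rule armendariz[OF rad, where N = 1]) (use yf in auto)
  then have ya0: "(y * a) * poly.coeff g0 0 \<in> I"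
    by (simp add: a_def)
  have "y * a = (y * a) * poly.coeff g0 0 - (y * a) * (poly.coeff g0 0 - 1)"
    by (simp add: algebra_simps power2_eq_square power3_eq_cube)
  also have "\<dots> \<in> I"
    by (intro diff_ideal mult_ideal ya0 g00 UNIV_I)
  finally have ya: "y * a \<in> I" .
  have "y * y = a * (y * a) - c * y"
    unfolding y_def by (simp add: algebra_simps power2_eq_square power3_eq_cube)
  also have "\<dots> \<in> I"
    by (intro diff_ideal mult_ideal ya cy UNIV_I)
  finally have y: "y \<in> I"
    using radical_inD[OF rad] by blast
  have "a^3 - b = a * y + z"
    unfolding y_def z_def by (simp add: algebra_simps power2_eq_square power3_eq_cube)
  also have "\<dots> \<in> I"
    by (intro add_ideal mult_ideal y z UNIV_I)
  finally show ?thesis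
    using y y_def by blast
qed

lemma prime_polys:
  assumes "cideal UNIV p" "1 \<notin> p" and prime: "\<And>x y. x * y \<in> p \<Longrightarrow> x \<in> p \<or> y \<in> p"
    and fg: "f * g \<in> polys p"
  shows "f \<in> polys p \<or> g \<in> polys p"
proof -
  interpret cideal UNIV p by fact
  have "radical_in UNIV p"
    using prime by (auto simp: radical_in_def)
  then have "poly.coeff f i * poly.coeff g j \<in> p" for i j
    by (rule armendariz[where N = 0]) (use polysD[OF fg] in auto)
  then show ?thesis
    using prime by (meson polysI)
qed

text \<open>Over the fraction field \<open>K\<close> of the quotient by \<open>p\<close> a nonzero column of \<open>M\<close> has a greatest common divisor \<open>d\<close> in
  \<open>K[X]\<close>; dividing by \<open>d\<close> gives a unimodular column \<open>f\<close> that spans the image of \<open>M\<close>. The element \<open>t\<close> clears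
  denominators: \<open>d\<close> is an element of least degree in the ideal of the column, pseudo-division costs powers of its
  leading coefficient, and rescaling to the prescribed constant terms costs one more denominator.\<close>

lemma factor_mod_prime:
  fixes p :: "'r::comm_ring_1 set" and M :: "'i \<Rightarrow> 'i \<Rightarrow> 'r poly"
  assumes "cideal UNIV p" and proper: "1 \<notin> p" and prime: "\<And>x y. x * y \<in> p \<Longrightarrow> x \<in> p \<or> y \<in> p"
    and S: "finite S"
    and minors: "\<And>i j k l. \<lbrakk>i \<in> S; j \<in> S; k \<in> S; l \<in> S\<rbrakk> \<Longrightarrow> M i j * M k l - M i l * M k j \<in> polys p"
    and trace: "(\<Sum>i\<in>S. M i i) - 1 \<in> polys p"
    and init: "\<And>i j. \<lbrakk>i \<in> S; j \<in> S\<rbrakk> \<Longrightarrow> poly.coeff (M i j) 0 - x i * y j \<in> p"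
  shows "\<exists>t h k. t \<notin> p \<and> (\<forall>i\<in>S. \<forall>j\<in>S. h i * k j - smult (t^2) (M i j) \<in> polys p) \<and>
    (\<forall>i\<in>S. poly.coeff (h i) 0 - t * x i \<in> p) \<and> (\<forall>j\<in>S. poly.coeff (k j) 0 - t * y j \<in> p)"
proof -
  interpret cideal UNIV p by fact
  interpret P: cideal UNIV "polys p"
    using cideal_polys[OF assms(1)] by simp
  have pprime: "f \<in> polys p \<or> g \<in> polys p" if "f * g \<in> polys p" for f g
    using prime_polys[OF assms(1) proper prime that] .
  have "\<exists>j\<in>S. M j j \<notin> polys p"
  proof (rule ccontr)
    assume "\<not> ?thesis"
    then have "(\<Sum>i\<in>S. M i i) - ((\<Sum>i\<in>S. M i i) - 1) \<in> polys p"
      by (intro P.diff_ideal P.sum_ideal trace) auto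
    then have "poly.coeff 1 0 \<in> p"
      by (intro polysD) simp
    then show False using proper by simp
  qed
  then obtain j0 where j0: "j0 \<in> S" "M j0 j0 \<notin> polys p" by blast
  define c where "c i = M i j0" for i
  (* the ideal generated by one nonzero column, modulo p *)
  define N where "N = {(\<Sum>i\<in>S. a i * c i) + r | a r. r \<in> polys p}"
  have NI: "(\<Sum>i\<in>S. a i * c i) + r \<in> N" if "r \<in> polys p" for a r
    using that by (auto simp: N_def)
  have N_p: "r \<in> N" if "r \<in> polys p" for r
    using NI[OF that, of "\<lambda>_. 0"] by simp
  have N_c: "c i \<in> N" if "i \<in> S" for i
    using NI[OF P.zero_ideal, of "\<lambda>l. if l = i then 1 else 0"] that S by (simp add: if_distrib[of "\<lambda>z. z * _"] cong: if_cong)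
  have N_diff: "f - g \<in> N" if fg: "f \<in> N" "g \<in> N" for f g
  proof -
    obtain a r a' r' where *: "r \<in> polys p" "r' \<in> polys p"
      "f = (\<Sum>i\<in>S. a i * c i) + r" "g = (\<Sum>i\<in>S. a' i * c i) + r'"
      using fg by (auto simp: N_def)
    have "f - g = (\<Sum>i\<in>S. (a i - a' i) * c i) + (r - r')"
      by (simp add: * sum_subtractf left_diff_distrib)
    then show ?thesis using NI[OF P.diff_ideal[OF *(1,2)]] by simp
  qed
  have N_mult: "g * f \<in> N" if f: "f \<in> N" for f g
  proof -
    obtain a r where *: "r \<in> polys p" "f = (\<Sum>i\<in>S. a i * c i) + r"
      using f by (auto simp: N_def)
    have "g * f = (\<Sum>i\<in>S. (g * a i) * c i) + g * r"
      by (simp add: * distrib_left sum_distrib_left mult.assoc)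
    then show ?thesis using NI[OF P.mult_ideal[OF UNIV_I *(1)]] by simp
  qed
  have "c j0 \<in> N \<and> c j0 \<notin> polys p"
    using N_c j0 by (auto simp: c_def)
  then obtain d where d: "d \<in> N" "d \<notin> polys p"
    and least: "\<And>g. g \<in> N \<Longrightarrow> g \<notin> polys p \<Longrightarrow> Polynomial.degree d \<le> Polynomial.degree g"
    using ex_has_least_nat[of "\<lambda>g. g \<in> N \<and> g \<notin> polys p" "c j0" Polynomial.degree] by blast
  define lc where "lc = poly.coeff d (Polynomial.degree d)"
  have lc: "lc \<notin> p"
  proof
    assume "lc \<in> p"
    define d' where "d' = d - Polynomial.monom lc (Polynomial.degree d)"
    have m: "Polynomial.monom lc (Polynomial.degree d) \<in> polys p"
      using \<open>lc \<in> p\<close> zero_ideal by (auto simp: polys_def)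
    have d': "d' \<in> N" "d' \<notin> polys p"
      using N_diff[OF d(1) N_p[OF m]] P.add_ideal[OF _ m, of d'] d(2) by (auto simp: d'_def)
    have "poly.coeff d' k = 0" if "k > Polynomial.degree d - 1" for k
      using that by (cases "k = Polynomial.degree d") (auto simp: d'_def lc_def coeff_eq_0)
    then have le: "Polynomial.degree d' \<le> Polynomial.degree d - 1"
      by (intro degree_le) auto
    have "Polynomial.degree d \<noteq> 0"
    proof
      assume "Polynomial.degree d = 0"
      then obtain z where "d = [:z:]"
        by (rule degree_eq_zeroE)
      then have "d = [:lc:]"
        by (simp add: lc_def)
      then show False
        using m d(2) by (simp add: monom_0)
    qed
    then show False using least[OF d'] le by simp
  qed
  have "d \<noteq> 0"
    using d(2) P.zero_ideal by auto
  have "\<exists>e q. smult (lc ^ e) (c i) - d * q \<in> polys p" if "i \<in> S" for i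
  proof -
    obtain q r where qr: "pseudo_divmod (c i) d = (q, r)"
      by (metis surj_pair)
    note pd = pseudo_divmod[OF \<open>d \<noteq> 0\<close> qr, folded lc_def]
    have "r = [:lc ^ (Suc (Polynomial.degree (c i)) - Polynomial.degree d):] * c i - q * d"
      using pd(1) by (simp add: mult.commute)
    also have "\<dots> \<in> N"
      by (intro N_diff N_mult N_c that d)
    finally have "r \<in> polys p"
      using least[of r] pd(2) P.zero_ideal by force
    then show ?thesis
      using pd(1) by (metis add_diff_cancel_left')
  qed
  then obtain e q where eq: "\<And>i. i \<in> S \<Longrightarrow> smult (lc ^ e i) (c i) - d * q i \<in> polys p"
    by metis
  define m where "m = (\<Sum>i\<in>S. e i)"
  define t where "t = lc ^ m"
  define f where "f i = smult (lc ^ (m - e i)) (q i)" for i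
  have tnp: "t \<notin> p"
    unfolding t_def using lc proper prime by (induction m) auto
  have df: "[:t:] * c i - d * f i \<in> polys p" if "i \<in> S" for i
  proof -
    have "e i \<le> m"
      unfolding m_def using that S by (simp add: member_le_sum)
    then have "lc ^ (m - e i) * lc ^ e i = t"
      unfolding t_def by (metis le_add_diff_inverse2 power_add)
    then have "[:t:] * c i - d * f i = [:lc ^ (m - e i):] * (smult (lc ^ e i) (c i) - d * q i)"
      by (simp add: f_def smult_diff_right)
    then show ?thesis
      using P.mult_ideal[OF UNIV_I eq[OF that], of "[:lc ^ (m - e i):]"] by simp
  qed
  obtain a r where dr: "r \<in> polys p" "d = (\<Sum>i\<in>S. a i * c i) + r"
    using d(1) by (auto simp: N_def)
  have cancel: "g \<in> polys p" if "d * g \<in> polys p" for g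
    using pprime[OF that] d(2) by blast
  have af: "[:t:] - (\<Sum>l\<in>S. a l * f l) \<in> polys p"
  proof (rule cancel)
    have "d * ([:t:] - (\<Sum>l\<in>S. a l * f l)) = [:t:] * ((\<Sum>i\<in>S. a i * c i) + r) - d * (\<Sum>l\<in>S. a l * f l)"
      by (subst dr(2)[symmetric]) (simp add: algebra_simps)
    also have "\<dots> = (\<Sum>l\<in>S. a l * ([:t:] * c l - d * f l)) + [:t:] * r"
      by (simp add: algebra_simps sum_distrib_left sum_subtractf del: mult_pCons_left mult_pCons_right)
    also have "\<dots> \<in> polys p"
      by (intro P.add_ideal P.mult_ideal P.sum_ideal df dr UNIV_I)
    finally show "d * ([:t:] - (\<Sum>l\<in>S. a l * f l)) \<in> polys p" .
  qed
  define g where "g k = (\<Sum>l\<in>S. a l * M l k)" for k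
  have ident: "d * (A * fl - fi * B) = u * (A * cl - ci * B) - A * (u * cl - d * fl) + B * (u * ci - d * fi)"
    for u A B fl fi cl ci :: "'r poly"
    by (simp add: algebra_simps)
  have Mf: "M i k * f l - f i * M l k \<in> polys p" if "i \<in> S" "k \<in> S" "l \<in> S" for i k l
  proof (rule cancel)
    have "d * (M i k * f l - f i * M l k) =
       [:t:] * (M i k * c l - c i * M l k) - M i k * ([:t:] * c l - d * f l) + M l k * ([:t:] * c i - d * f i)"
      by (rule ident)
    also have "\<dots> \<in> polys p"
      using that j0 unfolding c_def[of l] c_def[of i]
      by (intro P.add_ideal P.diff_ideal P.mult_ideal UNIV_I df[unfolded c_def] minors)
    finally show "d * (M i k * f l - f i * M l k) \<in> polys p" .
  qed
  have fg: "f i * g k - [:t:] * M i k \<in> polys p" if "i \<in> S" "k \<in> S" for i k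
  proof -
    have "f i * g k - u * M i k = - (\<Sum>l\<in>S. a l * (M i k * f l - f i * M l k))
         - M i k * (u - (\<Sum>l\<in>S. a l * f l))" for u
    proof -
      have "(\<Sum>l\<in>S. a l * (M i k * f l - f i * M l k)) = M i k * (\<Sum>l\<in>S. a l * f l) - f i * g k"
        unfolding g_def by (simp add: right_diff_distrib sum_subtractf sum_distrib_left mult.left_commute)
      then show ?thesis by (simp add: algebra_simps)
    qed
    then have "f i * g k - [:t:] * M i k = - (\<Sum>l\<in>S. a l * (M i k * f l - f i * M l k))
         - M i k * ([:t:] - (\<Sum>l\<in>S. a l * f l))" .
    also have "\<dots> \<in> polys p"
      by (intro P.diff_ideal P.minus_ideal P.sum_ideal P.mult_ideal Mf af that UNIV_I)
    finally show ?thesis .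
  qed
  define F where "F i = poly.coeff (f i) 0" for i
  define G where "G k = poly.coeff (g k) 0" for k
  have FG: "F i * G k - t * (x i * y k) \<in> p" if "i \<in> S" "k \<in> S" for i k
  proof -
    have "F i * G k - t * poly.coeff (M i k) 0 \<in> p"
      using polysD[OF fg[OF that], of 0] by (simp add: F_def G_def coeff_mult_0)
    moreover have "t * poly.coeff (M i k) 0 - t * (x i * y k) \<in> p"
      using mult_ideal[OF UNIV_I init[OF that], of t] by (simp add: right_diff_distrib)
    ultimately show ?thesis by (rule cong_trans)
  qed
  have xy: "(\<Sum>i\<in>S. x i * y i) - 1 \<in> p"
  proof -
    have 1: "(\<Sum>i\<in>S. poly.coeff (M i i) 0) - 1 \<in> p"
      using polysD[OF trace, of 0] by (simp add: coeff_sum)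
    have 2: "(\<Sum>i\<in>S. x i * y i) - (\<Sum>i\<in>S. poly.coeff (M i i) 0) \<in> p"
      by (rule cong_sum, rule cong_sym, rule init)
    show ?thesis by (rule cong_trans[OF 2 1])
  qed
  define u where "u = (\<Sum>k\<in>S. G k * x k)"
  define v where "v = (\<Sum>i\<in>S. y i * F i)"
  have Fu: "u * F i - t * x i \<in> p" if "i \<in> S" for i
  proof -
    have "u * F i - t * x i = (\<Sum>k\<in>S. x k * (F i * G k - t * (x i * y k))) + t * x i * ((\<Sum>i\<in>S. x i * y i) - 1)"
      unfolding u_def by (simp add: right_diff_distrib sum_subtractf sum_distrib_left sum_distrib_right ac_simps)
    also have "\<dots> \<in> p"
      by (intro add_ideal sum_ideal mult_ideal FG xy that UNIV_I)
    finally show ?thesis .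
  qed
  have Gv: "v * G k - t * y k \<in> p" if "k \<in> S" for k
  proof -
    have "v * G k - t * y k = (\<Sum>i\<in>S. y i * (F i * G k - t * (x i * y k))) + t * y k * ((\<Sum>i\<in>S. x i * y i) - 1)"
      unfolding v_def by (simp add: right_diff_distrib sum_subtractf sum_distrib_left sum_distrib_right ac_simps)
    also have "\<dots> \<in> p"
      by (intro add_ideal sum_ideal mult_ideal FG xy that UNIV_I)
    finally show ?thesis .
  qed
  have uv: "u * v - t \<in> p"
  proof -
    have "u * v - t = (\<Sum>i\<in>S. y i * (u * F i - t * x i)) + t * ((\<Sum>i\<in>S. x i * y i) - 1)"
      unfolding v_def by (simp add: right_diff_distrib sum_subtractf sum_distrib_left ac_simps)
    also have "\<dots> \<in> p"
      by (intro add_ideal sum_ideal mult_ideal Fu xy UNIV_I)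
    finally show ?thesis .
  qed
  have const: "[:r:] \<in> polys p" if "r \<in> p" for r
    using that by (auto simp: polys_def coeff_pCons zero_ideal split: nat.splits)
  have hk: "smult u (f i) * smult v (g j) - smult (t^2) (M i j) \<in> polys p" if "i \<in> S" "j \<in> S" for i j
  proof -
    have "smult u (f i) * smult v (g j) - smult (t^2) (M i j)
       = [:u:] * [:v:] * (f i * g j - [:t:] * M i j) + ([:t:] * M i j) * [:u * v - t:]"
      by (simp add: algebra_simps smult_diff_right smult_diff_left power2_eq_square)
    also have "\<dots> \<in> polys p"
      by (intro P.add_ideal P.mult_ideal fg const uv that UNIV_I)
    finally show ?thesis .
  qed
  show ?thesis
    by (rule exI[of _ t], rule exI[of _ "\<lambda>i. smult u (f i)"], rule exI[of _ "\<lambda>i. smult v (g i)"])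
       (use tnp hk Fu Gv in \<open>auto simp: F_def G_def\<close>)
qed

section \<open>The theorem of Dedekind and Mertens\<close>

text \<open>Subgroups of the additive group suffice here: coefficients of products are handled additively, so
  that no ring has to act.\<close>

definition additive_set :: "'r::ab_group_add set \<Rightarrow> bool" where
  "additive_set C \<longleftrightarrow> 0 \<in> C \<and> (\<forall>x\<in>C. \<forall>y\<in>C. x - y \<in> C)"

lemma additive_setD:
  assumes "additive_set C"
  shows "0 \<in> C" "\<And>x y. x \<in> C \<Longrightarrow> y \<in> C \<Longrightarrow> x - y \<in> C" "\<And>x y. x \<in> C \<Longrightarrow> y \<in> C \<Longrightarrow> x + y \<in> C"
proof -
  show 0: "0 \<in> C" using assms by (simp add: additive_set_def)
  show diff: "x - y \<in> C" if "x \<in> C" "y \<in> C" for x y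
    using assms that by (auto simp: additive_set_def)
  show "x + y \<in> C" if "x \<in> C" "y \<in> C" for x y
    using diff[OF that(1) diff[OF 0 that(2)]] by simp
qed

lemma additive_set_sum: "additive_set C \<Longrightarrow> (\<And>i. i \<in> A \<Longrightarrow> f i \<in> C) \<Longrightarrow> sum f A \<in> C"
  by (induction A rule: infinite_finite_induct) (auto simp: additive_setD)

inductive_set additive_span :: "'r::ab_group_add set \<Rightarrow> 'r set" for S where
  zero: "0 \<in> additive_span S"
| plus: "x \<in> additive_span S \<Longrightarrow> s \<in> S \<Longrightarrow> x + s \<in> additive_span S"
| minus: "x \<in> additive_span S \<Longrightarrow> s \<in> S \<Longrightarrow> x - s \<in> additive_span S"

lemma span_base: "s \<in> S \<Longrightarrow> s \<in> additive_span S"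
  using additive_span.plus[OF additive_span.zero] by force

lemma additive_set_span: "additive_set (additive_span S)"
proof -
  have "x - y \<in> additive_span S" if "y \<in> additive_span S" "x \<in> additive_span S" for x y
    using that
  proof (induction arbitrary: x rule: additive_span.induct)
    case zero
    then show ?case by simp
  next
    case (plus y s)
    then show ?case using additive_span.minus[of "x - y" S s] by (simp add: diff_diff_eq)
  next
    case (minus y s)
    then show ?case using additive_span.plus[of "x - y" S s] by (simp add: algebra_simps)
  qed
  then show ?thesis
    by (auto simp: additive_set_def additive_span.zero)
qed

lemma span_mult:
  fixes a :: "'r::comm_ring_1"
  assumes "additive_set T" "\<And>s. s \<in> S \<Longrightarrow> a * s \<in> T" "x \<in> additive_span S"
  shows "a * x \<in> T"
  using assms(3)
  by induction (use assms(1,2) in \<open>auto simp: additive_setD distrib_left right_diff_distrib\<close>)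

text \<open>This is \<open>Y\<^sup>n C\<close>, the additive group generated by all \<open>n\<close>-fold products from \<open>Y\<close> times an element of \<open>C\<close>.\<close>

definition products :: "'r::comm_ring_1 set \<Rightarrow> nat \<Rightarrow> 'r set \<Rightarrow> 'r set" where
  "products Y n C = additive_span {prod_list as * c | as c. length as = n \<and> set as \<subseteq> Y \<and> c \<in> C}"

lemma products_base:
  "length as = n \<Longrightarrow> set as \<subseteq> Y \<Longrightarrow> c \<in> C \<Longrightarrow> prod_list as * c \<in> products Y n C"
  unfolding products_def by (rule span_base) auto

lemma additive_products: "additive_set (products Y n C)"
  by (simp add: products_def additive_set_span)

lemma products_mult:
  assumes "additive_set T" "w \<in> products Y n C"
    and "\<And>as c. length as = n \<Longrightarrow> set as \<subseteq> Y \<Longrightarrow> c \<in> C \<Longrightarrow> a * (prod_list as * c) \<in> T"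
  shows "a * w \<in> T"
  using assms unfolding products_def by (elim span_mult[rotated 2]) auto

lemma products_least:
  assumes "additive_set T" "w \<in> products Y n C"
    and "\<And>as c. length as = n \<Longrightarrow> set as \<subseteq> Y \<Longrightarrow> c \<in> C \<Longrightarrow> prod_list as * c \<in> T"
  shows "w \<in> T"
  using products_mult[of T w Y n C 1] assms by simp

lemma products_Suc:
  assumes "a \<in> Y" "w \<in> products Y n C" shows "a * w \<in> products Y (Suc n) C"
proof (rule products_mult[OF additive_products assms(2)])
  fix as c assume "length as = n" "set as \<subseteq> Y" "c \<in> C"
  then have "prod_list (a # as) * c \<in> products Y (Suc n) C"
    using assms(1) by (intro products_base) auto
  then show "a * (prod_list as * c) \<in> products Y (Suc n) C"
    by (simp add: mult.assoc)
qed

lemma products_products: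
  assumes "w \<in> products Y n (products Y m C)" shows "w \<in> products Y (n + m) C"
proof (rule products_least[OF additive_products assms])
  fix as c assume "length as = n" "set as \<subseteq> Y" and c: "c \<in> products Y m C"
  then show "prod_list as * c \<in> products Y (n + m) C"
  proof (induction as arbitrary: n)
    case (Cons a as)
    then show ?case using products_Suc[of a Y "prod_list as * c" "length as + m"]
      by (auto simp: mult.assoc)
  qed auto
qed

text \<open>In terms of content: \<open>c(f)\<^sup>n\<^sup>+\<^sup>1 c(g) \<subseteq> c(f)\<^sup>n c(f g)\<close> for \<open>g\<close> of degree at most \<open>n\<close>. The
  additive group \<open>C\<close> plays the role of \<open>c(f g)\<close>, which allows \<open>C\<close> to be a subring that merely contains the
  coefficients of the product.\<close>

theorem dedekind_mertens:
  fixes f g :: "'r::comm_ring_1 poly"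
  assumes "Polynomial.degree g \<le> n" "additive_set C" "\<And>k. poly.coeff (f * g) k \<in> C"
    and "length as = Suc n" "set as \<subseteq> range (poly.coeff f)"
  shows "prod_list as * poly.coeff g j \<in> products (range (poly.coeff f)) n C"
  using assms
proof (induction f arbitrary: g n C as j)
  case 0
  then have "prod_list as = 0"
    by (cases as) auto
  then show ?case by (simp add: additive_setD(1)[OF additive_products])
next
  case (pCons a f)
  note outer = pCons.IH
  let ?F = "pCons a f" and ?Y = "range (poly.coeff (pCons a f))"
  have a: "a \<in> ?Y"
    by (rule range_eqI[of _ _ 0]) simp
  have Y: "?Y = insert a (range (poly.coeff f))"
  proof
    show "?Y \<subseteq> insert a (range (poly.coeff f))"
      by (auto simp: coeff_pCons split: nat.splits)
    show "insert a (range (poly.coeff f)) \<subseteq> ?Y"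
    proof -
      have "poly.coeff f i \<in> ?Y" for i
        by (rule range_eqI[of _ _ "Suc i"]) simp
      then show ?thesis using a by blast
    qed
  qed
  show ?case
    using pCons.prems
  proof (induction n arbitrary: g C as j)
    case 0
    then have "Polynomial.degree g = 0" by simp
    then obtain b where g: "g = [:b:]"
      by (rule degree_eq_zeroE)
    obtain i where i: "as = [poly.coeff ?F i]"
      using 0 by (auto simp: length_Suc_conv)
    have "poly.coeff ?F i * poly.coeff g j \<in> C"
    proof (cases j)
      case 0
      then show ?thesis using \<open>poly.coeff (?F * g) i \<in> C\<close>
        by (simp add: g mult.commute coeff_pCons split: nat.splits)
    next
      case (Suc j')
      then show ?thesis using additive_setD(1)[OF \<open>additive_set C\<close>] by (simp add: g)
    qed
    then show ?case
      using products_base[of "[]" 0 ?Y _ C] by (simp add: i)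
  next
    case (Suc n)
    note C = \<open>additive_set C\<close>
    obtain b g' where g: "g = pCons b g'"
      using pCons_cases by blast
    have deg': "Polynomial.degree g' \<le> n"
      using Suc.prems(1) by (auto simp: g split: if_splits)
    have ab: "a * b \<in> C"
      using Suc.prems(3)[of 0] by (simp add: g coeff_mult_0 mult.commute)
    have low: "prod_list as' * (a * poly.coeff g j) \<in> products ?Y (Suc n) C"
      if as': "length as' = Suc n" "set as' \<subseteq> ?Y" for as' j
    proof (cases j)
      case 0
      then show ?thesis using products_base[OF as' ab] by (simp add: g)
    next
      case (Suc j')
      have "poly.coeff (?F * smult a g') k \<in> products ?Y 1 C" for k
      proof -
        have "poly.coeff (?F * g) (Suc k) = b * poly.coeff ?F (Suc k) + poly.coeff (?F * g') k"
          unfolding g mult_pCons_right by simp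
        then have "poly.coeff (?F * smult a g') k
            = a * poly.coeff (?F * g) (Suc k) - poly.coeff ?F (Suc k) * (a * b)"
          by (simp add: algebra_simps)
        moreover have "prod_list [a] * poly.coeff (?F * g) (Suc k) \<in> products ?Y 1 C"
          using a Suc.prems(3)[of "Suc k"] by (intro products_base) (simp_all del: mult_pCons_left)
        moreover have "prod_list [poly.coeff ?F (Suc k)] * (a * b) \<in> products ?Y 1 C"
          by (rule products_base) (simp_all add: ab del: coeff_pCons_Suc)
        ultimately show ?thesis
          using additive_setD(2)[OF additive_products] by simp
      qed
      then have "prod_list as' * poly.coeff (smult a g') j' \<in> products ?Y n (products ?Y 1 C)"
        using deg' as'
        by (intro Suc.IH additive_products) (auto intro: order.trans[OF degree_smult_le])
      then show ?thesis
        using products_products[of _ ?Y n 1 C] Suc by (simp add: g)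
    qed
    show ?case
    proof (cases "a \<in> set as")
      case True
      have "prod_list as = a * prod_list (remove1 a as)"
        using True by (induction as) (auto simp: mult.left_commute)
      moreover have "length (remove1 a as) = Suc n" "set (remove1 a as) \<subseteq> ?Y"
        using Suc.prems(4,5) True set_remove1_subset[of a as] by (auto simp: length_remove1)
      ultimately show ?thesis
        using low[of "remove1 a as" j] by (simp add: ac_simps)
    next
      case False
      define C2 where "C2 = additive_span (C \<union> range (\<lambda>j. a * poly.coeff g j))"
      have "poly.coeff (f * g) k \<in> C2" for k
      proof -
        have "poly.coeff (f * g) k = poly.coeff (?F * g) (Suc k) - a * poly.coeff g (Suc k)"
          by simp
        moreover have "poly.coeff (?F * g) (Suc k) \<in> C2" "a * poly.coeff g (Suc k) \<in> C2"
          unfolding C2_def using Suc.prems(3)[of "Suc k"]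
          by (intro span_base; simp del: mult_pCons_left)+
        ultimately show ?thesis
          using additive_setD(2)[OF additive_set_span] unfolding C2_def by metis
      qed
      then have "prod_list as * poly.coeff g j \<in> products (range (poly.coeff f)) (Suc n) C2"
        using Suc.prems(1,4,5) False Y
        by (intro outer) (auto simp: C2_def additive_set_span)
      then show ?thesis
      proof (rule products_least[OF additive_products])
        fix as' c assume as': "length as' = Suc n" "set as' \<subseteq> range (poly.coeff f)" and c: "c \<in> C2"
        then have as'Y: "set as' \<subseteq> ?Y" using Y by auto
        show "prod_list as' * c \<in> products ?Y (Suc n) C"
          using c unfolding C2_def
          by (elim span_mult[rotated 2, OF _ additive_products])
             (use products_base[OF as'(1) as'Y] low[OF as'(1) as'Y] in auto)
      qed
    qed
  qed
qed

section \<open>The extension generated by a factorization\<close>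

text \<open>Zorn's lemma. If \<open>x\<close> cannot be added to \<open>T\<close> then some \<open>s * x ^ k\<close> has to meet \<open>c\<close>. When \<open>c\<close> is an
  ideal, localizing at \<open>T\<close> means localizing \<open>A\<close> at a minimal prime over \<open>c\<close>: every element of \<open>A\<close> outside \<open>T\<close> becomes
  nilpotent modulo \<open>c\<close>.\<close>

lemma maximal_multiplicative_set:
  fixes A c :: "'r::comm_ring_1 set"
  assumes "csubring A" "1 \<notin> c"
  obtains T where "T \<subseteq> A" "1 \<in> T" "T \<inter> c = {}" "\<And>x y. x \<in> T \<Longrightarrow> y \<in> T \<Longrightarrow> x * y \<in> T"
    "\<And>x. x \<in> A \<Longrightarrow> x \<notin> T \<Longrightarrow> \<exists>s\<in>T. \<exists>k. s * x ^ k \<in> c"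
proof -
  interpret csubring A by fact
  define W where "W = {T. T \<subseteq> A \<and> 1 \<in> T \<and> T \<inter> c = {} \<and> (\<forall>x\<in>T. \<forall>y\<in>T. x * y \<in> T)}"
  have WD: "V \<subseteq> A" "1 \<in> V" "V \<inter> c = {}" "x \<in> V \<Longrightarrow> y \<in> V \<Longrightarrow> x * y \<in> V" if "V \<in> W" for V x y
    using that by (auto simp: W_def)
  have WI: "V \<in> W" if "V \<subseteq> A" "1 \<in> V" "V \<inter> c = {}" "\<And>x y. x \<in> V \<Longrightarrow> y \<in> V \<Longrightarrow> x * y \<in> V" for V
    using that by (auto simp: W_def)
  have "{1} \<in> W"
    using assms one_mem by (intro WI) auto
  then have "W \<noteq> {}" by blast
  moreover have "\<Union>CC \<in> W" if ne: "CC \<noteq> {}" and chain: "subset.chain W CC" for CC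
  proof (rule WI)
    have CW: "V \<in> W" if "V \<in> CC" for V
      using chain that by (auto simp: subset_chain_def)
    show "\<Union>CC \<subseteq> A" "\<Union>CC \<inter> c = {}"
      using WD(1,3)[OF CW] by fastforce+
    show "1 \<in> \<Union>CC"
      using ne WD(2)[OF CW] by fastforce
    fix x y assume "x \<in> \<Union>CC" "y \<in> \<Union>CC"
    then obtain V Z where VZ: "x \<in> V" "V \<in> CC" "y \<in> Z" "Z \<in> CC" by auto
    then have "V \<subseteq> Z \<or> Z \<subseteq> V"
      using chain by (auto simp: subset_chain_def)
    then show "x * y \<in> \<Union>CC"
    proof
      assume "V \<subseteq> Z"
      then have "x * y \<in> Z" using VZ by (intro WD(4)[OF CW]) auto
      then show ?thesis using VZ by auto
    next
      assume "Z \<subseteq> V"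
      then have "x * y \<in> V" using VZ by (intro WD(4)[OF CW]) auto
      then show ?thesis using VZ by auto
    qed
  qed
  ultimately have "\<exists>T\<in>W. \<forall>V\<in>W. T \<subseteq> V \<longrightarrow> V = T"
    by (rule subset_Zorn_nonempty)
  then obtain T where T: "T \<in> W" and max: "\<And>V. V \<in> W \<Longrightarrow> T \<subseteq> V \<Longrightarrow> V = T"
    by auto
  have T': "T \<subseteq> A" "1 \<in> T" "T \<inter> c = {}" "\<And>x y. x \<in> T \<Longrightarrow> y \<in> T \<Longrightarrow> x * y \<in> T"
    using WD[OF T] by auto
  have "\<exists>s\<in>T. \<exists>k. s * x ^ k \<in> c" if x: "x \<in> A" "x \<notin> T" for x
  proof (rule ccontr)
    assume neg: "\<not> ?thesis"
    define U where "U = {s * x ^ k | s k. s \<in> T}"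
    have UI: "s * x ^ k \<in> U" if "s \<in> T" for s k
      using that by (auto simp: U_def)
    have "T \<subseteq> U"
      using UI[of _ 0] by auto
    have "x \<in> U"
      using UI[OF T'(2), of 1] by simp
    have "u * v \<in> U" if uv: "u \<in> U" "v \<in> U" for u v
    proof -
      obtain s k s' k' where *: "u = s * x ^ k" "v = s' * x ^ k'" "s \<in> T" "s' \<in> T"
        using uv by (auto simp: U_def)
      have "u * v = (s * s') * x ^ (k + k')"
        by (simp add: * power_add ac_simps)
      then show ?thesis
        using UI[OF T'(4)[OF *(3,4)]] by simp
    qed
    moreover have "U \<subseteq> A"
      using T'(1) x(1) by (auto simp: U_def intro!: mult_mem power_mem)
    moreover have "U \<inter> c = {}"
      using neg by (auto simp: U_def)
    ultimately have "U \<in> W"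
      using \<open>T \<subseteq> U\<close> T'(2) by (intro WI) auto
    then show False
      using max[OF _ \<open>T \<subseteq> U\<close>] \<open>x \<in> U\<close> x(2) by simp
  qed
  then show thesis
    using T' by (intro that[of T]) auto
qed

text \<open>The situation in which a factorization descends from a large ring to the subring \<open>A\<close>, everything
  modulo \<open>J\<close>. The last assumption says that over the quotient of \<open>A\<close> by any prime the matrix \<open>f i * g j\<close> factorizes up to a
  denominator \<open>t\<close> with the right constant terms; seminormality is the assumption on \<open>u\<close>.\<close>

locale descent = cideal UNIV J for J :: "'w::comm_ring_1 set" +
  fixes A :: "'w set" and S :: "'i set" and f g :: "'i \<Rightarrow> 'w poly" and x y :: "'i \<Rightarrow> 'w"
  assumes sub: "csubring A" and JA: "J \<subseteq> A"
    and semin: "\<And>u. u * u \<in> A \<Longrightarrow> u * u * u \<in> A \<Longrightarrow> u \<in> A"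
    and finite_S: "finite S"
    and fg: "\<And>i j. i \<in> S \<Longrightarrow> j \<in> S \<Longrightarrow> f i * g j \<in> polys A"
    and trace: "(\<Sum>i\<in>S. f i * g i) - 1 \<in> polys J"
    and x: "\<And>i. i \<in> S \<Longrightarrow> x i \<in> A" and y: "\<And>i. i \<in> S \<Longrightarrow> y i \<in> A"
    and f0: "\<And>i. i \<in> S \<Longrightarrow> poly.coeff (f i) 0 - x i \<in> J"
    and g0: "\<And>i. i \<in> S \<Longrightarrow> poly.coeff (g i) 0 - y i \<in> J"
    and local: "\<And>p. cideal A p \<Longrightarrow> J \<subseteq> p \<Longrightarrow> 1 \<notin> p \<Longrightarrow>
        (\<And>a b. a \<in> A \<Longrightarrow> b \<in> A \<Longrightarrow> a * b \<in> p \<Longrightarrow> a \<in> p \<or> b \<in> p) \<Longrightarrow>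
        \<exists>t h k. t \<in> A \<and> t \<notin> p \<and> (\<forall>i\<in>S. h i \<in> polys A \<and> k i \<in> polys A) \<and>
          (\<forall>i\<in>S. \<forall>j\<in>S. h i * k j - [:t * t:] * (f i * g j) \<in> polys p) \<and>
          (\<forall>i\<in>S. poly.coeff (h i) 0 - t * x i \<in> p \<and> poly.coeff (k i) 0 - t * y i \<in> p)"
begin

sublocale A: csubring A by (rule sub)

lemma xy: "(\<Sum>i\<in>S. poly.coeff (f i) 0 * y i) - 1 \<in> J" "(\<Sum>i\<in>S. x i * poly.coeff (g i) 0) - 1 \<in> J"
proof -
  have t: "(\<Sum>i\<in>S. poly.coeff (f i) 0 * poly.coeff (g i) 0) - 1 \<in> J"
    using polysD[OF trace, of 0] by (simp add: coeff_sum coeff_mult_0)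
  have 1: "(\<Sum>i\<in>S. poly.coeff (f i) 0 * poly.coeff (g i) 0) - (\<Sum>i\<in>S. poly.coeff (f i) 0 * y i) \<in> J"
    by (rule cong_sum) (use mult_ideal[OF UNIV_I g0] in \<open>simp add: right_diff_distrib\<close>)
  have 2: "(\<Sum>i\<in>S. poly.coeff (f i) 0 * poly.coeff (g i) 0) - (\<Sum>i\<in>S. x i * poly.coeff (g i) 0) \<in> J"
    by (rule cong_sum) (use mult_ideal'[OF UNIV_I f0] in \<open>simp add: left_diff_distrib\<close>)
  show "(\<Sum>i\<in>S. poly.coeff (f i) 0 * y i) - 1 \<in> J"
    by (rule cong_trans[OF cong_sym[OF 1] t])
  show "(\<Sum>i\<in>S. x i * poly.coeff (g i) 0) - 1 \<in> J"
    by (rule cong_trans[OF cong_sym[OF 2] t])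
qed

lemma additive_A: "additive_set A"
  by (simp add: additive_set_def A.zero_mem A.diff_mem)

text \<open>Kronecker substitution: with exponents far enough apart the coefficients of all members of the family are
  coefficients of one polynomial, so that a theorem about single polynomials applies to families.\<close>

lemma packed:
  fixes q :: "'i \<Rightarrow> 'w poly"
  obtains e :: "'i \<Rightarrow> nat" where
    "\<And>i. i \<in> S \<Longrightarrow> range (poly.coeff (q i)) \<subseteq> insert 0 (range (poly.coeff (\<Sum>i\<in>S. Polynomial.monom 1 (e i) * q i)))"
proof -
  obtain m :: "'i \<Rightarrow> nat" where m: "inj_on m S"
    using finite_S finite_imp_inj_to_nat_seg by blast
  define D where "D = Suc (\<Sum>i\<in>S. Polynomial.degree (q i))"
  have D: "poly.coeff (q i) k = 0" if "i \<in> S" "D \<le> k" for i k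
  proof -
    have "Polynomial.degree (q i) \<le> (\<Sum>i\<in>S. Polynomial.degree (q i))"
      using that finite_S by (intro member_le_sum) auto
    then show ?thesis using that by (intro coeff_eq_0) (simp add: D_def)
  qed
  define e where "e i = D * m i" for i
  have "range (poly.coeff (q i)) \<subseteq> insert 0 (range (poly.coeff (\<Sum>i\<in>S. Polynomial.monom 1 (e i) * q i)))"
    if i: "i \<in> S" for i
  proof clarsimp
    fix k assume nz: "poly.coeff (q i) k \<notin> range (poly.coeff (\<Sum>i\<in>S. Polynomial.monom 1 (e i) * q i))"
    show "poly.coeff (q i) k = 0"
    proof (rule ccontr)
      assume "poly.coeff (q i) k \<noteq> 0"
      then have k: "k < D"
        using D[OF i, of k] by (meson not_le)
      have "poly.coeff (\<Sum>i\<in>S. Polynomial.monom 1 (e i) * q i) (e i + k)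
          = (\<Sum>l\<in>S. if l = i then poly.coeff (q i) k else 0)"
        unfolding coeff_sum
      proof (rule sum.cong[OF refl])
        fix l assume l: "l \<in> S"
        show "poly.coeff (Polynomial.monom 1 (e l) * q l) (e i + k) = (if l = i then poly.coeff (q i) k else 0)"
        proof (cases "l = i")
          case False
          then have "m l \<noteq> m i" using m l i by (auto dest: inj_onD)
          show ?thesis
          proof (cases "e i + k < e l")
            case True
            then show ?thesis using False by (simp add: coeff_monom_mult)
          next
            case le: False
            then have "D * m l \<le> D * m i + k" by (simp add: e_def)
            then have "m l \<le> m i"
              using k \<open>m l \<noteq> m i\<close>
              by (metis add_less_cancel_left le_less_trans less_Suc_eq_le mult_Suc_right mult_less_cancel1 add.commute)
            then have "Suc (m l) \<le> m i" using \<open>m l \<noteq> m i\<close> by simp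
            then have "D * Suc (m l) \<le> D * m i" by (rule mult_le_mono2)
            then have "D \<le> e i + k - e l" by (simp add: e_def)
            then show ?thesis using False le D[OF l] by (simp add: coeff_monom_mult)
          qed
        qed (simp add: coeff_monom_mult)
      qed
      also have "\<dots> = poly.coeff (q i) k"
        using i finite_S by simp
      finally show False using nz by (metis rangeI)
    qed
  qed
  then show thesis by (rule that)
qed

text \<open>Let \<open>F, G\<close> be the packed polynomials. By Dedekind and Mertens every coefficient of \<open>G\<close> times an \<open>(n+1)\<close>-fold
  product of coefficients of \<open>F\<close> is an \<open>A\<close>-combination of \<open>n\<close>-fold products of coefficients of \<open>F\<close>. So the group \<open>D\<close>
  of these combinations is stable under all products of a coefficient of \<open>F\<close> and one of \<open>G\<close>. It is even stable under the single
  coefficients, because the constant terms of \<open>g\<close> generate the unit ideal together with multipliers \<open>x i\<close> from \<open>A\<close>, and those of \<open>f\<close>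
  likewise. So \<open>E = D + J\<close> is a ring containing all coefficients. As the elements of \<open>D\<close> are sums of \<open>n\<close>-fold products, an element \<open>s\<close>
  that carries the coefficients of \<open>f\<close> into \<open>A\<close> carries \<open>E\<close> into \<open>A\<close> after \<open>n\<close> steps.\<close>

lemma coeffs_in: 
  obtains E n s0 where "csubring E" "A \<subseteq> E" "\<And>i. i \<in> S \<Longrightarrow> f i \<in> polys E" "\<And>i. i \<in> S \<Longrightarrow> g i \<in> polys E"
    "\<And>s w. s \<in> A \<Longrightarrow> (\<And>i k. i \<in> S \<Longrightarrow> s * poly.coeff (f i) k \<in> A) \<Longrightarrow> w \<in> E \<Longrightarrow> s ^ n * w \<in> A"
proof -
  obtain ef where ef: "\<And>i. i \<in> S \<Longrightarrow> range (poly.coeff (f i)) \<subseteq> insert 0 (range (poly.coeff (\<Sum>i\<in>S. Polynomial.monom 1 (ef i) * f i)))"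
    using packed by blast
  obtain eg where eg: "\<And>i. i \<in> S \<Longrightarrow> range (poly.coeff (g i)) \<subseteq> insert 0 (range (poly.coeff (\<Sum>i\<in>S. Polynomial.monom 1 (eg i) * g i)))"
    using packed by blast
  define F where "F = (\<Sum>i\<in>S. Polynomial.monom 1 (ef i) * f i)"
  define G where "G = (\<Sum>i\<in>S. Polynomial.monom 1 (eg i) * g i)"
  define n where "n = Polynomial.degree G"
  let ?Y = "range (poly.coeff F)"
  let ?D = "products ?Y n A"
  note add_D = additive_setD[OF additive_products[of ?Y n A]]
  interpret PA: csubring "polys A" by (rule csubring_polys[OF sub])
  have m1: "Polynomial.monom 1 k \<in> polys A" for k
    by (auto simp: polys_def A.zero_mem A.one_mem)
  have "F * G = (\<Sum>i\<in>S. \<Sum>j\<in>S. Polynomial.monom 1 (ef i) * Polynomial.monom 1 (eg j) * (f i * g j))"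
    unfolding F_def G_def by (simp add: sum_product ac_simps)
  also have "\<dots> \<in> polys A"
    by (intro PA.sum_mem PA.mult_mem m1 fg)
  finally have FG: "poly.coeff (F * G) k \<in> A" for k
    by (rule polysD)
  have A_D: "a * w \<in> products ?Y k A" if "a \<in> A" "w \<in> products ?Y k A" for a w k
  proof (rule products_mult[OF additive_products that(2)])
    fix as c assume as: "length as = k" "set as \<subseteq> ?Y" "c \<in> A"
    have "prod_list as * (a * c) \<in> products ?Y k A"
      using as that by (intro products_base A.mult_mem)
    then show "a * (prod_list as * c) \<in> products ?Y k A" by (simp add: mult.left_commute)
  qed
  have abw: "a * (b * w) \<in> ?D" if a: "a \<in> ?Y" and b: "b \<in> range (poly.coeff G)" and w: "w \<in> ?D" for a b w
  proof -
    have "a * b * w \<in> ?D"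
    proof (rule products_mult[OF additive_products w])
      fix as c assume as: "length as = n" "set as \<subseteq> ?Y" "c \<in> A"
      obtain j where j: "b = poly.coeff G j" using b by auto
      have "prod_list (a # as) * poly.coeff G j \<in> ?D"
        by (rule dedekind_mertens) (use as a FG additive_A n_def in auto)
      then have "c * (prod_list (a # as) * b) \<in> ?D"
        unfolding j by (rule A_D[OF as(3)])
      then show "a * b * (prod_list as * c) \<in> ?D" by (simp add: ac_simps)
    qed
    then show ?thesis by (simp add: mult.assoc)
  qed
  define E where "E = {w. \<exists>w'\<in>?D. w - w' \<in> J}"
  have EI: "w \<in> E" if "w' \<in> ?D" "w - w' \<in> J" for w w'
    using that by (auto simp: E_def)
  have D_E: "w \<in> E" if "w \<in> ?D" for w
    using EI[OF that] zero_ideal by simp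
  have add_E: "additive_set E"
  proof -
    have "u - v \<in> E" if uv: "u \<in> E" "v \<in> E" for u v
    proof -
      obtain u' v' where *: "u' \<in> ?D" "v' \<in> ?D" "u - u' \<in> J" "v - v' \<in> J"
        using uv by (auto simp: E_def)
      show ?thesis
        by (rule EI[OF add_D(2)[OF *(1,2)]]) (use diff_ideal[OF *(3,4)] in \<open>simp add: algebra_simps\<close>)
    qed
    then show ?thesis
      using D_E[OF add_D(1)] by (auto simp: additive_set_def)
  qed
  have cong_E: "u \<in> E" if "u - v \<in> J" "v \<in> E" for u v
    using that cong_trans unfolding E_def by blast
  have A_E: "a * w \<in> E" if a: "a \<in> A" and w: "w \<in> E" for a w
  proof -
    obtain w' where *: "w' \<in> ?D" "w - w' \<in> J" using w by (auto simp: E_def)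
    show ?thesis
      by (rule EI[OF A_D[OF a *(1)]])
         (use mult_ideal[OF UNIV_I *(2)] in \<open>simp add: right_diff_distrib\<close>)
  qed
  have f_Y: "poly.coeff (f i) k \<in> insert 0 ?Y" if "i \<in> S" for i k
    using ef[OF that] by (auto simp: F_def)
  have g_Y: "poly.coeff (g i) k \<in> insert 0 (range (poly.coeff G))" if "i \<in> S" for i k
    using eg[OF that] by (auto simp: G_def)
  have Y_E: "a * w \<in> E" if a: "a \<in> ?Y" and w: "w \<in> E" for a w
  proof -
    obtain w' where *: "w' \<in> ?D" "w - w' \<in> J" using w by (auto simp: E_def)
    have "(\<Sum>i\<in>S. x i * (a * (poly.coeff (g i) 0 * w'))) \<in> ?D"
    proof (rule additive_set_sum[OF additive_products])
      fix i assume i: "i \<in> S"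
      show "x i * (a * (poly.coeff (g i) 0 * w')) \<in> ?D"
        using g_Y[OF i, of 0] abw[OF a _ *(1)] add_D(1) by (intro A_D[OF x[OF i]]) auto
    qed
    moreover have "a * w - (\<Sum>i\<in>S. x i * (a * (poly.coeff (g i) 0 * w'))) \<in> J"
    proof -
      have "a * w - (\<Sum>i\<in>S. x i * (a * (poly.coeff (g i) 0 * w')))
         = a * (w - w') - a * w' * ((\<Sum>i\<in>S. x i * poly.coeff (g i) 0) - 1)"
        by (simp add: right_diff_distrib sum_distrib_left mult.assoc mult.left_commute mult.commute)
      also have "\<dots> \<in> J"
        by (intro diff_ideal mult_ideal xy * UNIV_I)
      finally show ?thesis .
    qed
    ultimately show ?thesis by (rule EI)
  qed
  have G_E: "b * w \<in> E" if b: "b \<in> range (poly.coeff G)" and w: "w \<in> E" for b w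
  proof -
    obtain w' where *: "w' \<in> ?D" "w - w' \<in> J" using w by (auto simp: E_def)
    have "(\<Sum>i\<in>S. y i * (poly.coeff (f i) 0 * (b * w'))) \<in> ?D"
    proof (rule additive_set_sum[OF additive_products])
      fix i assume i: "i \<in> S"
      show "y i * (poly.coeff (f i) 0 * (b * w')) \<in> ?D"
        using f_Y[OF i, of 0] abw[OF _ b *(1)] add_D(1) by (intro A_D[OF y[OF i]]) auto
    qed
    moreover have "b * w - (\<Sum>i\<in>S. y i * (poly.coeff (f i) 0 * (b * w'))) \<in> J"
    proof -
      have "b * w - (\<Sum>i\<in>S. y i * (poly.coeff (f i) 0 * (b * w')))
         = b * (w - w') - b * w' * ((\<Sum>i\<in>S. poly.coeff (f i) 0 * y i) - 1)"
        by (simp add: right_diff_distrib sum_distrib_left mult.assoc mult.left_commute mult.commute)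
      also have "\<dots> \<in> J"
        by (intro diff_ideal mult_ideal xy * UNIV_I)
      finally show ?thesis .
    qed
    ultimately show ?thesis by (rule EI)
  qed
  have one_E: "1 \<in> E"
  proof -
    define u where "u = (\<Sum>i\<in>S. poly.coeff (f i) 0 * y i)"
    have "u ^ k \<in> products ?Y k A" for k
    proof (induction k)
      case 0
      show ?case using products_base[of "[]" 0 ?Y 1 A] A.one_mem by simp
    next
      case (Suc k)
      have "(\<Sum>i\<in>S. y i * (poly.coeff (f i) 0 * u ^ k)) \<in> products ?Y (Suc k) A"
      proof (rule additive_set_sum[OF additive_products])
        fix i assume i: "i \<in> S"
        show "y i * (poly.coeff (f i) 0 * u ^ k) \<in> products ?Y (Suc k) A"
          using f_Y[OF i, of 0] products_Suc[OF _ Suc] additive_setD(1)[OF additive_products]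
          by (intro A_D[OF y[OF i]]) auto
      qed
      also have "(\<Sum>i\<in>S. y i * (poly.coeff (f i) 0 * u ^ k)) = u ^ Suc k"
        by (simp add: u_def sum_distrib_right ac_simps)
      finally show ?case .
    qed
    moreover have "u ^ k - 1 \<in> J" for k
    proof (induction k)
      case (Suc k)
      have "u ^ Suc k - 1 = u * (u ^ k - 1) + (u - 1)" by (simp add: algebra_simps)
      also have "\<dots> \<in> J" using Suc xy(1) by (intro add_ideal mult_ideal) (auto simp: u_def)
      finally show ?case .
    qed (simp add: zero_ideal)
    ultimately show ?thesis
      using EI[of "u ^ n" 1] cong_sym by blast
  qed
  have mult_E: "u * v \<in> E" if u: "u \<in> E" and v: "v \<in> E" for u v
  proof -
    obtain u' where *: "u' \<in> ?D" "u - u' \<in> J" using u by (auto simp: E_def)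
    have "v * u' \<in> E"
    proof (rule products_mult[OF add_E *(1)])
      fix as c assume "length as = n" "set as \<subseteq> ?Y" and c: "c \<in> A"
      then have "prod_list as * (c * v) \<in> E"
      proof (induction as arbitrary: n)
        case Nil
        show ?case using A_E[OF c v] by simp
      next
        case (Cons a as)
        then show ?case using Y_E[of a "prod_list as * (c * v)"] by (simp add: mult.assoc)
      qed
      then show "v * (prod_list as * c) \<in> E" by (simp add: ac_simps)
    qed
    then show ?thesis
      by (rule cong_E[rotated]) (use mult_ideal[OF UNIV_I *(2), of v] in \<open>simp add: algebra_simps\<close>)
  qed
  show thesis
  proof (rule that[of E n])
    show "csubring E"
      by standard (use one_E mult_E add_E in \<open>auto simp: additive_setD(2)\<close>)
    show "A \<subseteq> E" using A_E[OF _ one_E] by auto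
    show "f i \<in> polys E" if "i \<in> S" for i
    proof (rule polysI)
      show "poly.coeff (f i) k \<in> E" for k
        using Y_E[OF _ one_E, of "poly.coeff (f i) k"] f_Y[OF that, of k] additive_setD(1)[OF add_E]
        by auto
    qed
    show "g i \<in> polys E" if "i \<in> S" for i
    proof (rule polysI)
      show "poly.coeff (g i) k \<in> E" for k
        using G_E[OF _ one_E, of "poly.coeff (g i) k"] g_Y[OF that, of k] additive_setD(1)[OF add_E]
        by auto
    qed
    show "s ^ n * w \<in> A" if s: "s \<in> A" and sf: "\<And>i k. i \<in> S \<Longrightarrow> s * poly.coeff (f i) k \<in> A" and w: "w \<in> E" for s w
    proof -
      have sY: "s * a \<in> A" if a: "a \<in> ?Y" for a
      proof -
        obtain k where k: "a = poly.coeff F k"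
          using a by auto
        then have "a = (\<Sum>i\<in>S. poly.coeff (Polynomial.monom 1 (ef i) * f i) k)"
          by (simp add: F_def coeff_sum)
        then have "s * a = (\<Sum>i\<in>S. s * poly.coeff (Polynomial.monom 1 (ef i) * f i) k)"
          by (simp add: sum_distrib_left)
        also have "\<dots> \<in> A"
          by (rule A.sum_mem) (auto simp: coeff_monom_mult sf A.zero_mem)
        finally show ?thesis .
      qed
      obtain w' where *: "w' \<in> ?D" "w - w' \<in> J" using w by (auto simp: E_def)
      have "s ^ n * w' \<in> A"
      proof (rule products_mult[OF additive_A *(1)])
        fix as c assume "length as = n" "set as \<subseteq> ?Y" and c: "c \<in> A"
        then show "s ^ n * (prod_list as * c) \<in> A"
        proof (induction as arbitrary: n)
          case (Cons a as)
          have "(s * a) * (s ^ length as * (prod_list as * c)) \<in> A"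
            using Cons by (intro A.mult_mem[OF sY]) auto
          then show ?case using Cons.prems by (auto simp: ac_simps)
        qed (simp add: c)
      qed
      moreover have "s ^ n * (w - w') \<in> A"
        using JA mult_ideal[OF UNIV_I *(2)] by blast
      ultimately have "s ^ n * (w - w') + s ^ n * w' \<in> A" by (intro A.add_mem)
      then show ?thesis by (simp add: algebra_simps)
    qed
  qed
qed

end

section \<open>Descent along a conductor\<close>

context descent
begin

text \<open>The goal is that the conductor \<open>c\<close> contains 1. Seminormality makes \<open>c\<close> radical in \<open>E\<close>: if \<open>u * u\<close> lies in \<open>c\<close> and \<open>w\<close> in
  \<open>E\<close>, then the square and the cube of \<open>u * w\<close> lie in \<open>A\<close>. For proper \<open>c\<close> take \<open>T\<close> maximal multiplicative
  avoiding \<open>c\<close>, and let \<open>Q\<close> be the elements that \<open>T\<close> carries into \<open>c\<close>. The trace of \<open>A\<close> in \<open>Q\<close> is a prime with complement \<open>T\<close>,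
  so over it a factorization \<open>h, k\<close> with denominator \<open>t\<close> exists, and \<open>f i * w\<close> is congruent to \<open>h i\<close> for \<open>w\<close> the sum of the
  \<open>g j * h j\<close>. As \<open>w * w'\<close> is the constant \<open>t * t\<close>, the polynomial \<open>w\<close> is the constant \<open>t\<close> modulo the
  radical ideal \<open>Q\<close>. So \<open>T\<close> carries the coefficients of \<open>f\<close> into \<open>A\<close>, hence a power of some element of \<open>T\<close> into \<open>c\<close>.\<close>

theorem descends: "i \<in> S \<Longrightarrow> f i \<in> polys A" "i \<in> S \<Longrightarrow> g i \<in> polys A"
proof -
  obtain E n where E: "csubring E" "A \<subseteq> E" and f: "\<And>i. i \<in> S \<Longrightarrow> f i \<in> polys E"
    and g: "\<And>i. i \<in> S \<Longrightarrow> g i \<in> polys E"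
    and finite_type: "\<And>s w. s \<in> A \<Longrightarrow> (\<And>i k. i \<in> S \<Longrightarrow> s * poly.coeff (f i) k \<in> A) \<Longrightarrow> w \<in> E \<Longrightarrow> s ^ n * w \<in> A"
    using coeffs_in by metis
  interpret E: csubring E by fact
  (* the conductor of A in E *)
  define c where "c = {s \<in> E. \<forall>w\<in>E. s * w \<in> A}"
  have cI: "s \<in> c" if "s \<in> E" "\<And>w. w \<in> E \<Longrightarrow> s * w \<in> A" for s
    using that by (auto simp: c_def)
  have cD: "s \<in> E" "w \<in> E \<Longrightarrow> s * w \<in> A" if "s \<in> c" for s w
    using that by (auto simp: c_def)
  interpret c: cideal E c
  proof
    show "c \<subseteq> E" by (auto simp: c_def)
    show "0 \<in> c" by (rule cI) (auto simp: E.zero_mem A.zero_mem)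
  next
    fix u v assume "u \<in> c" "v \<in> c"
    then show "u + v \<in> c"
      by (intro cI) (auto simp: distrib_right intro: E.add_mem A.add_mem cD)
  next
    fix e u assume e: "e \<in> E" and u: "u \<in> c"
    show "e * u \<in> c"
    proof (rule cI)
      show "e * u \<in> E" using e cD(1)[OF u] by (rule E.mult_mem)
      fix w assume "w \<in> E"
      then have "u * (e * w) \<in> A" using e by (intro cD(2)[OF u] E.mult_mem)
      then show "e * u * w \<in> A" by (simp add: ac_simps)
    qed
  qed
  have rad_c: "radical_in E c"
    unfolding radical_in_def
  proof (intro ballI impI cI)
    fix u w assume u: "u \<in> E" "u * u \<in> c" and w: "w \<in> E"
    show "u * w \<in> A"
    proof (rule semin)
      have "(u * u) * (w * w) \<in> A"
        using w by (intro cD(2)[OF u(2)] E.mult_mem)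
      moreover have "(u * u) * (u * (w * (w * w))) \<in> A"
        using u(1) w by (intro cD(2)[OF u(2)] E.mult_mem)
      ultimately show "u * w * (u * w) \<in> A" "u * w * (u * w) * (u * w) \<in> A"
        by (simp_all add: ac_simps)
    qed
  qed
  have JE: "J \<subseteq> E" using JA E by blast
  have Jc: "s \<in> c" if "s \<in> J" for s
    using that JE JA mult_ideal'[OF UNIV_I that] by (intro cI) auto
  have "1 \<in> c"
  proof (rule ccontr)
    assume "1 \<notin> c"
    then obtain T where T: "T \<subseteq> A" "1 \<in> T" "T \<inter> c = {}" "\<And>x y. x \<in> T \<Longrightarrow> y \<in> T \<Longrightarrow> x * y \<in> T"
      and max: "\<And>x. x \<in> A \<Longrightarrow> x \<notin> T \<Longrightarrow> \<exists>s\<in>T. \<exists>k. s * x ^ k \<in> c"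
      using maximal_multiplicative_set[OF sub] by metis
    have TE: "s \<in> E" if "s \<in> T" for s using that T(1) E(2) by blast
    define Q where "Q = {e \<in> E. \<exists>s\<in>T. s * e \<in> c}"
    define p where "p = Q \<inter> A"
    have QI: "e \<in> Q" if "e \<in> E" "s \<in> T" "s * e \<in> c" for s e
      using that by (auto simp: Q_def)
    have cQ: "s \<in> Q" if "s \<in> c" for s
      using QI[of s 1] that T(2) cD(1) by simp
    interpret Q: cideal E Q
    proof
      show "Q \<subseteq> E" by (auto simp: Q_def)
      show "0 \<in> Q" by (rule cQ[OF c.zero_ideal])
    next
      fix u v assume "u \<in> Q" "v \<in> Q"
      then obtain s s' where *: "u \<in> E" "v \<in> E" "s \<in> T" "s' \<in> T" "s * u \<in> c" "s' * v \<in> c"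
        by (auto simp: Q_def)
      show "u + v \<in> Q"
      proof (rule QI)
        have "s' * (s * u) + s * (s' * v) \<in> c"
          by (rule c.add_ideal[OF c.mult_ideal[OF TE[OF *(4)] *(5)] c.mult_ideal[OF TE[OF *(3)] *(6)]])
        then show "(s * s') * (u + v) \<in> c" by (simp add: algebra_simps)
      qed (use * T(4) E.add_mem in auto)
    next
      fix e u assume e: "e \<in> E" and "u \<in> Q"
      then obtain s where *: "u \<in> E" "s \<in> T" "s * u \<in> c"
        by (auto simp: Q_def)
      show "e * u \<in> Q"
        by (rule QI[of _ s]) (use * e E.mult_mem c.mult_ideal[OF e *(3)] in \<open>auto simp: ac_simps\<close>)
    qed
    have rad_Q: "radical_in E Q"
      unfolding radical_in_def
    proof (intro ballI impI)
      fix u assume u: "u \<in> E" "u * u \<in> Q"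
      then obtain s where s: "s \<in> T" "s * (u * u) \<in> c"
        by (auto simp: Q_def)
      have "s * (s * (u * u)) \<in> c"
        by (rule c.mult_ideal[OF TE[OF s(1)] s(2)])
      then have "(s * u) * (s * u) \<in> c" by (simp add: ac_simps)
      then have "s * u \<in> c"
        using radical_inD[OF rad_c] u(1) s(1) TE E.mult_mem by blast
      then show "u \<in> Q" using u(1) s(1) by (intro QI)
    qed
    have T_Q: "s \<notin> Q" if "s \<in> T" for s
      using that T(3,4) by (auto simp: Q_def)
    have A_T: "a \<in> Q" if "a \<in> A" "a \<notin> T" for a
    proof -
      obtain s k where s: "s \<in> T" "s * a ^ k \<in> c" using max[OF \<open>a \<in> A\<close> \<open>a \<notin> T\<close>] by blast
      have a: "a \<in> E" using that E(2) by blast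
      have "a ^ k \<in> Q" using s E.power_mem[OF a] by (intro QI)
      then show ?thesis by (rule Q.radical_power[OF rad_Q a])
    qed
    have T_cancel: "e \<in> Q" if seQ: "s * e \<in> Q" and sT: "s \<in> T" and eE: "e \<in> E" for s e
    proof -
      obtain s' where "s' \<in> T" "s' * (s * e) \<in> c" using seQ by (auto simp: Q_def)
      then show ?thesis using QI[of e "s' * s"] T(4) sT eE by (simp add: mult.assoc)
    qed
    have pQ: "p \<subseteq> Q" by (auto simp: p_def)
    have JQ: "J \<subseteq> Q" using Jc cQ by blast
    have "cideal A p"
    proof
      show "p \<subseteq> A" by (auto simp: p_def)
      show "0 \<in> p" by (simp add: p_def Q.zero_ideal A.zero_mem)
      show "u + v \<in> p" if "u \<in> p" "v \<in> p" for u v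
        using that by (auto simp: p_def intro: Q.add_ideal A.add_mem)
      show "e * u \<in> p" if "e \<in> A" "u \<in> p" for e u
        using that E(2) by (auto simp: p_def intro: Q.mult_ideal A.mult_mem)
    qed
    moreover have "J \<subseteq> p" using JQ JA by (auto simp: p_def)
    moreover have "1 \<notin> p" using T_Q[OF T(2)] by (auto simp: p_def)
    moreover have "a \<in> p \<or> b \<in> p" if "a \<in> A" "b \<in> A" "a * b \<in> p" for a b
      using that A_T[of a] A_T[of b] T_Q[of "a * b"] T(4)[of a b] by (auto simp: p_def)
    ultimately obtain t h k where t: "t \<in> A" "t \<notin> p" and h: "\<And>i. i \<in> S \<Longrightarrow> h i \<in> polys A"
      and k: "\<And>i. i \<in> S \<Longrightarrow> k i \<in> polys A"
      and hk': "\<And>i j. i \<in> S \<Longrightarrow> j \<in> S \<Longrightarrow> h i * k j - [:t * t:] * (f i * g j) \<in> polys p"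
      and h0': "\<And>i. i \<in> S \<Longrightarrow> poly.coeff (h i) 0 - t * x i \<in> p"
      and k0': "\<And>i. i \<in> S \<Longrightarrow> poly.coeff (k i) 0 - t * y i \<in> p"
      using local[of p] by metis
    have tT: "t \<in> T" using t A_T by (auto simp: p_def)
    have tE: "t \<in> E" by (rule TE[OF tT])
    interpret PE: csubring "polys E" by (rule csubring_polys) fact
    interpret PQ: cideal "polys E" "polys Q" by (rule cideal_polys) unfold_locales
    have hE: "h i \<in> polys E" and kE: "k i \<in> polys E" if "i \<in> S" for i
      using h[OF that] k[OF that] E(2) by (auto simp: polys_def)
    have hk: "h i * k j - [:t * t:] * (f i * g j) \<in> polys Q" if "i \<in> S" "j \<in> S" for i j
      using hk'[OF that] pQ by (auto simp: polys_def)
    have traceQ: "(\<Sum>i\<in>S. f i * g i) - 1 \<in> polys Q"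
      by (rule polysI) (use JQ polysD[OF trace] in blast)
    define w where "w = (\<Sum>j\<in>S. g j * h j)"
    define w' where "w' = (\<Sum>i\<in>S. k i * f i)"
    have wE: "w \<in> polys E"
      unfolding w_def by (intro PE.sum_mem PE.mult_mem g hE)
    have w'E: "w' \<in> polys E"
      unfolding w'_def by (intro PE.sum_mem PE.mult_mem f kE)
    have fhgh: "f i * g j * h l - f l * g j * h i \<in> polys Q" if "i \<in> S" "j \<in> S" "l \<in> S" for i j l
    proof -
      have "[:t * t:] * (f i * g j * h l - f l * g j * h i)
         = h i * (h l * k j - [:t * t:] * (f l * g j)) - h l * (h i * k j - [:t * t:] * (f i * g j))"
        by (simp only: right_diff_distrib) (simp only: ac_simps diff_diff_eq2 diff_add_cancel; simp add: algebra_simps)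
      also have "\<dots> \<in> polys Q"
        by (intro hk hE that PQ.diff_ideal PQ.mult_ideal)
      finally have *: "t * t * poly.coeff (f i * g j * h l - f l * g j * h i) m \<in> Q" for m
        using polysD by fastforce
      have mem: "f i * g j * h l - f l * g j * h i \<in> polys E"
        by (intro PE.diff_mem PE.mult_mem f g hE that)
      show ?thesis
        by (rule polysI, rule T_cancel[OF * T(4)[OF tT tT] polysD[OF mem]])
    qed
    have fw: "f i * w - h i \<in> polys Q" if i: "i \<in> S" for i
    proof -
      have "f i * w - h i = (\<Sum>j\<in>S. f i * g j * h j - f j * g j * h i) + h i * ((\<Sum>j\<in>S. f j * g j) - 1)"
        unfolding w_def
        by (simp add: sum_subtractf sum_distrib_left right_diff_distrib) (simp add: ac_simps)
      also have "\<dots> \<in> polys Q"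
        by (intro fhgh hE traceQ i PQ.add_ideal PQ.sum_ideal PQ.mult_ideal)
      finally show ?thesis .
    qed
    have ww': "w * w' - [:t * t:] \<in> polys Q"
    proof -
      define m where "m = (\<Sum>i\<in>S. f i * g i)"
      have "w * w' - u = (\<Sum>j\<in>S. \<Sum>i\<in>S. (f i * g j) * (h j * k i - u * (f j * g i))) + u * (m + 1) * (m - 1)" for u
      proof -
        have "m * m = (\<Sum>j\<in>S. \<Sum>i\<in>S. (f i * g j) * (f j * g i))"
          unfolding m_def sum_product by (simp add: ac_simps)
        then have "u * (m * m) = (\<Sum>j\<in>S. \<Sum>i\<in>S. (f i * g j) * (u * (f j * g i)))"
          by (simp add: sum_distrib_left ac_simps)
        moreover have "w * w' = (\<Sum>j\<in>S. \<Sum>i\<in>S. (f i * g j) * (h j * k i))"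
          unfolding w_def w'_def sum_product by (simp add: ac_simps)
        ultimately show ?thesis
          by (simp add: right_diff_distrib sum_subtractf) (simp add: algebra_simps)
      qed
      then have "w * w' - [:t * t:] = (\<Sum>j\<in>S. \<Sum>i\<in>S. (f i * g j) * (h j * k i - [:t * t:] * (f j * g i)))
           + [:t * t:] * (m + 1) * (m - 1)" .
      also have "\<dots> \<in> polys Q"
      proof (intro hk traceQ[folded m_def] PQ.add_ideal PQ.sum_ideal PQ.mult_ideal)
        show "[:t * t:] * (m + 1) \<in> polys E"
          unfolding m_def using tE E.zero_mem
          by (intro PE.mult_mem PE.add_mem PE.sum_mem PE.one_mem f g)
             (auto simp: polys_def coeff_pCons intro: E.mult_mem split: nat.splits)
      qed (auto intro: PE.mult_mem f g)
      finally show ?thesis .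
    qed
    have w0: "poly.coeff w 0 - t \<in> Q"
    proof -
      have "poly.coeff w 0 - t = (\<Sum>j\<in>S. poly.coeff (g j) 0 * (poly.coeff (h j) 0 - t * x j))
         + t * ((\<Sum>i\<in>S. x i * poly.coeff (g i) 0) - 1)"
        by (simp add: w_def coeff_sum coeff_mult_0 right_diff_distrib sum_subtractf sum_distrib_left ac_simps)
      also have "\<dots> \<in> Q"
        using xy(2) JQ h0' pQ g tE by (intro Q.add_ideal Q.sum_ideal Q.mult_ideal) (auto intro: polysD)
      finally show ?thesis .
    qed
    have w'0: "poly.coeff w' 0 - t \<in> Q"
    proof -
      have "poly.coeff w' 0 - t = (\<Sum>j\<in>S. poly.coeff (f j) 0 * (poly.coeff (k j) 0 - t * y j))
         + t * ((\<Sum>i\<in>S. poly.coeff (f i) 0 * y i) - 1)"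
        by (simp add: w'_def coeff_sum coeff_mult_0 right_diff_distrib sum_subtractf sum_distrib_left ac_simps)
      also have "\<dots> \<in> Q"
        using xy(1) JQ k0' pQ f tE by (intro Q.add_ideal Q.sum_ideal Q.mult_ideal) (auto intro: polysD)
      finally show ?thesis .
    qed
    have wt: "w - [:t:] \<in> polys Q"
    proof (rule polysI)
      fix m
      show "poly.coeff (w - [:t:]) m \<in> Q"
      proof (cases m)
        case 0
        then show ?thesis using w0 by simp
      next
        case (Suc m')
        have "poly.coeff (w * w') r \<in> Q" if "1 \<le> r" for r
          using polysD[OF ww', of r] that by (auto simp: coeff_pCons split: nat.splits)
        then have 1: "poly.coeff w m * poly.coeff w' 0 \<in> Q"
          using Suc by (intro Q.armendariz[OF rad_Q wE w'E, where N = 1]) auto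
        have wm: "poly.coeff w m \<in> E" using wE by (auto intro: polysD)
        have "t * poly.coeff w m = poly.coeff w m * poly.coeff w' 0 - poly.coeff w m * (poly.coeff w' 0 - t)"
          by (simp add: algebra_simps)
        also have "\<dots> \<in> Q"
          by (intro 1 w'0 wm Q.diff_ideal Q.mult_ideal)
        finally have "poly.coeff w m \<in> Q"
          using T_cancel tT wm by blast
        then show ?thesis using Suc by simp
      qed
    qed
    have ft: "f i * [:t:] - h i \<in> polys Q" if i: "i \<in> S" for i
    proof -
      have "f i * u - h i = (f i * w - h i) - f i * (w - u)" for u
        by (simp add: algebra_simps)
      then have "f i * [:t:] - h i = (f i * w - h i) - f i * (w - [:t:])" .
      also have "\<dots> \<in> polys Q"
        by (intro fw wt f i PQ.diff_ideal PQ.mult_ideal)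
      finally show ?thesis .
    qed
    have "\<exists>s\<in>T. s * poly.coeff (f i) m \<in> A" if i: "i \<in> S" for i m
    proof -
      have "poly.coeff (f i) m * t - poly.coeff (h i) m \<in> Q"
        using polysD[OF ft[OF i], of m] by (simp add: mult.commute)
      then obtain s where s: "s \<in> T" "s * (poly.coeff (f i) m * t - poly.coeff (h i) m) \<in> c"
        by (auto simp: Q_def)
      have "s * (poly.coeff (f i) m * t - poly.coeff (h i) m) \<in> A"
        using cD(2)[OF s(2) E.one_mem] by simp
      moreover have "s * poly.coeff (h i) m \<in> A"
        using s(1) T(1) h[OF i] by (intro A.mult_mem) (auto intro: polysD)
      ultimately have "s * (poly.coeff (f i) m * t - poly.coeff (h i) m) + s * poly.coeff (h i) m \<in> A"
        by (rule A.add_mem)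
      then have "(s * t) * poly.coeff (f i) m \<in> A"
        by (simp add: algebra_simps)
      then show ?thesis using T(4)[OF s(1) tT] by blast
    qed
    then obtain s where s: "\<And>i m. i \<in> S \<Longrightarrow> s i m \<in> T \<and> s i m * poly.coeff (f i) m \<in> A"
      by metis
    have prod_T: "prod u B \<in> T" if "\<And>b. b \<in> B \<Longrightarrow> u b \<in> T" for u and B :: "('i \<times> nat) set"
      using that T(2,4) by (induction B rule: infinite_finite_induct) auto
    define B where "B = (SIGMA i:S. {..Polynomial.degree (f i)})"
    have finB: "finite B" using finite_S by (auto simp: B_def)
    define \<sigma> where "\<sigma> = (\<Prod>(i, m)\<in>B. s i m)"
    have \<sigma>T: "\<sigma> \<in> T"
      unfolding \<sigma>_def by (rule prod_T) (use s in \<open>auto simp: B_def\<close>)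
    have "\<sigma> * poly.coeff (f i) m \<in> A" if i: "i \<in> S" for i m
    proof (cases "m \<le> Polynomial.degree (f i)")
      case True
      then have im: "(i, m) \<in> B" using i by (auto simp: B_def)
      have "\<sigma> = s i m * (\<Prod>(i, m)\<in>B - {(i, m)}. s i m)"
        unfolding \<sigma>_def by (subst prod.remove[OF finB im]) simp
      then have "\<sigma> * poly.coeff (f i) m = (\<Prod>(i, m)\<in>B - {(i, m)}. s i m) * (s i m * poly.coeff (f i) m)"
        by (simp add: ac_simps)
      moreover have "(\<Prod>(i, m)\<in>B - {(i, m)}. s i m) \<in> T"
        by (rule prod_T) (use s in \<open>auto simp: B_def\<close>)
      ultimately show ?thesis
        using s[OF i, of m] T(1) by (auto intro: A.mult_mem)
    next
      case False
      then show ?thesis by (simp add: coeff_eq_0 A.zero_mem)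
    qed
    then have "\<sigma> ^ n \<in> c"
      using finite_type[of \<sigma>] \<sigma>T T(1) TE by (intro cI E.power_mem) auto
    moreover have "\<sigma> ^ n \<in> T"
      using \<sigma>T T(2,4) by (induction n) auto
    ultimately show False using T(3) by blast
  qed
  then have "E \<subseteq> A" using cD(2)[of 1] by auto
  then show "i \<in> S \<Longrightarrow> f i \<in> polys A" "i \<in> S \<Longrightarrow> g i \<in> polys A"
    using f g by (auto simp: polys_def)
qed

end

section \<open>Factorization over a seminormal ring\<close>

lemma exists_maximal_ideal:
  fixes N :: "'r::comm_ring_1 set"
  assumes "cideal UNIV N" "1 \<notin> N"
  obtains m where "cideal UNIV m" "N \<subseteq> m" "1 \<notin> m" "\<And>x. x \<notin> m \<Longrightarrow> \<exists>y. x * y - 1 \<in> m"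
proof -
  interpret N: cideal UNIV N by fact
  define W where "W = {m. cideal UNIV m \<and> N \<subseteq> m \<and> 1 \<notin> m}"
  have WD: "cideal UNIV V" "N \<subseteq> V" "1 \<notin> V" if "V \<in> W" for V
    using that by (auto simp: W_def)
  have "N \<in> W" using assms by (auto simp: W_def)
  then have "W \<noteq> {}" by blast
  moreover have "\<Union>CC \<in> W" if ne: "CC \<noteq> {}" and chain: "subset.chain W CC" for CC
  proof -
    have CW: "V \<in> W" if "V \<in> CC" for V
      using chain that by (auto simp: subset_chain_def)
    have "cideal UNIV (\<Union>CC)"
    proof
      show "0 \<in> \<Union>CC"
        using ne WD(2)[OF CW] N.zero_ideal by fastforce
    next
      fix x y assume "x \<in> \<Union>CC" "y \<in> \<Union>CC"
      then obtain V Z where VZ: "x \<in> V" "V \<in> CC" "y \<in> Z" "Z \<in> CC" by auto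
      then have "V \<subseteq> Z \<or> Z \<subseteq> V"
        using chain by (auto simp: subset_chain_def)
      then show "x + y \<in> \<Union>CC"
      proof
        assume "V \<subseteq> Z"
        then have "x + y \<in> Z" using VZ by (intro cideal.add_ideal[OF WD(1)[OF CW]]) auto
        then show ?thesis using VZ by auto
      next
        assume "Z \<subseteq> V"
        then have "x + y \<in> V" using VZ by (intro cideal.add_ideal[OF WD(1)[OF CW]]) auto
        then show ?thesis using VZ by auto
      qed
    next
      fix e x assume "x \<in> \<Union>CC"
      then obtain V where V: "x \<in> V" "V \<in> CC" by auto
      then have "e * x \<in> V" by (intro cideal.mult_ideal[OF WD(1)[OF CW]]) auto
      then show "e * x \<in> \<Union>CC" using V by auto
    qed auto
    moreover have "N \<subseteq> \<Union>CC" using ne WD(2)[OF CW] by fastforce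
    moreover have "1 \<notin> \<Union>CC" using WD(3)[OF CW] by auto
    ultimately show ?thesis by (auto simp: W_def)
  qed
  ultimately have "\<exists>m\<in>W. \<forall>V\<in>W. m \<subseteq> V \<longrightarrow> V = m"
    by (rule subset_Zorn_nonempty)
  then obtain m where m: "m \<in> W" and max: "\<And>V. V \<in> W \<Longrightarrow> m \<subseteq> V \<Longrightarrow> V = m"
    by auto
  interpret m: cideal UNIV m by (rule WD[OF m])
  have "\<exists>y. x * y - 1 \<in> m" if x: "x \<notin> m" for x
  proof -
    define V where "V = {a + x * y | a y. a \<in> m}"
    have VI: "a + x * y \<in> V" if "a \<in> m" for a y
      using that by (auto simp: V_def)
    have "m \<subseteq> V" using VI[of _ 0] by auto
    have "x \<in> V" using VI[OF m.zero_ideal, of 1] by simp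
    have "cideal UNIV V"
    proof
      show "0 \<in> V" using VI[OF m.zero_ideal, of 0] by simp
    next
      fix u v assume "u \<in> V" "v \<in> V"
      then obtain a y b z where *: "u = a + x * y" "v = b + x * z" "a \<in> m" "b \<in> m"
        by (auto simp: V_def)
      have "u + v = (a + b) + x * (y + z)" by (simp add: * algebra_simps)
      then show "u + v \<in> V" using VI[OF m.add_ideal[OF *(3,4)]] by simp
    next
      fix e u assume "u \<in> V"
      then obtain a y where *: "u = a + x * y" "a \<in> m"
        by (auto simp: V_def)
      have "e * u = e * a + x * (e * y)" by (simp add: * algebra_simps)
      then show "e * u \<in> V" using VI[OF m.mult_ideal[OF UNIV_I *(2)]] by simp
    qed auto
    then have "1 \<in> V"
      using max[of V] \<open>m \<subseteq> V\<close> \<open>x \<in> V\<close> x WD(2)[OF m] by (auto simp: W_def)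
    then obtain a y where "1 = a + x * y" "a \<in> m" by (auto simp: V_def)
    then have "x * y - 1 = - a" by (simp add: algebra_simps)
    then show ?thesis using m.minus_ideal[OF \<open>a \<in> m\<close>] by metis
  qed
  then show thesis using that WD[OF m] by blast
qed

text \<open>Adjoining an inverse of \<open>s\<close>, that is dividing \<open>R[X]\<close> by \<open>I\<close> and \<open>s X - 1\<close>, does not give the zero ring since no
  power of \<open>s\<close> lies in the radical ideal \<open>I\<close>; any maximal ideal of this ring will do. Thus the quotient of \<open>R\<close> by \<open>I\<close> embeds into a
  product of fields that are all quotients of the one ring \<open>R[X]\<close>.\<close>

lemma separating_maximal_ideal:
  fixes I :: "'r::comm_ring_1 set"
  assumes "cideal UNIV I" and rad: "radical_in UNIV I" and s: "s \<notin> I"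
  obtains m :: "'r poly set" where "cideal UNIV m" "1 \<notin> m" "\<And>x. x \<notin> m \<Longrightarrow> \<exists>y. x * y - 1 \<in> m"
    "\<And>a. a \<in> I \<Longrightarrow> [:a:] \<in> m" "[:s:] \<notin> m"
proof -
  interpret cideal UNIV I by fact
  interpret P: cideal UNIV "polys I"
    using cideal_polys[OF assms(1)] by simp
  (* s * X - 1, which inverts s *)
  define r :: "'r poly" where "r = [:- 1, s:]"
  define N where "N = {w + r * q | w q. w \<in> polys I}"
  have NI: "w + r * q \<in> N" if "w \<in> polys I" for w q
    using that by (auto simp: N_def)
  have "cideal UNIV N"
  proof
    show "0 \<in> N" using NI[OF P.zero_ideal, of 0] by simp
  next
    fix u v assume "u \<in> N" "v \<in> N"
    then obtain a y b z where *: "u = a + r * y" "v = b + r * z" "a \<in> polys I" "b \<in> polys I"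
      by (auto simp: N_def)
    have "u + v = (a + b) + r * (y + z)" by (simp add: * algebra_simps)
    then show "u + v \<in> N" using NI[OF P.add_ideal[OF *(3,4)]] by simp
  next
    fix e u assume "u \<in> N"
    then obtain a y where *: "u = a + r * y" "a \<in> polys I"
      by (auto simp: N_def)
    have "e * u = e * a + r * (e * y)" by (simp add: * algebra_simps)
    then show "e * u \<in> N" using NI[OF P.mult_ideal[OF UNIV_I *(2)]] by simp
  qed auto
  moreover have "1 \<notin> N"
  proof
    assume "1 \<in> N"
    then obtain w q where wq: "1 = w + r * q" "w \<in> polys I" by (auto simp: N_def)
    have "poly.coeff q k + s ^ k \<in> I" for k
    proof (induction k)
      case 0
      have "poly.coeff (w + r * q) 0 = 1" by (simp flip: wq(1))
      then have "poly.coeff q 0 + s ^ 0 = poly.coeff w 0"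
        by (simp add: r_def algebra_simps)
      then show ?case using polysD[OF wq(2)] by simp
    next
      case (Suc k)
      have "poly.coeff (w + r * q) (Suc k) = 0" by (simp flip: wq(1))
      then have "poly.coeff q (Suc k) + s ^ Suc k = s * (poly.coeff q k + s ^ k) + poly.coeff w (Suc k)"
        by (simp add: r_def algebra_simps eq_neg_iff_add_eq_0)
      also have "\<dots> \<in> I"
        by (rule add_ideal[OF mult_ideal[OF UNIV_I Suc] polysD[OF wq(2)]])
      finally show ?case .
    qed
    from this[of "Suc (Polynomial.degree q)"] have "s ^ Suc (Polynomial.degree q) \<in> I"
      by (simp add: coeff_eq_0)
    then show False using radical_power[OF rad, of s] s by blast
  qed
  ultimately obtain m where m: "cideal UNIV m" "N \<subseteq> m" "1 \<notin> m" "\<And>x. x \<notin> m \<Longrightarrow> \<exists>y. x * y - 1 \<in> m"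
    by (rule exists_maximal_ideal) blast
  interpret m: cideal UNIV m by fact
  have "[:a:] \<in> m" if "a \<in> I" for a
  proof -
    have "[:a:] \<in> polys I" using that by (auto simp: polys_def coeff_pCons zero_ideal split: nat.splits)
    then show ?thesis using NI[of "[:a:]" 0] m(2) by auto
  qed
  moreover have "[:s:] \<notin> m"
  proof
    assume "[:s:] \<in> m"
    moreover have "r \<in> m" using NI[OF P.zero_ideal, of 1] m(2) by auto
    ultimately have "[:0, 1:] * [:s:] - r \<in> m" by (intro m.diff_ideal m.mult_ideal) auto
    also have "[:0, 1:] * [:s:] - r = 1" by (simp add: r_def one_pCons)
    finally show False using m(3) by simp
  qed
  ultimately show thesis using that m by blast
qed

text \<open>Modulo a maximal ideal the denominator \<open>t\<close> of \<open>factor_mod_prime\<close> is invertible and can be divided out.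
  The degrees of the factors are bounded by the one of their product since neither family vanishes modulo \<open>m\<close>.\<close>

lemma factor_mod_maximal:
  fixes m :: "'r::comm_ring_1 set" and M :: "'i \<Rightarrow> 'i \<Rightarrow> 'r poly"
  assumes "cideal UNIV m" and proper: "1 \<notin> m" and inv: "\<And>x. x \<notin> m \<Longrightarrow> \<exists>y. x * y - 1 \<in> m"
    and S: "finite S"
    and minors: "\<And>i j k l. \<lbrakk>i \<in> S; j \<in> S; k \<in> S; l \<in> S\<rbrakk> \<Longrightarrow> M i j * M k l - M i l * M k j \<in> polys m"
    and trace: "(\<Sum>i\<in>S. M i i) - 1 \<in> polys m"
    and init: "\<And>i j. \<lbrakk>i \<in> S; j \<in> S\<rbrakk> \<Longrightarrow> poly.coeff (M i j) 0 - x i * y j \<in> m"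
    and deg: "\<And>i j k. \<lbrakk>i \<in> S; j \<in> S; D < k\<rbrakk> \<Longrightarrow> poly.coeff (M i j) k = 0"
  shows "\<exists>f g. (\<forall>i\<in>S. \<forall>j\<in>S. f i * g j - M i j \<in> polys m) \<and>
    (\<forall>i\<in>S. poly.coeff (f i) 0 - x i \<in> m \<and> poly.coeff (g i) 0 - y i \<in> m) \<and>
    (\<forall>i\<in>S. \<forall>k>D. poly.coeff (f i) k \<in> m \<and> poly.coeff (g i) k \<in> m)"
proof -
  interpret cideal UNIV m by fact
  interpret P: cideal UNIV "polys m"
    using cideal_polys[OF assms(1)] by simp
  have prime: "x \<in> m \<or> y \<in> m" if "x * y \<in> m" for x y
  proof (rule disjCI)
    assume "y \<notin> m"
    then obtain z where z: "y * z - 1 \<in> m" using inv by blast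
    have "x = z * (x * y) - x * (y * z - 1)" by (simp add: algebra_simps)
    also have "\<dots> \<in> m" by (intro that z diff_ideal mult_ideal UNIV_I)
    finally show "x \<in> m" .
  qed
  have rad: "radical_in UNIV m" using prime by (auto simp: radical_in_def)
  obtain t h k where t: "t \<notin> m"
    and hk: "\<And>i j. i \<in> S \<Longrightarrow> j \<in> S \<Longrightarrow> h i * k j - smult (t^2) (M i j) \<in> polys m"
    and h0: "\<And>i. i \<in> S \<Longrightarrow> poly.coeff (h i) 0 - t * x i \<in> m"
    and k0: "\<And>i. i \<in> S \<Longrightarrow> poly.coeff (k i) 0 - t * y i \<in> m"
    using factor_mod_prime[OF assms(1) proper prime S minors trace init] by blast
  obtain w where w: "t * w - 1 \<in> m" using inv[OF t] by blast
  define f where "f i = smult w (h i)" for i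
  define g where "g i = smult w (k i)" for i
  have const: "[:r:] \<in> polys m" if "r \<in> m" for r
    using that by (auto simp: polys_def coeff_pCons zero_ideal split: nat.splits)
  have fg: "f i * g j - M i j \<in> polys m" if ij: "i \<in> S" "j \<in> S" for i j
  proof -
    have tw: "(t * w + 1) * (t * w - 1) = w * w * t^2 - 1"
      by (simp add: algebra_simps power2_eq_square)
    have "f i * g j - M i j = [:w * w:] * (h i * k j - smult (t^2) (M i j)) + M i j * [:(t * w + 1) * (t * w - 1):]"
      unfolding tw by (simp add: f_def g_def smult_diff_right smult_diff_left)
    also have "\<dots> \<in> polys m"
      by (intro hk ij const w P.add_ideal P.mult_ideal mult_ideal UNIV_I)
    finally show ?thesis .
  qed
  have f0: "poly.coeff (f i) 0 - x i \<in> m" if i: "i \<in> S" for i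
  proof -
    have "poly.coeff (f i) 0 - x i = w * (poly.coeff (h i) 0 - t * x i) + x i * (t * w - 1)"
      by (simp add: f_def algebra_simps)
    also have "\<dots> \<in> m" by (intro h0 i w add_ideal mult_ideal UNIV_I)
    finally show ?thesis .
  qed
  have g0: "poly.coeff (g i) 0 - y i \<in> m" if i: "i \<in> S" for i
  proof -
    have "poly.coeff (g i) 0 - y i = w * (poly.coeff (k i) 0 - t * y i) + y i * (t * w - 1)"
      by (simp add: g_def algebra_simps)
    also have "\<dots> \<in> m" by (intro k0 i w add_ideal mult_ideal UNIV_I)
    finally show ?thesis .
  qed
  have high: "poly.coeff (f i * g j) r \<in> m" if "Suc D \<le> r" "i \<in> S" "j \<in> S" for i j r
    using polysD[OF fg[OF that(2,3)], of r] deg[OF that(2,3), of r] that(1) by simp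
  have unit: "\<exists>j\<in>S. poly.coeff (f j) 0 * poly.coeff (g j) 0 \<notin> m"
  proof (rule ccontr)
    assume neg: "\<not> ?thesis"
    have "(\<Sum>j\<in>S. f j * g j) - (\<Sum>j\<in>S. M j j) \<in> polys m"
      by (rule P.cong_sum) (rule fg)
    then have "(\<Sum>j\<in>S. f j * g j) - 1 \<in> polys m"
      using trace by (rule P.cong_trans)
    then have "(\<Sum>j\<in>S. poly.coeff (f j) 0 * poly.coeff (g j) 0) - 1 \<in> m"
      using polysD[of "(\<Sum>j\<in>S. f j * g j) - 1" m 0] by (simp add: coeff_sum coeff_mult_0)
    moreover have "(\<Sum>j\<in>S. poly.coeff (f j) 0 * poly.coeff (g j) 0) \<in> m"
      using neg by (intro sum_ideal) auto
    ultimately have "1 \<in> m"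
      using diff_ideal by fastforce
    then show False using proper by simp
  qed
  then obtain j where j: "j \<in> S" "poly.coeff (f j) 0 \<notin> m" "poly.coeff (g j) 0 \<notin> m"
    using mult_ideal mult_ideal' by blast
  have "poly.coeff (f i) r \<in> m \<and> poly.coeff (g i) r \<in> m" if "i \<in> S" "D < r" for i r
  proof
    have "poly.coeff (f i) r * poly.coeff (g j) 0 \<in> m"
      by (rule armendariz[OF rad, where N = "Suc D"]) (use that j high in auto)
    then show "poly.coeff (f i) r \<in> m" using prime j by blast
    have "poly.coeff (f j) 0 * poly.coeff (g i) r \<in> m"
      by (rule armendariz[OF rad, where N = "Suc D"]) (use that j high in auto)
    then show "poly.coeff (g i) r \<in> m" using prime j by blast
  qed
  then show ?thesis using fg f0 g0 by blast
qed

locale comm_ring_hom =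
  fixes h :: "'a::comm_ring_1 \<Rightarrow> 'b::comm_ring_1"
  assumes add: "h (x + y) = h x + h y" and mult: "h (x * y) = h x * h y" and one: "h 1 = 1"
begin

lemma zero: "h 0 = 0"
  using add[of 0 0] by simp

lemma diff: "h (x - y) = h x - h y"
  using add[of "x - y" y] by simp

lemma sum: "h (sum f A) = (\<Sum>i\<in>A. h (f i))"
  by (induction A rule: infinite_finite_induct) (auto simp: zero add)

lemma coeff_map: "poly.coeff (map_poly h p) k = h (poly.coeff p k)"
  by (simp add: coeff_map_poly zero)

lemma map_mult: "map_poly h (p * q) = map_poly h p * map_poly h q"
  by (rule poly_eqI) (simp add: coeff_map coeff_mult sum mult)

lemma map_diff: "map_poly h (p - q) = map_poly h p - map_poly h q"
  by (rule poly_eqI) (simp add: coeff_map diff)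

lemma map_sum: "map_poly h (sum f A) = (\<Sum>i\<in>A. map_poly h (f i))"
  by (rule poly_eqI) (simp add: coeff_map coeff_sum sum)

lemma map_one: "map_poly h 1 = 1"
  by (rule poly_eqI) (simp add: coeff_map coeff_1 one zero)

end

lemma unit_square: "y * y * (a * a) - (a * y + 1) * (a * y - 1) = (1::'r::comm_ring_1)"
  by (simp add: algebra_simps)

lemma square_cube_split:
  "b * b - c * (c * c) = (b * b - (u * u * u) * (u * u * u)) + ((u * u) * ((u * u) * (u * u)) - c * (c * (c::'r::comm_ring_1)))"
  by (simp add: algebra_simps)

lemma cube_difference:
  "(u - a) ^ 3 = 4 * (u * u * u - a * a * a) - (3 * (a + u)) * (u * u - a * (a::'r::comm_ring_1))"
  by (simp add: power3_eq_cube algebra_simps)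

text \<open>The large ring is the type of functions \<open>'r \<Rightarrow> 'r poly\<close>, with \<open>J\<close> the functions whose value at each \<open>s\<close> outside \<open>I\<close> lies in a
  chosen maximal ideal avoiding \<open>s\<close>. Modulo \<open>J\<close> this is a product of fields containing the quotient of the given
  ring by \<open>I\<close>. The
  factors in the single components have a common degree bound, so they glue to polynomials over the
  product. The set \<open>A\<close> is the image of the given ring plus \<open>J\<close>. It satisfies the seminormality
  condition of the descent because in a reduced ring \<open>u\<^sup>2 = a\<^sup>2\<close> and \<open>u\<^sup>3 = a\<^sup>3\<close> force \<open>u = a\<close>.\<close>

theorem seminormal_factorization:
  fixes I :: "'r::comm_ring_1 set" and M :: "'i \<Rightarrow> 'i \<Rightarrow> 'r poly"
  assumes I: "cideal UNIV I" and rad: "radical_in UNIV I"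
    and semin: "\<And>b c. b^2 - c^3 \<in> I \<Longrightarrow> \<exists>a. a^3 - b \<in> I \<and> a^2 - c \<in> I"
    and S: "finite S"
    and minors: "\<And>i j k l. \<lbrakk>i \<in> S; j \<in> S; k \<in> S; l \<in> S\<rbrakk> \<Longrightarrow> M i j * M k l - M i l * M k j \<in> polys I"
    and trace: "(\<Sum>i\<in>S. M i i) - 1 \<in> polys I"
    and init: "\<And>i j. \<lbrakk>i \<in> S; j \<in> S\<rbrakk> \<Longrightarrow> poly.coeff (M i j) 0 - x i * y j \<in> I"
  shows "\<exists>f g. \<forall>i\<in>S. \<forall>j\<in>S. f i * g j - M i j \<in> polys I"
proof -
  interpret I: cideal UNIV I by fact
  define good where "good s m \<longleftrightarrow> cideal UNIV m \<and> 1 \<notin> m \<and> (\<forall>x. x \<notin> m \<longrightarrow> (\<exists>y. x * y - 1 \<in> m)) \<and>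
    (\<forall>a\<in>I. [:a:] \<in> m) \<and> [:s:] \<notin> m" for s and m :: "'r poly set"
  define m where "m s = (SOME m. good s m)" for s
  have good: "good s (m s)" if "s \<notin> I" for s
  proof -
    have "\<exists>m. good s m"
      using separating_maximal_ideal[OF I rad that] unfolding good_def by metis
    then show ?thesis unfolding m_def by (rule someI_ex)
  qed
  have m: "cideal UNIV (m s)" "1 \<notin> m s" "x \<notin> m s \<Longrightarrow> \<exists>y. x * y - 1 \<in> m s"
    "a \<in> I \<Longrightarrow> [:a:] \<in> m s" "[:s:] \<notin> m s" if "s \<notin> I" for s x a
    using good[OF that] by (auto simp: good_def)
  define \<iota> :: "'r \<Rightarrow> 'r \<Rightarrow> 'r poly" where "\<iota> a = (\<lambda>_. [:a:])" for a
  interpret \<iota>: comm_ring_hom \<iota>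
    by standard (auto simp: \<iota>_def fun_eq_iff one_pCons)
  define ms where "ms s = {\<phi> :: 'r \<Rightarrow> 'r poly. \<phi> s \<in> m s}" for s
  have ms_ideal: "cideal UNIV (ms s)" if "s \<notin> I" for s
  proof -
    interpret ms: cideal UNIV "m s" using m(1)[OF that] .
    show ?thesis
      by standard (auto simp: ms_def intro: ms.zero_ideal ms.add_ideal ms.mult_ideal)
  qed
  have ms_one: "1 \<notin> ms s" if "s \<notin> I" for s
    using m(2)[OF that] by (simp add: ms_def)
  have ms_inv: "\<exists>y. \<phi> * y - 1 \<in> ms s" if s: "s \<notin> I" and \<phi>: "\<phi> \<notin> ms s" for s \<phi>
  proof -
    obtain y where "\<phi> s * y - 1 \<in> m s" using m(3)[OF s, of "\<phi> s"] \<phi> by (auto simp: ms_def)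
    then show ?thesis by (intro exI[of _ "\<lambda>_. y"]) (simp add: ms_def)
  qed
  define J where "J = {\<phi>. \<forall>s. s \<notin> I \<longrightarrow> \<phi> \<in> ms s}"
  interpret J: cideal UNIV J
    by standard (auto simp: J_def intro: cideal.zero_ideal[OF ms_ideal]
        cideal.add_ideal[OF ms_ideal] cideal.mult_ideal[OF ms_ideal])
  interpret PJ: cideal UNIV "polys J"
    using cideal_polys[OF J.cideal_axioms] by simp
  have \<iota>J: "\<iota> a \<in> J \<longleftrightarrow> a \<in> I" for a
    using m(4,5) by (auto simp: J_def ms_def \<iota>_def)
  have \<iota>PJ: "map_poly \<iota> q \<in> polys J \<longleftrightarrow> q \<in> polys I" for q
    by (auto simp: polys_def \<iota>.coeff_map \<iota>J)
  have J_ms: "J \<subseteq> ms s" if "s \<notin> I" for s using that by (auto simp: J_def)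
  have polys_mono: "q \<in> polys K \<Longrightarrow> K \<subseteq> L \<Longrightarrow> q \<in> polys L" for q and K L :: "('r \<Rightarrow> 'r poly) set"
    by (rule polysI) (use polysD in blast)
  have rad_J: "radical_in UNIV J"
  proof -
    have "\<phi> \<in> ms s" if s: "s \<notin> I" and \<phi>: "\<phi> * \<phi> \<in> ms s" for s \<phi>
    proof (rule ccontr)
      interpret ms: cideal UNIV "ms s" using ms_ideal[OF s] .
      assume "\<phi> \<notin> ms s"
      then obtain y where y: "\<phi> * y - 1 \<in> ms s" using ms_inv[OF s] by blast
      have "y * y * (\<phi> * \<phi>) - (\<phi> * y + 1) * (\<phi> * y - 1) \<in> ms s"
        by (rule ms.diff_ideal[OF ms.mult_ideal[OF UNIV_I \<phi>] ms.mult_ideal[OF UNIV_I y]])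
      then show False using ms_one[OF s] unfolding unit_square by blast
    qed
    then show ?thesis unfolding radical_in_def J_def by blast
  qed
  define A where "A = {\<phi>. \<exists>a. \<phi> - \<iota> a \<in> J}"
  have AI: "\<phi> \<in> A" if "\<phi> - \<iota> a \<in> J" for \<phi> a using that by (auto simp: A_def)
  have \<iota>A: "\<iota> a \<in> A" for a using AI[of "\<iota> a" a] J.zero_ideal by simp
  have mapA: "map_poly \<iota> q \<in> polys A" for q by (rule polysI) (simp add: \<iota>.coeff_map \<iota>A)
  have A: "csubring A"
  proof
    show "1 \<in> A" using \<iota>A[of 1] by (simp add: \<iota>.one)
    fix u v assume "u \<in> A" "v \<in> A"
    then obtain a b where ab: "u - \<iota> a \<in> J" "v - \<iota> b \<in> J" by (auto simp: A_def)
    have "(u - v) - \<iota> (a - b) = (u - \<iota> a) - (v - \<iota> b)" by (simp add: \<iota>.diff)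
    also have "\<dots> \<in> J" by (rule J.diff_ideal[OF ab])
    finally show "u - v \<in> A" by (rule AI)
    have "u * v - \<iota> (a * b) \<in> J" unfolding \<iota>.mult by (rule J.cong_mult[OF ab]) auto
    then show "u * v \<in> A" by (rule AI)
  qed
  have JA: "J \<subseteq> A" using AI[of _ 0] by (auto simp: \<iota>.zero)
  have semin_A: "u \<in> A" if u: "u * u \<in> A" "u * u * u \<in> A" for u
  proof -
    obtain c b where cb: "u * u - \<iota> c \<in> J" "u * u * u - \<iota> b \<in> J" using u by (auto simp: A_def)
    have "\<iota> (b^2 - c^3) = \<iota> b * \<iota> b - \<iota> c * (\<iota> c * \<iota> c)"
      by (simp only: \<iota>.diff \<iota>.mult power2_eq_square power3_eq_cube mult.assoc)
    also have "\<dots> = (\<iota> b * \<iota> b - (u * u * u) * (u * u * u)) + ((u * u) * ((u * u) * (u * u)) - \<iota> c * (\<iota> c * \<iota> c))"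
      by (rule square_cube_split)
    also have "\<dots> \<in> J"
      by (rule J.add_ideal[OF J.cong_mult[OF J.cong_sym[OF cb(2)] J.cong_sym[OF cb(2)]]
          J.cong_mult[OF cb(1) J.cong_mult[OF cb(1) cb(1)]]]) auto
    finally have "b^2 - c^3 \<in> I" by (simp only: \<iota>J)
    from semin[OF this] obtain a where a: "a^3 - b \<in> I" "a^2 - c \<in> I" by (elim exE conjE)
    define \<alpha> where "\<alpha> = \<iota> a"
    have 2: "u * u - \<alpha> * \<alpha> \<in> J"
    proof -
      have "u * u - \<alpha> * \<alpha> = (u * u - \<iota> c) - \<iota> (a^2 - c)"
        by (simp add: \<alpha>_def \<iota>.diff \<iota>.mult power2_eq_square)
      also have "\<dots> \<in> J" by (rule J.diff_ideal[OF cb(1) iffD2[OF \<iota>J a(2)]])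
      finally show ?thesis .
    qed
    have 3: "u * u * u - \<alpha> * \<alpha> * \<alpha> \<in> J"
    proof -
      have "u * u * u - \<alpha> * \<alpha> * \<alpha> = (u * u * u - \<iota> b) - \<iota> (a^3 - b)"
        by (simp add: \<alpha>_def \<iota>.diff \<iota>.mult power3_eq_cube)
      also have "\<dots> \<in> J" by (rule J.diff_ideal[OF cb(2) iffD2[OF \<iota>J a(1)]])
      finally show ?thesis .
    qed
    have "(u - \<alpha>) ^ 3 = 4 * (u * u * u - \<alpha> * \<alpha> * \<alpha>) - (3 * (\<alpha> + u)) * (u * u - \<alpha> * \<alpha>)"
      by (rule cube_difference)
    also have "\<dots> \<in> J" by (intro 2 3 J.diff_ideal J.mult_ideal UNIV_I)
    finally have "u - \<alpha> \<in> J" by (rule J.radical_power[OF rad_J UNIV_I])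
    then show ?thesis unfolding \<alpha>_def by (rule AI)
  qed
  define D where "D = (\<Sum>(i, j)\<in>S \<times> S. Polynomial.degree (M i j))"
  have D: "poly.coeff (M i j) k = 0" if "i \<in> S" "j \<in> S" "D < k" for i j k
  proof -
    have "Polynomial.degree (M i j) \<le> D"
      unfolding D_def using that(1,2) S
      member_le_sum[of "(i, j)" "S \<times> S" "\<lambda>(i, j). Polynomial.degree (M i j)"] by auto
    then show ?thesis using that by (intro coeff_eq_0) simp
  qed
  define N where "N i j = map_poly \<iota> (M i j)" for i j
  have N_minors: "N i j * N k l - N i l * N k j \<in> polys J" if "i \<in> S" "j \<in> S" "k \<in> S" "l \<in> S" for i j k l
    unfolding N_def using minors[OF that] \<iota>PJ by (simp flip: \<iota>.map_mult \<iota>.map_diff)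
  have N_trace: "(\<Sum>i\<in>S. N i i) - 1 \<in> polys J"
    unfolding N_def using trace \<iota>PJ \<iota>.map_one by (metis \<iota>.map_diff \<iota>.map_sum)
  have N_init: "poly.coeff (N i j) 0 - \<iota> (x i) * \<iota> (y j) \<in> J" if "i \<in> S" "j \<in> S" for i j
    unfolding N_def using init[OF that] \<iota>J by (simp add: \<iota>.coeff_map flip: \<iota>.mult \<iota>.diff)
  have N_D: "poly.coeff (N i j) k = 0" if "i \<in> S" "j \<in> S" "D < k" for i j k
    using D[OF that] by (simp add: N_def \<iota>.coeff_map \<iota>.zero)
  define ok where "ok s f g \<longleftrightarrow> (\<forall>i\<in>S. \<forall>j\<in>S. f i * g j - N i j \<in> polys (ms s)) \<and>
    (\<forall>i\<in>S. poly.coeff (f i) 0 - \<iota> (x i) \<in> ms s \<and> poly.coeff (g i) 0 - \<iota> (y i) \<in> ms s) \<and>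
    (\<forall>i\<in>S. \<forall>k>D. poly.coeff (f i) k \<in> ms s \<and> poly.coeff (g i) k \<in> ms s)"
    for s and f g :: "'i \<Rightarrow> ('r \<Rightarrow> 'r poly) poly"
  have "\<exists>f g. ok s f g" if s: "s \<notin> I" for s
    unfolding ok_def
    by (rule factor_mod_maximal[OF ms_ideal[OF s] ms_one[OF s] ms_inv[OF s] S
        polys_mono[OF N_minors J_ms[OF s]] polys_mono[OF N_trace J_ms[OF s]]
        subsetD[OF J_ms[OF s] N_init] N_D])
  then have "\<forall>s. \<exists>fg. s \<notin> I \<longrightarrow> ok s (fst fg) (snd fg)"
    by (metis fst_conv snd_conv)
  from choice[OF this] obtain fg where fg: "\<And>s. s \<notin> I \<Longrightarrow> ok s (fst (fg s)) (snd (fg s))"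
    by blast
  define fs where "fs s = fst (fg s)" for s
  define gs where "gs s = snd (fg s)" for s
  have fgs: "i \<in> S \<Longrightarrow> j \<in> S \<Longrightarrow> fs s i * gs s j - N i j \<in> polys (ms s)"
    and fs0: "i \<in> S \<Longrightarrow> poly.coeff (fs s i) 0 - \<iota> (x i) \<in> ms s"
    and gs0: "i \<in> S \<Longrightarrow> poly.coeff (gs s i) 0 - \<iota> (y i) \<in> ms s"
    and fsD: "i \<in> S \<Longrightarrow> k > D \<Longrightarrow> poly.coeff (fs s i) k \<in> ms s"
    and gsD: "i \<in> S \<Longrightarrow> k > D \<Longrightarrow> poly.coeff (gs s i) k \<in> ms s" if "s \<notin> I" for s i j k
    using fg[OF that] unfolding ok_def fs_def gs_def by auto
  (* the coefficients above D vanish componentwise, so a common degree bound is available *)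
  define glue where "glue qs = (\<Sum>k\<le>D. Polynomial.monom (\<lambda>s. poly.coeff (qs s) k s) k)"
    for qs :: "'r \<Rightarrow> ('r \<Rightarrow> 'r poly) poly"
  have glue: "glue qs - qs s \<in> polys (ms s)"
    if s: "s \<notin> I" and qs: "\<And>k. D < k \<Longrightarrow> poly.coeff (qs s) k \<in> ms s" for qs s
  proof (rule polysI)
    fix k
    interpret ms: cideal UNIV "ms s" using ms_ideal[OF s] .
    have "poly.coeff (glue qs) k = (\<Sum>l\<le>D. if l = k then (\<lambda>s. poly.coeff (qs s) k s) else 0)"
      unfolding glue_def coeff_sum by (rule sum.cong) auto
    also have "\<dots> = (if k \<le> D then (\<lambda>s. poly.coeff (qs s) k s) else 0)"
      by simp
    finally show "poly.coeff (glue qs - qs s) k \<in> ms s"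
      using ms.minus_ideal[OF qs[of k]] ms.zero_ideal by (auto simp: ms_def)
  qed
  define f where "f i = glue (\<lambda>s. fs s i)" for i
  define g where "g i = glue (\<lambda>s. gs s i)" for i
  have f_fs: "f i - fs s i \<in> polys (ms s)" if "s \<notin> I" "i \<in> S" for s i
    unfolding f_def by (rule glue[where qs = "\<lambda>s. fs s i", OF that(1) fsD[OF that]])
  have g_gs: "g i - gs s i \<in> polys (ms s)" if "s \<notin> I" "i \<in> S" for s i
    unfolding g_def by (rule glue[where qs = "\<lambda>s. gs s i", OF that(1) gsD[OF that]])
  have fgN: "f i * g j - N i j \<in> polys J" if ij: "i \<in> S" "j \<in> S" for i j
  proof -
    have "f i * g j - N i j \<in> polys (ms s)" if s: "s \<notin> I" for s
    proof -
      interpret P: cideal UNIV "polys (ms s)" using cideal_polys[OF ms_ideal[OF s]] by simp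
      show ?thesis
        by (rule P.cong_trans[OF P.cong_mult[OF f_fs[OF s ij(1)] g_gs[OF s ij(2)] UNIV_I UNIV_I] fgs[OF s ij]])
    qed
    then show ?thesis by (auto simp: polys_def J_def)
  qed
  have f0: "poly.coeff (f i) 0 - \<iota> (x i) \<in> J" and g0: "poly.coeff (g i) 0 - \<iota> (y i) \<in> J" if i: "i \<in> S" for i
  proof -
    have "poly.coeff (f i) 0 - \<iota> (x i) \<in> ms s" "poly.coeff (g i) 0 - \<iota> (y i) \<in> ms s" if s: "s \<notin> I" for s
    proof -
      interpret ms: cideal UNIV "ms s" using ms_ideal[OF s] .
      show "poly.coeff (f i) 0 - \<iota> (x i) \<in> ms s"
        by (rule ms.cong_trans[OF polysD[OF f_fs[OF s i], of 0, unfolded coeff_diff] fs0[OF s i]])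
      show "poly.coeff (g i) 0 - \<iota> (y i) \<in> ms s"
        by (rule ms.cong_trans[OF polysD[OF g_gs[OF s i], of 0, unfolded coeff_diff] gs0[OF s i]])
    qed
    then show "poly.coeff (f i) 0 - \<iota> (x i) \<in> J" "poly.coeff (g i) 0 - \<iota> (y i) \<in> J" by (auto simp: J_def)
  qed
  interpret PA: csubring "polys A" by (rule csubring_polys[OF A])
  interpret descent J A S f g "\<lambda>i. \<iota> (x i)" "\<lambda>i. \<iota> (y i)"
  proof
    fix i j assume ij: "i \<in> S" "j \<in> S"
    have "f i * g j - N i j \<in> polys A"
      using fgN[OF ij] JA by (rule polys_mono)
    then have "(f i * g j - N i j) + N i j \<in> polys A"
      unfolding N_def by (intro PA.add_mem mapA)
    then show "f i * g j \<in> polys A" by simp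
  next
    have "(\<Sum>i\<in>S. f i * g i) - (\<Sum>i\<in>S. N i i) \<in> polys J"
      by (rule PJ.cong_sum) (rule fgN)
    then show "(\<Sum>i\<in>S. f i * g i) - 1 \<in> polys J"
      using N_trace by (rule PJ.cong_trans)
  next
    fix p assume p: "cideal A p" "J \<subseteq> p" "1 \<notin> p" "\<And>a b. a \<in> A \<Longrightarrow> b \<in> A \<Longrightarrow> a * b \<in> p \<Longrightarrow> a \<in> p \<or> b \<in> p"
    interpret p: cideal A p by fact
    interpret Pp: cideal "polys A" "polys p" by (rule cideal_polys) fact
    define p0 where "p0 = {a. \<iota> a \<in> p}"
    have p0: "cideal UNIV p0"
    proof
      show "0 \<in> p0" by (simp add: p0_def \<iota>.zero p.zero_ideal)
      show "a + b \<in> p0" if "a \<in> p0" "b \<in> p0" for a b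
        using p.add_ideal that by (simp add: p0_def \<iota>.add)
      show "e * a \<in> p0" if "a \<in> p0" for e a
        using p.mult_ideal[OF \<iota>A] that by (simp add: p0_def \<iota>.mult)
    qed auto
    have Ip0: "I \<subseteq> p0" using \<iota>J p(2) by (auto simp: p0_def)
    have Pp0: "map_poly \<iota> q \<in> polys p \<longleftrightarrow> q \<in> polys p0" for q
      by (auto simp: polys_def \<iota>.coeff_map p0_def)
    have one0: "1 \<notin> p0" using p(3) by (simp add: p0_def \<iota>.one)
    have prime0: "a \<in> p0 \<or> b \<in> p0" if "a * b \<in> p0" for a b
      using that p(4)[OF \<iota>A \<iota>A] by (simp add: p0_def \<iota>.mult)
    have I_p0: "q \<in> polys I \<Longrightarrow> q \<in> polys p0" for q using Ip0 by (auto simp: polys_def)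
    have "\<exists>t h k. t \<notin> p0 \<and> (\<forall>i\<in>S. \<forall>j\<in>S. h i * k j - smult (t^2) (M i j) \<in> polys p0) \<and>
      (\<forall>i\<in>S. poly.coeff (h i) 0 - t * x i \<in> p0) \<and> (\<forall>j\<in>S. poly.coeff (k j) 0 - t * y j \<in> p0)"
      by (rule factor_mod_prime[OF p0 one0 prime0 S I_p0[OF minors] I_p0[OF trace] subsetD[OF Ip0 init]])
    then obtain t h k where t: "t \<notin> p0"
      and hk: "\<And>i j. i \<in> S \<Longrightarrow> j \<in> S \<Longrightarrow> h i * k j - smult (t^2) (M i j) \<in> polys p0"
      and h0: "\<And>i. i \<in> S \<Longrightarrow> poly.coeff (h i) 0 - t * x i \<in> p0"
      and k0: "\<And>i. i \<in> S \<Longrightarrow> poly.coeff (k i) 0 - t * y i \<in> p0"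
      by blast
    have hk_p: "map_poly \<iota> (h i) * map_poly \<iota> (k j) - [:\<iota> t * \<iota> t:] * (f i * g j) \<in> polys p"
      if ij: "i \<in> S" "j \<in> S" for i j
    proof -
      have "map_poly \<iota> (smult (t^2) (M i j)) = [:\<iota> t * \<iota> t:] * N i j"
        unfolding N_def by (rule poly_eqI) (simp add: \<iota>.coeff_map \<iota>.mult power2_eq_square mult.assoc)
      then have 1: "map_poly \<iota> (h i) * map_poly \<iota> (k j) - [:\<iota> t * \<iota> t:] * N i j \<in> polys p"
        using hk[OF ij] by (simp only: flip: Pp0) (simp add: \<iota>.map_mult \<iota>.map_diff)
      have "[:\<iota> t * \<iota> t:] * (f i * g j - N i j) \<in> polys J"
        by (intro fgN[OF ij] PJ.mult_ideal UNIV_I)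
      then have 2: "[:\<iota> t * \<iota> t:] * (f i * g j - N i j) \<in> polys p"
        using p(2) by (rule polys_mono)
      have split: "q - c * (f i * g j) = (q - c * N i j) - c * (f i * g j - N i j)" for c q
        by (simp add: algebra_simps)
      show ?thesis
        by (subst split) (rule Pp.diff_ideal[OF 1 2])
    qed
    have h0_p: "poly.coeff (map_poly \<iota> (h i)) 0 - \<iota> t * \<iota> (x i) \<in> p" if "i \<in> S" for i
      using h0[OF that] by (simp add: p0_def \<iota>.coeff_map \<iota>.diff \<iota>.mult)
    have k0_p: "poly.coeff (map_poly \<iota> (k i)) 0 - \<iota> t * \<iota> (y i) \<in> p" if "i \<in> S" for i
      using k0[OF that] by (simp add: p0_def \<iota>.coeff_map \<iota>.diff \<iota>.mult)
    have t_p: "\<iota> t \<notin> p" using t by (simp add: p0_def)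
    show "\<exists>t h k. t \<in> A \<and> t \<notin> p \<and> (\<forall>i\<in>S. h i \<in> polys A \<and> k i \<in> polys A) \<and>
          (\<forall>i\<in>S. \<forall>j\<in>S. h i * k j - [:t * t:] * (f i * g j) \<in> polys p) \<and>
          (\<forall>i\<in>S. poly.coeff (h i) 0 - t * \<iota> (x i) \<in> p \<and> poly.coeff (k i) 0 - t * \<iota> (y i) \<in> p)"
      by (rule exI[of _ "\<iota> t"], rule exI[of _ "\<lambda>i. map_poly \<iota> (h i)"], rule exI[of _ "\<lambda>i. map_poly \<iota> (k i)"])
         (intro conjI ballI hk_p h0_p k0_p t_p \<iota>A mapA)
  qed (fact csubring.one_mem[OF A] csubring.diff_mem[OF A] csubring.mult_mem[OF A] JA semin_A S | rule \<iota>A | rule f0 g0, assumption)+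
  have lift: "\<exists>q'. q - map_poly \<iota> q' \<in> polys J" if q: "q \<in> polys A" for q
  proof -
    obtain a where a: "\<And>k. poly.coeff q k - \<iota> (a k) \<in> J"
      using polysD[OF q] unfolding A_def by (simp add: choice_iff) metis
    define q' where "q' = (\<Sum>k\<le>Polynomial.degree q. Polynomial.monom (a k) k)"
    have "poly.coeff q k - \<iota> (poly.coeff q' k) \<in> J" for k
    proof (cases "k \<le> Polynomial.degree q")
      case True
      then show ?thesis using a by (simp add: q'_def coeff_sum)
    next
      case False
      then show ?thesis by (simp add: q'_def coeff_sum coeff_eq_0 \<iota>.zero J.zero_ideal)
    qed
    then show ?thesis by (intro exI[of _ q'] polysI) (simp add: \<iota>.coeff_map)
  qed
  obtain f' where f': "\<And>i. i \<in> S \<Longrightarrow> f i - map_poly \<iota> (f' i) \<in> polys J"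
    using lift[OF descends(1)] by metis
  obtain g' where g': "\<And>i. i \<in> S \<Longrightarrow> g i - map_poly \<iota> (g' i) \<in> polys J"
    using lift[OF descends(2)] by metis
  have "f' i * g' j - M i j \<in> polys I" if ij: "i \<in> S" "j \<in> S" for i j
  proof -
    have 1: "f i * g j - map_poly \<iota> (f' i) * map_poly \<iota> (g' j) \<in> polys J"
      by (rule PJ.cong_mult[OF f'[OF ij(1)] g'[OF ij(2)]]) auto
    have "map_poly \<iota> (f' i) * map_poly \<iota> (g' j) - N i j \<in> polys J"
      by (rule PJ.cong_trans[OF PJ.cong_sym[OF 1] fgN[OF ij]])
    then show ?thesis
      unfolding N_def by (simp flip: \<iota>.map_mult \<iota>.map_diff add: \<iota>PJ)
  qed
  then show ?thesis by blast
qed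

section \<open>The free commutative ring on a set\<close>

text \<open>Terms over the elements of a ring, modulo the ring axioms. The point of the construction is that
  any ring given by a carrier is a quotient of a ring given by a type class.\<close>

datatype 'a ring_term = Gen 'a | Zero | One | Neg "'a ring_term"
  | Add "'a ring_term" "'a ring_term" | Mul "'a ring_term" "'a ring_term"

inductive ring_eq :: "'a ring_term \<Rightarrow> 'a ring_term \<Rightarrow> bool" where
  rt_refl: "ring_eq s s"
| rt_sym: "ring_eq s t \<Longrightarrow> ring_eq t s"
| rt_trans: "ring_eq s t \<Longrightarrow> ring_eq t u \<Longrightarrow> ring_eq s u"
| rt_neg: "ring_eq s t \<Longrightarrow> ring_eq (Neg s) (Neg t)"
| rt_add: "ring_eq s s' \<Longrightarrow> ring_eq t t' \<Longrightarrow> ring_eq (Add s t) (Add s' t')"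
| rt_mul: "ring_eq s s' \<Longrightarrow> ring_eq t t' \<Longrightarrow> ring_eq (Mul s t) (Mul s' t')"
| rt_add_assoc: "ring_eq (Add (Add s t) u) (Add s (Add t u))"
| rt_add_comm: "ring_eq (Add s t) (Add t s)"
| rt_add_zero: "ring_eq (Add Zero s) s"
| rt_add_neg: "ring_eq (Add (Neg s) s) Zero"
| rt_mul_assoc: "ring_eq (Mul (Mul s t) u) (Mul s (Mul t u))"
| rt_mul_comm: "ring_eq (Mul s t) (Mul t s)"
| rt_mul_one: "ring_eq (Mul One s) s"
| rt_distrib: "ring_eq (Mul (Add s t) u) (Add (Mul s u) (Mul t u))"

quotient_type 'a free_ring = "'a ring_term" / ring_eq
  by (rule equivpI) (auto simp: reflp_def symp_def transp_def intro: ring_eq.rt_refl ring_eq.rt_sym ring_eq.rt_trans)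

text \<open>The homomorphism to the field with two elements that kills the generators; it separates 0 from 1.\<close>

primrec term_parity :: "'a ring_term \<Rightarrow> bool" where
  "term_parity (Gen x) = False"
| "term_parity Zero = False"
| "term_parity One = True"
| "term_parity (Neg s) = term_parity s"
| "term_parity (Add s t) = (term_parity s \<noteq> term_parity t)"
| "term_parity (Mul s t) = (term_parity s \<and> term_parity t)"

lemma ring_eq_parity: "ring_eq s t \<Longrightarrow> term_parity s = term_parity t"
  by (induction rule: ring_eq.induct) auto

instantiation free_ring :: (type) comm_ring_1
begin

lift_definition zero_free_ring :: "'a free_ring" is Zero .
lift_definition one_free_ring :: "'a free_ring" is One .
lift_definition uminus_free_ring :: "'a free_ring \<Rightarrow> 'a free_ring" is Neg by (rule ring_eq.rt_neg)
lift_definition plus_free_ring :: "'a free_ring \<Rightarrow> 'a free_ring \<Rightarrow> 'a free_ring" is Add by (rule ring_eq.rt_add)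
lift_definition times_free_ring :: "'a free_ring \<Rightarrow> 'a free_ring \<Rightarrow> 'a free_ring" is Mul by (rule ring_eq.rt_mul)
lift_definition minus_free_ring :: "'a free_ring \<Rightarrow> 'a free_ring \<Rightarrow> 'a free_ring" is "\<lambda>s t. Add s (Neg t)"
  by (intro ring_eq.rt_add ring_eq.rt_neg)

instance
proof
  show "(0::'a free_ring) \<noteq> 1"
    by transfer (auto dest: ring_eq_parity)
qed (transfer; fact ring_eq.intros ring_eq.rt_refl)+

end

text \<open>Generators outside the carrier are sent to zero, so that evaluation is total and lands in the
  carrier.\<close>

primrec term_value :: "('a, 'r) ring_scheme \<Rightarrow> 'a ring_term \<Rightarrow> 'a" where
  "term_value R (Gen x) = (if x \<in> carrier R then x else \<zero>\<^bsub>R\<^esub>)"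
| "term_value R Zero = \<zero>\<^bsub>R\<^esub>"
| "term_value R One = \<one>\<^bsub>R\<^esub>"
| "term_value R (Neg s) = \<ominus>\<^bsub>R\<^esub> term_value R s"
| "term_value R (Add s t) = term_value R s \<oplus>\<^bsub>R\<^esub> term_value R t"
| "term_value R (Mul s t) = term_value R s \<otimes>\<^bsub>R\<^esub> term_value R t"

definition free_eval :: "('a, 'r) ring_scheme \<Rightarrow> 'a free_ring \<Rightarrow> 'a" where
  "free_eval R q = term_value R (rep_free_ring q)"

definition free_gen :: "'a \<Rightarrow> 'a free_ring" where
  "free_gen x = abs_free_ring (Gen x)"

context cring
begin

lemma term_value_closed: "term_value R s \<in> carrier R"
  by (induction s) auto

lemma ring_eq_value: "ring_eq s t \<Longrightarrow> term_value R s = term_value R t"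
  by (induction rule: ring_eq.induct)
     (simp_all add: term_value_closed a_assoc l_neg m_assoc l_distr, simp_all add: term_value_closed a_comm m_comm)

lemma free_eval_abs: "free_eval R (abs_free_ring s) = term_value R s"
proof -
  have "ring_eq (rep_free_ring (abs_free_ring s)) s"
    using Quotient3_rep_abs[OF Quotient3_free_ring] ring_eq.rt_refl by blast
  then show ?thesis unfolding free_eval_def by (rule ring_eq_value)
qed

lemma free_eval_closed [simp]: "free_eval R q \<in> carrier R"
  by (simp add: free_eval_def term_value_closed)

lemma free_eval_gen: "x \<in> carrier R \<Longrightarrow> free_eval R (free_gen x) = x"
  by (simp add: free_gen_def free_eval_abs)

lemma free_eval_zero: "free_eval R 0 = \<zero>"
  by (simp add: zero_free_ring_def free_eval_abs)

lemma free_eval_one: "free_eval R 1 = \<one>"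
  by (simp add: one_free_ring_def free_eval_abs)

lemma free_eval_add: "free_eval R (p + q) = free_eval R p \<oplus> free_eval R q"
  by (induct p rule: free_ring.abs_induct, induct q rule: free_ring.abs_induct) (simp add: plus_free_ring.abs_eq free_eval_abs)

lemma free_eval_mult: "free_eval R (p * q) = free_eval R p \<otimes> free_eval R q"
  by (induct p rule: free_ring.abs_induct, induct q rule: free_ring.abs_induct) (simp add: times_free_ring.abs_eq free_eval_abs)

lemma free_eval_diff: "free_eval R (p - q) = free_eval R p \<ominus> free_eval R q"
  by (induct p rule: free_ring.abs_induct, induct q rule: free_ring.abs_induct) (simp add: minus_free_ring.abs_eq free_eval_abs a_minus_def)

lemma free_eval_sum:
  "finite A \<Longrightarrow> free_eval R (sum f A) = (\<Oplus>i\<in>A. free_eval R (f i))"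
  by (induction rule: finite_induct) (auto simp: free_eval_zero free_eval_add)

lemma free_eval_power: "free_eval R (p ^ n) = free_eval R p [^] n"
  by (induction n) (auto simp: free_eval_one free_eval_mult m_comm)

definition free_kernel :: "'a free_ring set" where
  "free_kernel = {q. free_eval R q = \<zero>}"

lemma free_kernel_diff: "p - q \<in> free_kernel \<longleftrightarrow> free_eval R p = free_eval R q"
  by (auto simp: free_kernel_def free_eval_diff)

lemma free_kernel_ideal: "cideal UNIV free_kernel"
  by standard (auto simp: free_kernel_def free_eval_zero free_eval_add free_eval_mult)

definition free_eval_poly :: "'a free_ring poly \<Rightarrow> nat \<Rightarrow> 'a" where
  "free_eval_poly p = (\<lambda>n. free_eval R (poly.coeff p n))"

lemma free_eval_poly_closed [simp]: "free_eval_poly p \<in> carrier (UP R)"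
proof -
  have "free_eval_poly p \<in> up R"
  proof (rule mem_upI)
    show "free_eval_poly p n \<in> carrier R" for n by (simp add: free_eval_poly_def)
    show "\<exists>n. bound \<zero> n (free_eval_poly p)"
      by (rule exI[of _ "Polynomial.degree p"]) (auto simp: free_eval_poly_def free_eval_zero coeff_eq_0)
  qed
  then show ?thesis by (simp add: UP_def)
qed

lemma free_eval_poly_surj:
  assumes "q \<in> carrier (UP R)" obtains p where "free_eval_poly p = q"
proof -
  have q: "q \<in> up R" using assms by (simp add: UP_def)
  then obtain n where n: "bound \<zero> n q" by blast
  define p where "p = (\<Sum>k\<le>n. Polynomial.monom (free_gen (q k)) k)"
  have "free_eval_poly p = q"
  proof
    fix k
    show "free_eval_poly p k = q k"
    proof (cases "k \<le> n")
      case True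
      then show ?thesis
        using mem_upD[OF q] by (simp add: free_eval_poly_def p_def coeff_sum free_eval_gen)
    next
      case False
      then show ?thesis
        using n by (simp add: free_eval_poly_def p_def coeff_sum free_eval_zero bound_def)
    qed
  qed
  then show thesis by (rule that)
qed

lemma free_eval_poly_mult:
  "free_eval_poly (p * q) = free_eval_poly p \<otimes>\<^bsub>UP R\<^esub> free_eval_poly q"
proof -
  have "free_eval_poly p \<in> up R" "free_eval_poly q \<in> up R"
    using free_eval_poly_closed by (simp_all add: UP_def)
  then show ?thesis
    by (simp add: UP_def) (simp add: free_eval_poly_def coeff_mult free_eval_sum free_eval_mult)
qed

lemma free_eval_poly_add:
  "free_eval_poly (p + q) = free_eval_poly p \<oplus>\<^bsub>UP R\<^esub> free_eval_poly q"
proof -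
  have "free_eval_poly p \<in> up R" "free_eval_poly q \<in> up R"
    using free_eval_poly_closed by (simp_all add: UP_def)
  then show ?thesis
    by (simp add: UP_def) (simp add: free_eval_poly_def free_eval_add)
qed

lemma free_eval_poly_zero: "free_eval_poly 0 = \<zero>\<^bsub>UP R\<^esub>"
  by (simp add: UP_def free_eval_poly_def free_eval_zero)

lemma free_eval_poly_one: "free_eval_poly 1 = \<one>\<^bsub>UP R\<^esub>"
  by (auto simp: UP_def free_eval_poly_def free_eval_zero free_eval_one coeff_1 fun_eq_iff)

lemma free_kernel_poly_diff: "p - q \<in> polys free_kernel \<longleftrightarrow> free_eval_poly p = free_eval_poly q"
  by (auto simp: polys_def free_kernel_diff free_eval_poly_def fun_eq_iff)

end

section \<open>Tensor products of modules with a dual basis\<close>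

lemma finsum_additive:
  assumes "abelian_group M" "abelian_group N" "\<And>x. x \<in> carrier M \<Longrightarrow> f x \<in> carrier N"
    and add: "\<And>x y. x \<in> carrier M \<Longrightarrow> y \<in> carrier M \<Longrightarrow> f (x \<oplus>\<^bsub>M\<^esub> y) = f x \<oplus>\<^bsub>N\<^esub> f y"
    and "finite A" "\<And>i. i \<in> A \<Longrightarrow> g i \<in> carrier M"
  shows "f (finsum M g A) = finsum N (\<lambda>i. f (g i)) A"
proof -
  interpret M: abelian_group M by fact
  interpret N: abelian_group N by fact
  have zero: "f \<zero>\<^bsub>M\<^esub> = \<zero>\<^bsub>N\<^esub>"
    using add[of "\<zero>\<^bsub>M\<^esub>" "\<zero>\<^bsub>M\<^esub>"] assms(3)[of "\<zero>\<^bsub>M\<^esub>"] by (simp add: N.add.l_cancel_one')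
  show ?thesis
    using assms(5,6)
  proof (induction rule: finite_induct)
    case empty
    then show ?case by (simp add: zero)
  next
    case (insert i A)
    then have "finsum M g A \<in> carrier M" by (intro M.finsum_closed) auto
    with insert show ?case by (simp add: add assms(3) Pi_def)
  qed
qed

text \<open>A finite dual basis. The \<open>e i\<close> generate \<open>M\<close> but need not be independent; that \<open>M\<close> has such data
  characterizes finitely generated projective modules.\<close>

locale frame = M: module R M
  for R :: "('a, 'r) ring_scheme" (structure) and M :: "('a, 'b, 'm) module_scheme" +
  fixes n :: nat and e :: "nat \<Rightarrow> 'b" and l :: "nat \<Rightarrow> 'b \<Rightarrow> 'a"
  assumes e: "i < n \<Longrightarrow> e i \<in> carrier M"
    and l: "i < n \<Longrightarrow> x \<in> carrier M \<Longrightarrow> l i x \<in> carrier R"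
    and l_add: "i < n \<Longrightarrow> x \<in> carrier M \<Longrightarrow> y \<in> carrier M \<Longrightarrow> l i (x \<oplus>\<^bsub>M\<^esub> y) = l i x \<oplus> l i y"
    and l_smult: "i < n \<Longrightarrow> a \<in> carrier R \<Longrightarrow> x \<in> carrier M \<Longrightarrow> l i (a \<odot>\<^bsub>M\<^esub> x) = a \<otimes> l i x"
    and expand: "x \<in> carrier M \<Longrightarrow> x = (\<Oplus>\<^bsub>M\<^esub>i\<in>{..<n}. l i x \<odot>\<^bsub>M\<^esub> e i)"

text \<open>The second factor carries two structures on the same group: over \<open>R\<close>, to form the tensor product, and over \<open>S\<close>, which acts on the
  result. The case \<open>S = R\<close> is the ordinary tensor product, the case where \<open>N\<close> is \<open>S\<close> itself is extension of
  scalars.\<close>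

locale tensor = frame R M n e l + N: module R N + N': module S N'
  for R :: "('a, 'r) ring_scheme" (structure) and M :: "('a, 'b, 'm) module_scheme" and n e l
    and N :: "('a, 'c, 'n) module_scheme" and S :: "('s, 't) ring_scheme"
    and N' :: "('s, 'c, 'n2) module_scheme" +
  assumes same: "carrier N' = carrier N" "(\<oplus>\<^bsub>N'\<^esub>) = (\<oplus>\<^bsub>N\<^esub>)" "\<zero>\<^bsub>N'\<^esub> = \<zero>\<^bsub>N\<^esub>"
    and commute: "\<And>s a y. s \<in> carrier S \<Longrightarrow> a \<in> carrier R \<Longrightarrow> y \<in> carrier N \<Longrightarrow>
      s \<odot>\<^bsub>N'\<^esub> (a \<odot>\<^bsub>N\<^esub> y) = a \<odot>\<^bsub>N\<^esub> (s \<odot>\<^bsub>N'\<^esub> y)"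
begin

abbreviation "B \<equiv> carrier M \<times> carrier N"
abbreviation "K \<equiv> tensor_kernel R M N"

definition cls :: "('b \<times> 'c \<Rightarrow>\<^sub>0 int) \<Rightarrow> ('b \<times> 'c \<Rightarrow>\<^sub>0 int) set" where
  "cls q = K #>\<^bsub>free_Abelian_group B\<^esub> q"

lemma relatorE:
  assumes "r \<in> tensor_relators R M N"
  obtains (left) x x' y where "r = frag_of (x \<oplus>\<^bsub>M\<^esub> x', y) - frag_of (x, y) - frag_of (x', y)"
      "x \<in> carrier M" "x' \<in> carrier M" "y \<in> carrier N"
  | (right) x y y' where "r = frag_of (x, y \<oplus>\<^bsub>N\<^esub> y') - frag_of (x, y) - frag_of (x, y')"
      "x \<in> carrier M" "y \<in> carrier N" "y' \<in> carrier N"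
  | (balanced) a x y where "r = frag_of (a \<odot>\<^bsub>M\<^esub> x, y) - frag_of (x, a \<odot>\<^bsub>N\<^esub> y)"
      "a \<in> carrier R" "x \<in> carrier M" "y \<in> carrier N"
  using assms unfolding tensor_relators_def by blast

lemma diff_keys:
  assumes "Poly_Mapping.keys p \<subseteq> B" "Poly_Mapping.keys q \<subseteq> B"
  shows "Poly_Mapping.keys (p - q) \<subseteq> B"
  using keys_diff[of p q] assms by blast

lemma pair_keys: "x \<in> carrier M \<Longrightarrow> y \<in> carrier N \<Longrightarrow> Poly_Mapping.keys (frag_of (x, y)) \<subseteq> B"
  by simp

lemma relators_keys:
  assumes "r \<in> tensor_relators R M N"
  shows "Poly_Mapping.keys r \<subseteq> B"
  using assms by (cases rule: relatorE) (simp_all add: diff_keys pair_keys)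

lemma K_subgroup: "subgroup K (free_Abelian_group B)"
  unfolding tensor_kernel_def
  by (rule group.generate_is_subgroup) (auto dest: relators_keys)

lemma K_keys: "k \<in> K \<Longrightarrow> Poly_Mapping.keys k \<subseteq> B"
  using subsetD[OF subgroup.subset[OF K_subgroup]] by (simp only: carrier_free_Abelian_group_iff)

lemma K_additive: "additive_set K"
proof -
  have "0 \<in> K" using subgroup.one_closed[OF K_subgroup] by simp
  moreover have "x - y \<in> K" if "x \<in> K" "y \<in> K" for x y
  proof -
    have "- y \<in> K" using subgroup.m_inv_closed[OF K_subgroup that(2)] K_keys[OF that(2)] by simp
    then show ?thesis using subgroup.m_closed[OF K_subgroup that(1), of "- y"] by simp
  qed
  ultimately show ?thesis by (simp add: additive_set_def)
qed

lemma K_relator: "r \<in> tensor_relators R M N \<Longrightarrow> r \<in> K"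
  unfolding tensor_kernel_def by (rule generate.incl)

lemma K_induct:
  assumes T: "additive_set T" and rel: "\<And>r. r \<in> tensor_relators R M N \<Longrightarrow> r \<in> T" and k: "k \<in> K"
  shows "k \<in> T"
  using k unfolding tensor_kernel_def
proof induction
  case (inv h)
  then show ?case
    using additive_setD(2)[OF T additive_setD(1)[OF T] rel[OF inv]] relators_keys by simp
qed (use T rel in \<open>auto simp: additive_setD\<close>)

lemma cls_image: "cls q = (\<lambda>k. k + q) ` K"
  by (auto simp: cls_def r_coset_def)

lemma cls_eq: "cls p = cls q \<longleftrightarrow> p - q \<in> K"
proof
  assume "cls p = cls q"
  moreover have "p \<in> cls p" unfolding cls_image using additive_setD(1)[OF K_additive] by force
  ultimately obtain k where "k \<in> K" "p = k + q" by (auto simp: cls_image)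
  then show "p - q \<in> K" by simp
next
  assume pq: "p - q \<in> K"
  show "cls p = cls q"
  proof
    show "cls p \<subseteq> cls q"
    proof
      fix z assume "z \<in> cls p"
      then obtain k where k: "k \<in> K" "z = k + p" by (auto simp: cls_image)
      then have "z = (k + (p - q)) + q" by simp
      then show "z \<in> cls q" unfolding cls_image by (rule image_eqI[OF _ additive_setD(3)[OF K_additive k(1) pq]])
    qed
    show "cls q \<subseteq> cls p"
    proof
      fix z assume "z \<in> cls q"
      then obtain k where k: "k \<in> K" "z = k + q" by (auto simp: cls_image)
      then have "z = (k - (p - q)) + p" by simp
      then show "z \<in> cls p" unfolding cls_image by (rule image_eqI[OF _ additive_setD(2)[OF K_additive k(1) pq]])
    qed
  qed
qed

lemma carrier_group: "carrier (tensor_group R M N) = cls ` {q. Poly_Mapping.keys q \<subseteq> B}"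
  by (auto simp: tensor_group_def FactGroup_def RCOSETS_def cls_def)

lemma one_group: "monoid.one (tensor_group R M N) = cls 0"
  by (auto simp: tensor_group_def FactGroup_def cls_image)

lemma mult_group: "monoid.mult (tensor_group R M N) (cls p) (cls q) = cls (p + q)"
proof -
  have "cls p <#>\<^bsub>free_Abelian_group B\<^esub> cls q = cls (p + q)"
  proof
    show "cls p <#>\<^bsub>free_Abelian_group B\<^esub> cls q \<subseteq> cls (p + q)"
    proof
      fix z assume "z \<in> cls p <#>\<^bsub>free_Abelian_group B\<^esub> cls q"
      then obtain k k' where *: "k \<in> K" "k' \<in> K" "z = (k + p) + (k' + q)"
        by (auto simp: set_mult_def cls_image)
      then have "z = (k + k') + (p + q)" by simp
      then show "z \<in> cls (p + q)" unfolding cls_image by (rule image_eqI[OF _ additive_setD(3)[OF K_additive *(1,2)]])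
    qed
    show "cls (p + q) \<subseteq> cls p <#>\<^bsub>free_Abelian_group B\<^esub> cls q"
    proof
      fix z assume "z \<in> cls (p + q)"
      then obtain k where *: "k \<in> K" "z = k + (p + q)" by (auto simp: cls_image)
      then have "z = (k + p) + (0 + q)" by simp
      moreover have "k + p \<in> cls p" "0 + q \<in> cls q"
        using * additive_setD(1)[OF K_additive] by (auto simp: cls_image simp del: add_0_left)
      ultimately show "z \<in> cls p <#>\<^bsub>free_Abelian_group B\<^esub> cls q"
        unfolding set_mult_def by auto
    qed
  qed
  then show ?thesis by (simp add: tensor_group_def FactGroup_def)
qed

text \<open>The form \<open>l i\<close> extended to the free group: \<open>(x, y)\<close> is sent to \<open>l i x \<odot> y\<close>. These forms kill the relations, and by
  \<open>normal_form\<close> they are all that is left of an element modulo the relations.\<close>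

definition th :: "nat \<Rightarrow> ('b \<times> 'c \<Rightarrow>\<^sub>0 int) \<Rightarrow> 'c" where
  "th i = (SOME h. h \<in> hom (free_Abelian_group B) (add_monoid N) \<and>
     (\<forall>x\<in>carrier M. \<forall>y\<in>carrier N. h (frag_of (x, y)) = l i x \<odot>\<^bsub>N\<^esub> y))"

lemma th:
  assumes i: "i < n"
  shows "th i \<in> hom (free_Abelian_group B) (add_monoid N)"
    and th_of: "x \<in> carrier M \<Longrightarrow> y \<in> carrier N \<Longrightarrow> th i (frag_of (x, y)) = l i x \<odot>\<^bsub>N\<^esub> y"
proof -
  have closed: "(\<lambda>(x, y). l i x \<odot>\<^bsub>N\<^esub> y) ` B \<subseteq> carrier N"
    using l[OF i] by auto
  obtain h where h: "h \<in> hom (free_Abelian_group B) (add_monoid N)"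
    "\<And>z. z \<in> B \<Longrightarrow> h (frag_of z) = (\<lambda>(x, y). l i x \<odot>\<^bsub>N\<^esub> y) z"
    by (rule N.add.free_Abelian_group_universal[OF closed]) blast
  have ex: "\<exists>h. h \<in> hom (free_Abelian_group B) (add_monoid N) \<and>
     (\<forall>x\<in>carrier M. \<forall>y\<in>carrier N. h (frag_of (x, y)) = l i x \<odot>\<^bsub>N\<^esub> y)"
    by (rule exI[of _ h]) (use h in simp)
  have *: "th i \<in> hom (free_Abelian_group B) (add_monoid N) \<and>
     (\<forall>x\<in>carrier M. \<forall>y\<in>carrier N. th i (frag_of (x, y)) = l i x \<odot>\<^bsub>N\<^esub> y)"
    unfolding th_def by (rule someI_ex[OF ex])
  show "th i \<in> hom (free_Abelian_group B) (add_monoid N)"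
    using * by (rule conjunct1)
  show "x \<in> carrier M \<Longrightarrow> y \<in> carrier N \<Longrightarrow> th i (frag_of (x, y)) = l i x \<odot>\<^bsub>N\<^esub> y"
    using * by simp
qed

lemma th_closed: "i < n \<Longrightarrow> Poly_Mapping.keys q \<subseteq> B \<Longrightarrow> th i q \<in> carrier N"
  using hom_in_carrier[OF th(1), of i q] by simp

lemma th_add: "i < n \<Longrightarrow> Poly_Mapping.keys p \<subseteq> B \<Longrightarrow> Poly_Mapping.keys q \<subseteq> B \<Longrightarrow> th i (p + q) = th i p \<oplus>\<^bsub>N\<^esub> th i q"
  using hom_mult[OF th(1), of i p q] by simp

lemma th_zero: "i < n \<Longrightarrow> th i 0 = \<zero>\<^bsub>N\<^esub>"
  using hom_one[OF th(1), of i] N.a_group by simp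

lemma th_diff:
  assumes "i < n" "Poly_Mapping.keys p \<subseteq> B" "Poly_Mapping.keys q \<subseteq> B"
  shows "th i (p - q) = th i p \<ominus>\<^bsub>N\<^esub> th i q"
proof -
  have k: "Poly_Mapping.keys (p - q) \<subseteq> B" using keys_diff[of p q] assms by blast
  have "th i p = th i (p - q) \<oplus>\<^bsub>N\<^esub> th i q"
    using th_add[OF assms(1) k assms(3)] by simp
  then show ?thesis
    using th_closed[OF assms(1)] k assms(3) by (simp add: a_minus_def N.a_assoc N.r_neg)
qed

lemma th_K:
  assumes i: "i < n" and k: "k \<in> K"
  shows "th i k = \<zero>\<^bsub>N\<^esub>"
proof -
  let ?T = "{k. Poly_Mapping.keys k \<subseteq> B \<and> th i k = \<zero>\<^bsub>N\<^esub>}"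
  have "k \<in> ?T"
  proof (rule K_induct[OF _ _ k])
    show "additive_set ?T"
      unfolding additive_set_def using i
      by (simp add: th_zero th_diff diff_keys N.r_neg a_minus_def)
    fix r assume r: "r \<in> tensor_relators R M N"
    from r have "th i r = \<zero>\<^bsub>N\<^esub>"
    proof (cases rule: relatorE)
      case (left x x' y)
      have "th i r = (l i x \<odot>\<^bsub>N\<^esub> y \<oplus>\<^bsub>N\<^esub> l i x' \<odot>\<^bsub>N\<^esub> y) \<ominus>\<^bsub>N\<^esub> l i x \<odot>\<^bsub>N\<^esub> y \<ominus>\<^bsub>N\<^esub> l i x' \<odot>\<^bsub>N\<^esub> y"
        unfolding left(1) using left i by (simp add: th_diff diff_keys th_of l l_add N.smult_l_distr)
      then show ?thesis using left i by (simp add: a_minus_def l N.a_ac N.r_neg N.r_neg1 N.r_neg2)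
    next
      case (right x y y')
      have "th i r = (l i x \<odot>\<^bsub>N\<^esub> y \<oplus>\<^bsub>N\<^esub> l i x \<odot>\<^bsub>N\<^esub> y') \<ominus>\<^bsub>N\<^esub> l i x \<odot>\<^bsub>N\<^esub> y \<ominus>\<^bsub>N\<^esub> l i x \<odot>\<^bsub>N\<^esub> y'"
        unfolding right(1) using right i by (simp add: th_diff diff_keys th_of l N.smult_r_distr)
      then show ?thesis using right i by (simp add: a_minus_def l N.a_ac N.r_neg N.r_neg1 N.r_neg2)
    next
      case (balanced a x y)
      have "th i r = (a \<otimes> l i x) \<odot>\<^bsub>N\<^esub> y \<ominus>\<^bsub>N\<^esub> l i x \<odot>\<^bsub>N\<^esub> (a \<odot>\<^bsub>N\<^esub> y)"
        unfolding balanced(1) using balanced i by (simp add: th_diff diff_keys th_of l l_smult)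
      also have "(a \<otimes> l i x) \<odot>\<^bsub>N\<^esub> y = l i x \<odot>\<^bsub>N\<^esub> (a \<odot>\<^bsub>N\<^esub> y)"
        using balanced i by (simp add: l N.smult_assoc1 M.R.m_comm flip: N.smult_assoc1)
      finally show ?thesis using balanced i by (simp add: a_minus_def l N.r_neg)
    qed
    then show "r \<in> ?T"
      using relators_keys[OF r] by simp
  qed
  then show ?thesis by simp
qed

lemma zero_right: "x \<in> carrier M \<Longrightarrow> frag_of (x, \<zero>\<^bsub>N\<^esub>) \<in> K"
proof -
  assume x: "x \<in> carrier M"
  have "frag_of (x, \<zero>\<^bsub>N\<^esub> \<oplus>\<^bsub>N\<^esub> \<zero>\<^bsub>N\<^esub>) - frag_of (x, \<zero>\<^bsub>N\<^esub>) - frag_of (x, \<zero>\<^bsub>N\<^esub>) \<in> K"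
    by (rule K_relator) (use x in \<open>unfold tensor_relators_def, blast\<close>)
  then show ?thesis
    using additive_setD(2)[OF K_additive additive_setD(1)[OF K_additive]] by fastforce
qed

lemma zero_left: "y \<in> carrier N \<Longrightarrow> frag_of (\<zero>\<^bsub>M\<^esub>, y) \<in> K"
proof -
  assume y: "y \<in> carrier N"
  have "frag_of (\<zero>\<^bsub>M\<^esub> \<oplus>\<^bsub>M\<^esub> \<zero>\<^bsub>M\<^esub>, y) - frag_of (\<zero>\<^bsub>M\<^esub>, y) - frag_of (\<zero>\<^bsub>M\<^esub>, y) \<in> K"
    by (rule K_relator) (use y in \<open>unfold tensor_relators_def, blast\<close>)
  then show ?thesis
    using additive_setD(2)[OF K_additive additive_setD(1)[OF K_additive]] by fastforce
qed

lemma cls_add_left: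
  "x \<in> carrier M \<Longrightarrow> x' \<in> carrier M \<Longrightarrow> y \<in> carrier N \<Longrightarrow>
    cls (frag_of (x \<oplus>\<^bsub>M\<^esub> x', y)) = cls (frag_of (x, y) + frag_of (x', y))"
  unfolding cls_eq diff_diff_eq[symmetric] by (rule K_relator) (unfold tensor_relators_def, blast)

lemma cls_add_right:
  "x \<in> carrier M \<Longrightarrow> y \<in> carrier N \<Longrightarrow> y' \<in> carrier N \<Longrightarrow>
    cls (frag_of (x, y \<oplus>\<^bsub>N\<^esub> y')) = cls (frag_of (x, y) + frag_of (x, y'))"
  unfolding cls_eq diff_diff_eq[symmetric] by (rule K_relator) (unfold tensor_relators_def, blast)

lemma cls_balanced:
  "a \<in> carrier R \<Longrightarrow> x \<in> carrier M \<Longrightarrow> y \<in> carrier N \<Longrightarrow>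
    cls (frag_of (a \<odot>\<^bsub>M\<^esub> x, y)) = cls (frag_of (x, a \<odot>\<^bsub>N\<^esub> y))"
  unfolding cls_eq by (rule K_relator) (unfold tensor_relators_def, blast)

lemma cls_zero: "cls q = cls 0 \<longleftrightarrow> q \<in> K"
  by (simp add: cls_eq)

lemma cls_add: "cls p = cls p' \<Longrightarrow> cls q = cls q' \<Longrightarrow> cls (p + q) = cls (p' + q')"
  unfolding cls_eq using additive_setD(3)[OF K_additive, of "p - p'" "q - q'"] by (simp add: algebra_simps)

lemma cls_diff: "cls p = cls p' \<Longrightarrow> cls q = cls q' \<Longrightarrow> cls (p - q) = cls (p' - q')"
  unfolding cls_eq using additive_setD(2)[OF K_additive, of "p - p'" "q - q'"] by (simp add: algebra_simps)

lemma cls_sum: "(\<And>i. i \<in> A \<Longrightarrow> cls (p i) = cls (p' i)) \<Longrightarrow> cls (sum p A) = cls (sum p' A)"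
proof (induction A rule: infinite_finite_induct)
  case (insert i A)
  then have "cls (p i + sum p A) = cls (p' i + sum p' A)" by (intro cls_add) auto
  then show ?case using insert by simp
qed simp_all

lemma cls_finsum_left:
  assumes y: "y \<in> carrier N" and "finite A" "\<And>i. i \<in> A \<Longrightarrow> f i \<in> carrier M"
  shows "cls (frag_of (finsum M f A, y)) = cls (\<Sum>i\<in>A. frag_of (f i, y))"
  using assms(2,3)
proof (induction rule: finite_induct)
  case empty
  then show ?case using zero_left[OF y] by (simp add: cls_zero)
next
  case (insert i A)
  have "finsum M f A \<in> carrier M" using insert by (intro M.finsum_closed) auto
  then have "cls (frag_of (finsum M f (insert i A), y)) = cls (frag_of (f i, y) + frag_of (finsum M f A, y))"
    using insert y by (simp add: cls_add_left Pi_def)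
  also have "\<dots> = cls (frag_of (f i, y) + (\<Sum>i\<in>A. frag_of (f i, y)))"
    using insert by (intro cls_add) auto
  finally show ?case using insert by simp
qed

lemma cls_finsum_right:
  assumes x: "x \<in> carrier M" and "finite A" "\<And>i. i \<in> A \<Longrightarrow> f i \<in> carrier N"
  shows "cls (frag_of (x, finsum N f A)) = cls (\<Sum>i\<in>A. frag_of (x, f i))"
  using assms(2,3)
proof (induction rule: finite_induct)
  case empty
  then show ?case using zero_right[OF x] by (simp add: cls_zero)
next
  case (insert i A)
  have "finsum N f A \<in> carrier N" using insert by (intro N.finsum_closed) auto
  then have "cls (frag_of (x, finsum N f (insert i A))) = cls (frag_of (x, f i) + frag_of (x, finsum N f A))"
    using insert x by (simp add: cls_add_right Pi_def)
  also have "\<dots> = cls (frag_of (x, f i) + (\<Sum>i\<in>A. frag_of (x, f i)))"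
    using insert by (intro cls_add) auto
  finally show ?case using insert by simp
qed

text \<open>Expand \<open>x\<close> in \<open>(x, y)\<close> along the dual basis and move the scalars to the right.\<close>

lemma normal_form:
  assumes "Poly_Mapping.keys q \<subseteq> B"
  shows "cls q = cls (\<Sum>i<n. frag_of (e i, th i q))"
  using assms
proof (induction q rule: free_Abelian_group_induct[consumes 1, case_names 1 2 3])
  case 1
  have "(\<Sum>i<n. frag_of (e i, th i 0)) \<in> K"
    by (rule additive_set_sum[OF K_additive]) (simp add: th_zero zero_right e)
  then show ?case using cls_zero by metis
next
  case (2 p q)
  have "cls (frag_of (e i, th i (p - q))) = cls (frag_of (e i, th i p) - frag_of (e i, th i q))" if i: "i < n" for i
  proof -
    have c: "th i p \<in> carrier N" "th i q \<in> carrier N" "th i (p - q) \<in> carrier N"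
      using th_closed[OF i 2(1)] th_closed[OF i 2(2)] th_closed[OF i diff_keys[OF 2(1,2)]] by this
    have "th i p = th i (p - q) \<oplus>\<^bsub>N\<^esub> th i q"
      using th_diff[OF i 2(1,2)] c by (simp add: a_minus_def N.a_assoc N.l_neg)
    then have "cls (frag_of (e i, th i p)) = cls (frag_of (e i, th i (p - q)) + frag_of (e i, th i q))"
      using cls_add_right[OF e[OF i] c(3,2)] by simp
    from cls_diff[OF this refl, of "frag_of (e i, th i q)"] show ?thesis by simp
  qed
  then have "cls (\<Sum>i<n. frag_of (e i, th i (p - q))) = cls (\<Sum>i<n. frag_of (e i, th i p) - frag_of (e i, th i q))"
    by (intro cls_sum) auto
  then show ?case using cls_diff[OF 2(3,4)] by (simp add: sum_subtractf)
next
  case (3 z)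
  then obtain x y where z: "z = (x, y)" and xy: "x \<in> carrier M" "y \<in> carrier N" by auto
  have "cls (frag_of (x, y)) = cls (frag_of (\<Oplus>\<^bsub>M\<^esub>i\<in>{..<n}. l i x \<odot>\<^bsub>M\<^esub> e i, y))"
    using expand[OF xy(1)] by simp
  also have "\<dots> = cls (\<Sum>i<n. frag_of (l i x \<odot>\<^bsub>M\<^esub> e i, y))"
    using xy l e by (intro cls_finsum_left) auto
  also have "\<dots> = cls (\<Sum>i<n. frag_of (e i, th i (frag_of (x, y))))"
    using xy l e by (intro cls_sum) (simp add: cls_balanced th_of)
  finally show ?case by (simp add: z)
qed

text \<open>This makes the tensor product a concrete object: an element is the family of its coordinates in \<open>N\<close>. All module
  laws follow coordinatewise.\<close>

lemma cls_eq_iff: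
  assumes "Poly_Mapping.keys p \<subseteq> B" "Poly_Mapping.keys q \<subseteq> B"
  shows "cls p = cls q \<longleftrightarrow> (\<forall>i<n. th i p = th i q)"
proof
  assume "cls p = cls q"
  then have "p - q \<in> K" by (simp add: cls_eq)
  show "\<forall>i<n. th i p = th i q"
  proof (intro allI impI)
    fix i assume i: "i < n"
    have "th i p \<ominus>\<^bsub>N\<^esub> th i q = \<zero>\<^bsub>N\<^esub>"
      using th_K[OF i \<open>p - q \<in> K\<close>] th_diff[OF i assms] by simp
    moreover have "th i p = (th i p \<ominus>\<^bsub>N\<^esub> th i q) \<oplus>\<^bsub>N\<^esub> th i q"
      using th_closed[OF i] assms by (simp add: a_minus_def N.a_assoc N.l_neg)
    ultimately show "th i p = th i q"
      using th_closed[OF i] assms by simp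
  qed
next
  assume "\<forall>i<n. th i p = th i q"
  then have "(\<Sum>i<n. frag_of (e i, th i p)) = (\<Sum>i<n. frag_of (e i, th i q))"
    by (intro sum.cong) auto
  then show "cls p = cls q"
    using normal_form[OF assms(1)] normal_form[OF assms(2)] by simp
qed

lemma a_inv_same: "a_inv N' = a_inv N"
  by (simp add: a_inv_def m_inv_def same fun_eq_iff)

lemma finsum_same: "finsum N' f C = finsum N f C"
  by (simp add: finsum_def finprod_def same)

definition act :: "'s \<Rightarrow> ('b \<times> 'c \<Rightarrow>\<^sub>0 int) \<Rightarrow> 'b \<times> 'c \<Rightarrow>\<^sub>0 int" where
  "act s = frag_extend (\<lambda>(x, y). frag_of (x, s \<odot>\<^bsub>N'\<^esub> y))"

lemma smult_N: "s \<in> carrier S \<Longrightarrow> y \<in> carrier N \<Longrightarrow> s \<odot>\<^bsub>N'\<^esub> y \<in> carrier N"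
  using N'.smult_closed[of s y] by (simp add: same)

lemma act:
  assumes s: "s \<in> carrier S" and q: "Poly_Mapping.keys q \<subseteq> B"
  shows act_keys: "Poly_Mapping.keys (act s q) \<subseteq> B"
    and th_act: "i < n \<Longrightarrow> th i (act s q) = s \<odot>\<^bsub>N'\<^esub> th i q"
proof -
  have "Poly_Mapping.keys (act s q) \<subseteq> B \<and> (\<forall>i<n. th i (act s q) = s \<odot>\<^bsub>N'\<^esub> th i q)"
    using q
  proof (induction q rule: free_Abelian_group_induct[consumes 1, case_names 1 2 3])
    case 1
    then show ?case using N'.smult_r_null[OF s] by (simp add: act_def th_zero same)
  next
    case (2 p q)
    have "s \<odot>\<^bsub>N'\<^esub> th i (p - q) = th i (act s p) \<ominus>\<^bsub>N\<^esub> th i (act s q)" if i: "i < n" for i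
    proof -
      have c: "th i p \<in> carrier N'" "th i q \<in> carrier N'"
        using th_closed[OF i 2(1)] th_closed[OF i 2(2)] by (simp_all add: same)
      then have "s \<odot>\<^bsub>N'\<^esub> (th i p \<oplus>\<^bsub>N'\<^esub> \<ominus>\<^bsub>N'\<^esub> th i q) = s \<odot>\<^bsub>N'\<^esub> th i p \<oplus>\<^bsub>N'\<^esub> \<ominus>\<^bsub>N'\<^esub> (s \<odot>\<^bsub>N'\<^esub> th i q)"
        using s by (simp add: N'.smult_r_distr N'.smult_r_minus)
      then show ?thesis
        using 2 i by (simp add: th_diff a_minus_def same a_inv_same)
    qed
    then show ?case
      using 2 by (simp add: act_def frag_extend_diff diff_keys th_diff)
  next
    case (3 z)
    then obtain x y where z: "z = (x, y)" and xy: "x \<in> carrier M" "y \<in> carrier N" by auto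
    then show ?case using s by (simp add: act_def smult_N th_of commute l)
  qed
  then show "Poly_Mapping.keys (act s q) \<subseteq> B" "i < n \<Longrightarrow> th i (act s q) = s \<odot>\<^bsub>N'\<^esub> th i q"
    by auto
qed

lemma act_add: "act s (p + q) = act s p + act s q"
  by (simp add: act_def frag_extend_add)

lemma act_K:
  assumes s: "s \<in> carrier S" and k: "k \<in> K"
  shows "act s k \<in> K"
proof -
  have "cls (act s k) = cls 0"
    using act[OF s K_keys[OF k]] th_K[OF _ k] N'.smult_r_null[OF s]
    by (subst cls_eq_iff) (auto simp: th_zero same)
  then show ?thesis by (simp add: cls_eq)
qed

lemma map_right_cls:
  assumes s: "s \<in> carrier S"
  shows "tensor_map_right R M N (\<lambda>y. s \<odot>\<^bsub>N'\<^esub> y) (cls q) = cls (act s q)"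
proof -
  have "tensor_map_right R M N (\<lambda>y. s \<odot>\<^bsub>N'\<^esub> y) (cls q) = K <#>\<^bsub>free_Abelian_group B\<^esub> (act s ` cls q)"
    by (simp add: tensor_map_right_def act_def)
  also have "\<dots> = cls (act s q)"
  proof
    show "K <#>\<^bsub>free_Abelian_group B\<^esub> (act s ` cls q) \<subseteq> cls (act s q)"
    proof
      fix z assume "z \<in> K <#>\<^bsub>free_Abelian_group B\<^esub> (act s ` cls q)"
      then obtain k k' where *: "k \<in> K" "k' \<in> K" "z = k + act s (k' + q)"
        by (auto simp: set_mult_def cls_image)
      then have "z = (k + act s k') + act s q" by (simp add: act_add)
      then show "z \<in> cls (act s q)"
        unfolding cls_image by (rule image_eqI[OF _ additive_setD(3)[OF K_additive *(1) act_K[OF s *(2)]]])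
    qed
    show "cls (act s q) \<subseteq> K <#>\<^bsub>free_Abelian_group B\<^esub> (act s ` cls q)"
    proof
      fix z assume "z \<in> cls (act s q)"
      then obtain k where k: "k \<in> K" "z = k + act s q" by (auto simp: cls_image)
      have "q \<in> cls q"
        unfolding cls_image by (rule image_eqI[OF _ additive_setD(1)[OF K_additive]]) simp
      then show "z \<in> K <#>\<^bsub>free_Abelian_group B\<^esub> (act s ` cls q)"
        unfolding set_mult_def using k by auto
    qed
  qed
  finally show ?thesis .
qed

definition T :: "('s, ('b \<times> 'c \<Rightarrow>\<^sub>0 int) set) module" where
  "T = \<lparr>carrier = carrier (tensor_group R M N), monoid.mult = undefined, monoid.one = undefined,
    ring.zero = monoid.one (tensor_group R M N), ring.add = monoid.mult (tensor_group R M N),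
    module.smult = (\<lambda>s. tensor_map_right R M N (\<lambda>y. s \<odot>\<^bsub>N'\<^esub> y))\<rparr>"

lemma carrier_T: "carrier T = cls ` {q. Poly_Mapping.keys q \<subseteq> B}"
  and zero_T: "\<zero>\<^bsub>T\<^esub> = cls 0"
  and add_T: "cls p \<oplus>\<^bsub>T\<^esub> cls q = cls (p + q)"
  and smult_T: "s \<in> carrier S \<Longrightarrow> s \<odot>\<^bsub>T\<^esub> cls q = cls (act s q)"
  by (simp_all add: T_def carrier_group one_group mult_group map_right_cls)

lemma T_cases:
  assumes "x \<in> carrier T" obtains q where "Poly_Mapping.keys q \<subseteq> B" "x = cls q"
  using assms by (auto simp: carrier_T)

lemma cls_T: "Poly_Mapping.keys q \<subseteq> B \<Longrightarrow> cls q \<in> carrier T"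
  by (auto simp: carrier_T)

lemma add_keys:
  assumes "Poly_Mapping.keys p \<subseteq> B" "Poly_Mapping.keys q \<subseteq> B"
  shows "Poly_Mapping.keys (p + q) \<subseteq> B"
  using keys_add[of p q] assms by blast

lemma T_group: "abelian_group T"
proof (rule abelian_groupI)
  fix x y z assume "x \<in> carrier T" "y \<in> carrier T" "z \<in> carrier T"
  then show "x \<oplus>\<^bsub>T\<^esub> y \<oplus>\<^bsub>T\<^esub> z = x \<oplus>\<^bsub>T\<^esub> (y \<oplus>\<^bsub>T\<^esub> z)"
    by (elim T_cases) (simp add: add_T add.assoc)
next
  fix x y assume "x \<in> carrier T" "y \<in> carrier T"
  then show "x \<oplus>\<^bsub>T\<^esub> y \<in> carrier T" "x \<oplus>\<^bsub>T\<^esub> y = y \<oplus>\<^bsub>T\<^esub> x"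
    by (elim T_cases, simp add: add_T cls_T add_keys, elim T_cases, simp add: add_T add.commute)
next
  fix x assume "x \<in> carrier T"
  then show "\<zero>\<^bsub>T\<^esub> \<oplus>\<^bsub>T\<^esub> x = x" by (elim T_cases) (simp add: zero_T add_T)
next
  fix x assume "x \<in> carrier T"
  then obtain q where q: "Poly_Mapping.keys q \<subseteq> B" "x = cls q" by (rule T_cases)
  then show "\<exists>y\<in>carrier T. y \<oplus>\<^bsub>T\<^esub> x = \<zero>\<^bsub>T\<^esub>"
    by (intro bexI[of _ "cls (- q)"] cls_T) (simp_all add: add_T zero_T)
qed (simp add: zero_T cls_T)

lemma T_laws:
  assumes a: "a \<in> carrier S" and b: "b \<in> carrier S" and x: "x \<in> carrier T" and y: "y \<in> carrier T"
  shows "a \<odot>\<^bsub>T\<^esub> x \<in> carrier T"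
    and "(a \<oplus>\<^bsub>S\<^esub> b) \<odot>\<^bsub>T\<^esub> x = a \<odot>\<^bsub>T\<^esub> x \<oplus>\<^bsub>T\<^esub> b \<odot>\<^bsub>T\<^esub> x"
    and "a \<odot>\<^bsub>T\<^esub> (x \<oplus>\<^bsub>T\<^esub> y) = a \<odot>\<^bsub>T\<^esub> x \<oplus>\<^bsub>T\<^esub> a \<odot>\<^bsub>T\<^esub> y"
    and "(a \<otimes>\<^bsub>S\<^esub> b) \<odot>\<^bsub>T\<^esub> x = a \<odot>\<^bsub>T\<^esub> (b \<odot>\<^bsub>T\<^esub> x)"
    and "\<one>\<^bsub>S\<^esub> \<odot>\<^bsub>T\<^esub> x = x"
proof -
  obtain p where p: "Poly_Mapping.keys p \<subseteq> B" "x = cls p" using x by (rule T_cases)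
  obtain q where q: "Poly_Mapping.keys q \<subseteq> B" "y = cls q" using y by (rule T_cases)
  have c: "i < n \<Longrightarrow> th i p \<in> carrier N'" for i
    using p th_closed by (simp add: same)
  note facts = a b p(1) act_keys add_keys th_act th_add c
  show "a \<odot>\<^bsub>T\<^esub> (x \<oplus>\<^bsub>T\<^esub> y) = a \<odot>\<^bsub>T\<^esub> x \<oplus>\<^bsub>T\<^esub> a \<odot>\<^bsub>T\<^esub> y"
    using a by (simp add: p q add_T smult_T act_add)
  show "a \<odot>\<^bsub>T\<^esub> x \<in> carrier T"
    using facts by (simp add: p smult_T cls_T)
  have "cls (act (a \<oplus>\<^bsub>S\<^esub> b) p) = cls (act a p + act b p)"
  proof (subst cls_eq_iff)
    show "Poly_Mapping.keys (act a p + act b p) \<subseteq> B"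
      by (rule add_keys[OF act_keys[OF a p(1)] act_keys[OF b p(1)]])
  qed (use facts N'.smult_l_distr[of a b] in \<open>simp_all add: same\<close>)
  then show "(a \<oplus>\<^bsub>S\<^esub> b) \<odot>\<^bsub>T\<^esub> x = a \<odot>\<^bsub>T\<^esub> x \<oplus>\<^bsub>T\<^esub> b \<odot>\<^bsub>T\<^esub> x"
    using a b by (simp add: p smult_T add_T)
  have "cls (act (a \<otimes>\<^bsub>S\<^esub> b) p) = cls (act a (act b p))"
    by (subst cls_eq_iff) (use facts N'.smult_assoc1[of a b] in simp_all)
  then show "(a \<otimes>\<^bsub>S\<^esub> b) \<odot>\<^bsub>T\<^esub> x = a \<odot>\<^bsub>T\<^esub> (b \<odot>\<^bsub>T\<^esub> x)"
    using a b by (simp add: p smult_T)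
  have "cls (act \<one>\<^bsub>S\<^esub> p) = cls p"
    by (subst cls_eq_iff) (use facts in simp_all)
  then show "\<one>\<^bsub>S\<^esub> \<odot>\<^bsub>T\<^esub> x = x" by (simp add: p smult_T)
qed

lemma T_module: "module S T"
proof (rule moduleI[OF _ T_group])
  show "cring S" by unfold_locales
  show "a \<odot>\<^bsub>T\<^esub> x \<in> carrier T" if "a \<in> carrier S" "x \<in> carrier T" for a x
    by (rule T_laws(1)[OF that(1,1,2,2)])
  show "(a \<oplus>\<^bsub>S\<^esub> b) \<odot>\<^bsub>T\<^esub> x = a \<odot>\<^bsub>T\<^esub> x \<oplus>\<^bsub>T\<^esub> b \<odot>\<^bsub>T\<^esub> x"
    if "a \<in> carrier S" "b \<in> carrier S" "x \<in> carrier T" for a b x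
    by (rule T_laws(2)[OF that(1,2,3,3)])
  show "a \<odot>\<^bsub>T\<^esub> (x \<oplus>\<^bsub>T\<^esub> y) = a \<odot>\<^bsub>T\<^esub> x \<oplus>\<^bsub>T\<^esub> a \<odot>\<^bsub>T\<^esub> y"
    if "a \<in> carrier S" "x \<in> carrier T" "y \<in> carrier T" for a x y
    by (rule T_laws(3)[OF that(1,1,2,3)])
  show "(a \<otimes>\<^bsub>S\<^esub> b) \<odot>\<^bsub>T\<^esub> x = a \<odot>\<^bsub>T\<^esub> (b \<odot>\<^bsub>T\<^esub> x)"
    if "a \<in> carrier S" "b \<in> carrier S" "x \<in> carrier T" for a b x
    by (rule T_laws(4)[OF that(1,2,3,3)])
  show "\<one>\<^bsub>S\<^esub> \<odot>\<^bsub>T\<^esub> x = x" if "x \<in> carrier T" for x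
    by (rule T_laws(5)[OF N'.R.one_closed N'.R.one_closed that that])
qed

lemma finsum_cls:
  assumes "finite A" "\<And>i. i \<in> A \<Longrightarrow> Poly_Mapping.keys (p i) \<subseteq> B"
  shows "(\<Oplus>\<^bsub>T\<^esub>i\<in>A. cls (p i)) = cls (\<Sum>i\<in>A. p i)"
proof -
  interpret T: abelian_group T by (rule T_group)
  show ?thesis
    using assms
    by (induction rule: finite_induct) (simp_all add: zero_T[symmetric] add_T[symmetric] cls_T Pi_def)
qed

definition coord :: "nat \<Rightarrow> ('b \<times> 'c \<Rightarrow>\<^sub>0 int) set \<Rightarrow> 'c" where
  "coord i C = th i (SOME q. Poly_Mapping.keys q \<subseteq> B \<and> C = cls q)"

lemma coord_cls:
  assumes "i < n" "Poly_Mapping.keys q \<subseteq> B"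
  shows "coord i (cls q) = th i q"
proof -
  let ?q = "SOME p. Poly_Mapping.keys p \<subseteq> B \<and> cls q = cls p"
  have "Poly_Mapping.keys ?q \<subseteq> B \<and> cls q = cls ?q"
    by (rule someI[of _ q]) (use assms in simp)
  then have "th i ?q = th i q"
    using cls_eq_iff[of q ?q] assms by auto
  then show ?thesis by (simp add: coord_def)
qed

end

lemma sum_div_mod:
  fixes f :: "nat \<Rightarrow> nat \<Rightarrow> 'z::comm_monoid_add"
  shows "(\<Sum>k<n * m. f (k div m) (k mod m)) = (\<Sum>a<n. \<Sum>b<m. f a b)"
proof (cases "m = 0")
  case False
  have "(\<Sum>k<n * m. f (k div m) (k mod m)) = (\<Sum>(a, b)\<in>{..<n} \<times> {..<m}. f a b)"
  proof (rule sum.reindex_bij_witness[of _ "\<lambda>(a, b). a * m + b" "\<lambda>k. (k div m, k mod m)"])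
    fix z assume "z \<in> {..<n} \<times> {..<m}"
    then obtain a b where z: "z = (a, b)" "a < n" "b < m" by auto
    have "a * m + b < Suc a * m" using z by simp
    also have "\<dots> \<le> n * m" using z by (intro mult_le_mono1) simp
    finally show "(case z of (a, b) \<Rightarrow> a * m + b) \<in> {..<n * m}" using z by simp
  qed (use False in \<open>auto simp: less_mult_imp_div_less\<close>)
  then show ?thesis by (simp add: sum.cartesian_product)
qed auto

locale tensor_frame = tensor R M n e l N S N' + N'': frame S N' m e' l'
  for R :: "('a, 'r) ring_scheme" (structure) and M :: "('a, 'b, 'm) module_scheme" and n e l
    and N :: "('a, 'c, 'n) module_scheme" and S :: "('s, 't) ring_scheme"
    and N' :: "('s, 'c, 'n2) module_scheme" and m e' l'
begin

definition "basis k = cls (frag_of (e (k div m), e' (k mod m)))"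
definition "coords k C = l' (k mod m) (coord (k div m) C)"

lemma index: "k < n * m \<Longrightarrow> k div m < n \<and> k mod m < m"
  by (cases "m = 0") (auto simp: less_mult_imp_div_less)

lemma e'_N: "b < m \<Longrightarrow> e' b \<in> carrier N"
  using N''.e by (simp add: same)

text \<open>The tensors \<open>e a \<otimes> e' b\<close> with the products of the coordinate forms are a dual basis; the pair \<open>(a, b)\<close> is
  numbered by \<open>a * m + b\<close>.\<close>

lemma frame_T: "frame S T (n * m) basis coords"
proof -
  interpret T: module S T by (rule T_module)
  show ?thesis
  proof
    fix k assume k: "k < n * m"
    note kk = index[OF k]
    show "basis k \<in> carrier T"
      using kk e e'_N by (simp add: basis_def cls_T)
    fix x assume "x \<in> carrier T"
    then obtain p where p: "Poly_Mapping.keys p \<subseteq> B" "x = cls p" by (rule T_cases)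
    have c: "th (k div m) p \<in> carrier N'"
      using th_closed kk p by (simp add: same)
    show "coords k x \<in> carrier S"
      using kk p c by (simp add: coords_def coord_cls N''.l)
    show "coords k (a \<odot>\<^bsub>T\<^esub> x) = a \<otimes>\<^bsub>S\<^esub> coords k x" if "a \<in> carrier S" for a
      using kk p c that by (simp add: coords_def coord_cls smult_T act_keys th_act N''.l_smult)
    fix y assume "y \<in> carrier T"
    then obtain q where q: "Poly_Mapping.keys q \<subseteq> B" "y = cls q" by (rule T_cases)
    have d: "th (k div m) q \<in> carrier N'"
      using th_closed kk q by (simp add: same)
    show "coords k (x \<oplus>\<^bsub>T\<^esub> y) = coords k x \<oplus>\<^bsub>S\<^esub> coords k y"
      using kk p q c d N''.l_add[of "k mod m" "th (k div m) p" "th (k div m) q"]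
      by (simp add: coords_def coord_cls add_T add_keys th_add same)
  next
    fix x assume "x \<in> carrier T"
    then obtain p where p: "Poly_Mapping.keys p \<subseteq> B" "x = cls p" by (rule T_cases)
    define u where "u a b = frag_of (e a, l' b (th a p) \<odot>\<^bsub>N'\<^esub> e' b)" for a b
    have c: "th a p \<in> carrier N'" if "a < n" for a
      using th_closed[OF that p(1)] by (simp add: same)
    have u: "Poly_Mapping.keys (u a b) \<subseteq> B" if "a < n" "b < m" for a b
      unfolding u_def using that e e'_N c N''.l smult_N by (intro pair_keys) auto
    have "(\<Oplus>\<^bsub>T\<^esub>k\<in>{..<n * m}. coords k x \<odot>\<^bsub>T\<^esub> basis k) = (\<Oplus>\<^bsub>T\<^esub>k\<in>{..<n * m}. cls (u (k div m) (k mod m)))"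
    proof (rule T.M.finsum_cong')
      fix k assume "k \<in> {..<n * m}"
      then have kk: "k div m < n" "k mod m < m" using index by auto
      then show "coords k x \<odot>\<^bsub>T\<^esub> basis k = cls (u (k div m) (k mod m))"
        using p c N''.l by (simp add: coords_def coord_cls basis_def smult_T u_def act_def)
    qed (use u index in \<open>auto intro!: cls_T\<close>)
    also have "\<dots> = cls (\<Sum>k<n * m. u (k div m) (k mod m))"
      using u index by (intro finsum_cls) auto
    also have "\<dots> = cls (\<Sum>a<n. \<Sum>b<m. u a b)"
      by (simp only: sum_div_mod)
    also have "\<dots> = cls (\<Sum>a<n. frag_of (e a, th a p))"
    proof (rule cls_sum)
      fix a assume "a \<in> {..<n}"
      then have a: "a < n" by simp
      have "cls (frag_of (e a, th a p)) = cls (frag_of (e a, \<Oplus>\<^bsub>N'\<^esub>b\<in>{..<m}. l' b (th a p) \<odot>\<^bsub>N'\<^esub> e' b))"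
        using N''.expand[OF c[OF a]] by simp
      also have "\<dots> = cls (\<Sum>b<m. u a b)"
        unfolding finsum_same u_def
        using c[OF a] e[OF a] e'_N N''.l smult_N by (intro cls_finsum_right) auto
      finally show "cls (\<Sum>b<m. u a b) = cls (frag_of (e a, th a p))" ..
    qed
    also have "\<dots> = x" using normal_form[OF p(1)] p(2) by simp
    finally show "x = (\<Oplus>\<^bsub>T\<^esub>k\<in>{..<n * m}. coords k x \<odot>\<^bsub>T\<^esub> basis k)" ..
  qed
qed

lemma coords_basis:
  assumes "j < n * m" "k < n * m"
  shows "coords j (basis k) = l' (j mod m) (l (j div m) (e (k div m)) \<odot>\<^bsub>N\<^esub> e' (k mod m))"
  using index[OF assms(1)] index[OF assms(2)] e e'_N
  by (simp add: coords_def basis_def coord_cls th_of)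

end

section \<open>Modules represented by idempotent matrices\<close>

lemma module_homI:
  assumes "\<And>x. x \<in> carrier M \<Longrightarrow> f x \<in> carrier N"
    and "\<And>x y. x \<in> carrier M \<Longrightarrow> y \<in> carrier M \<Longrightarrow> f (x \<oplus>\<^bsub>M\<^esub> y) = f x \<oplus>\<^bsub>N\<^esub> f y"
    and "\<And>a x. a \<in> carrier R \<Longrightarrow> x \<in> carrier M \<Longrightarrow> f (a \<odot>\<^bsub>M\<^esub> x) = a \<odot>\<^bsub>N\<^esub> f x"
  shows "f \<in> module_hom R M N"
  using assms by (auto simp: module_hom_def hom_def)

lemma module_homD:
  assumes "f \<in> module_hom R M N"
  shows "x \<in> carrier M \<Longrightarrow> f x \<in> carrier N"
    and "x \<in> carrier M \<Longrightarrow> y \<in> carrier M \<Longrightarrow> f (x \<oplus>\<^bsub>M\<^esub> y) = f x \<oplus>\<^bsub>N\<^esub> f y"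
    and "a \<in> carrier R \<Longrightarrow> x \<in> carrier M \<Longrightarrow> f (a \<odot>\<^bsub>M\<^esub> x) = a \<odot>\<^bsub>N\<^esub> f x"
  using assms by (auto simp: module_hom_def hom_def)

lemma module_isomorphic_refl: "module_isomorphic R M M"
  unfolding module_isomorphic_def by (rule bexI[of _ id]) (auto intro!: module_homI)

lemma module_isomorphic_trans:
  assumes "module_isomorphic R M N" "module_isomorphic R N P"
  shows "module_isomorphic R M P"
proof -
  obtain f g where f: "f \<in> module_hom R M N" "bij_betw f (carrier M) (carrier N)"
    and g: "g \<in> module_hom R N P" "bij_betw g (carrier N) (carrier P)"
    using assms unfolding module_isomorphic_def by blast
  have "g \<circ> f \<in> module_hom R M P"
    by (rule module_homI) (simp_all add: module_homD[OF f(1)] module_homD[OF g(1)])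
  then show ?thesis
    unfolding module_isomorphic_def using bij_betw_trans[OF f(2) g(2)] by blast
qed

lemma module_iso_inverse:
  assumes M: "module R M" and f: "f \<in> module_hom R M N" "bij_betw f (carrier M) (carrier N)"
  defines "g \<equiv> inv_into (carrier M) f"
  shows "g \<in> module_hom R N M" "bij_betw g (carrier N) (carrier M)"
    "\<And>x. x \<in> carrier M \<Longrightarrow> g (f x) = x" "\<And>y. y \<in> carrier N \<Longrightarrow> f (g y) = y"
proof -
  interpret M: module R M by fact
  show g: "bij_betw g (carrier N) (carrier M)"
    unfolding g_def by (rule bij_betw_inv_into[OF f(2)])
  show gf: "g (f x) = x" if "x \<in> carrier M" for x
    unfolding g_def using f(2) that by (rule bij_betw_inv_into_left)
  show fg: "f (g y) = y" if "y \<in> carrier N" for y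
    unfolding g_def using f(2) that by (rule bij_betw_inv_into_right)
  have gM: "g y \<in> carrier M" if "y \<in> carrier N" for y
    using g that by (auto simp: bij_betw_def)
  show "g \<in> module_hom R N M"
  proof (rule module_homI)
    fix x y assume "x \<in> carrier N" "y \<in> carrier N"
    then show "g (x \<oplus>\<^bsub>N\<^esub> y) = g x \<oplus>\<^bsub>M\<^esub> g y"
      using gf[of "g x \<oplus>\<^bsub>M\<^esub> g y"] module_homD(2)[OF f(1), of "g x" "g y"] gM fg by simp
  next
    fix a x assume "a \<in> carrier R" "x \<in> carrier N"
    then show "g (a \<odot>\<^bsub>N\<^esub> x) = a \<odot>\<^bsub>M\<^esub> g x"
      using gf[of "a \<odot>\<^bsub>M\<^esub> g x"] module_homD(3)[OF f(1), of a "g x"] gM fg by simp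
  qed (rule gM)
qed

lemma module_isomorphic_sym:
  "module R M \<Longrightarrow> module_isomorphic R M N \<Longrightarrow> module_isomorphic R N M"
  unfolding module_isomorphic_def using module_iso_inverse(1,2) by blast

text \<open>The matrix of the forms \<open>l i\<close> on the elements \<open>e j\<close> is the matrix of a projection onto a copy of \<open>M\<close> in the free module.\<close>

definition represents ::
    "('a, 'r) ring_scheme \<Rightarrow> ('a, 'b, 'm) module_scheme \<Rightarrow> nat \<Rightarrow> (nat \<Rightarrow> nat \<Rightarrow> 'a) \<Rightarrow> bool" where
  "represents R M n P \<longleftrightarrow> (\<exists>e l. frame R M n e l \<and> (\<forall>i<n. \<forall>j<n. l i (e j) = P i j))"

definition idempotent_matrix :: "('a, 'r) ring_scheme \<Rightarrow> nat \<Rightarrow> (nat \<Rightarrow> nat \<Rightarrow> 'a) \<Rightarrow> bool" where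
  "idempotent_matrix R n P \<longleftrightarrow> (\<forall>i<n. \<forall>j<n. P i j \<in> carrier R) \<and>
     (\<forall>i<n. \<forall>k<n. P i k = (\<Oplus>\<^bsub>R\<^esub>j\<in>{..<n}. P i j \<otimes>\<^bsub>R\<^esub> P j k))"

text \<open>For an idempotent matrix the image is the set of fixed vectors, which needs no choice of preimages.\<close>

definition img :: "('a, 'r) ring_scheme \<Rightarrow> nat \<Rightarrow> (nat \<Rightarrow> nat \<Rightarrow> 'a) \<Rightarrow> ('a, nat \<Rightarrow> 'a) module" where
  "img R n P = (free_module R n)\<lparr>carrier :=
     {v \<in> {..<n} \<rightarrow>\<^sub>E carrier R. \<forall>i<n. v i = (\<Oplus>\<^bsub>R\<^esub>j\<in>{..<n}. P i j \<otimes>\<^bsub>R\<^esub> v j)}\<rparr>"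

lemma img_simps:
  "carrier (img R n P) = {v \<in> {..<n} \<rightarrow>\<^sub>E carrier R. \<forall>i<n. v i = (\<Oplus>\<^bsub>R\<^esub>j\<in>{..<n}. P i j \<otimes>\<^bsub>R\<^esub> v j)}"
  "v \<oplus>\<^bsub>img R n P\<^esub> w = (\<lambda>i\<in>{..<n}. v i \<oplus>\<^bsub>R\<^esub> w i)"
  "\<zero>\<^bsub>img R n P\<^esub> = (\<lambda>i\<in>{..<n}. \<zero>\<^bsub>R\<^esub>)"
  "a \<odot>\<^bsub>img R n P\<^esub> v = (\<lambda>i\<in>{..<n}. a \<otimes>\<^bsub>R\<^esub> v i)"
  by (simp_all add: img_def free_module_def)

lemma free_simps:
  "carrier (free_module R n) = {..<n} \<rightarrow>\<^sub>E carrier R"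
  "v \<oplus>\<^bsub>free_module R n\<^esub> w = (\<lambda>i\<in>{..<n}. v i \<oplus>\<^bsub>R\<^esub> w i)"
  "\<zero>\<^bsub>free_module R n\<^esub> = (\<lambda>i\<in>{..<n}. \<zero>\<^bsub>R\<^esub>)"
  "a \<odot>\<^bsub>free_module R n\<^esub> v = (\<lambda>i\<in>{..<n}. a \<otimes>\<^bsub>R\<^esub> v i)"
  by (simp_all add: free_module_def)

lemma PiE_lt: "v \<in> {..<n::nat} \<rightarrow>\<^sub>E A \<Longrightarrow> i < n \<Longrightarrow> v i \<in> A"
  by (auto simp: PiE_def Pi_def)

lemma PiE_eqI: "v \<in> {..<n::nat} \<rightarrow>\<^sub>E A \<Longrightarrow> w \<in> {..<n} \<rightarrow>\<^sub>E A' \<Longrightarrow> (\<And>i. i < n \<Longrightarrow> v i = w i) \<Longrightarrow> v = w"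
  by (rule extensionalityI[of _ "{..<n}"]) (auto simp: PiE_def)

context cring
begin

lemma free_module_module: "module R (free_module R n)"
proof -
  let ?F = "free_module R n"
  have c: "v i \<in> carrier R" if "v \<in> carrier ?F" "i < n" for v i
    using PiE_lt[of v n "carrier R" i] that by (simp add: free_simps)
  have FI: "(\<lambda>i\<in>{..<n}. f i) \<in> carrier ?F" if "\<And>i. i < n \<Longrightarrow> f i \<in> carrier R" for f
    using that by (simp add: free_simps)
  have eqI: "v = w" if "v \<in> carrier ?F" "w \<in> carrier ?F" "\<And>i. i < n \<Longrightarrow> v i = w i" for v w
    using PiE_eqI[of v n "carrier R" w "carrier R"] that by (simp add: free_simps)
  have add: "v \<oplus>\<^bsub>?F\<^esub> w \<in> carrier ?F" if "v \<in> carrier ?F" "w \<in> carrier ?F" for v w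
    unfolding free_simps(2) by (rule FI) (simp add: c[OF that(1)] c[OF that(2)])
  have smult: "a \<odot>\<^bsub>?F\<^esub> v \<in> carrier ?F" if "a \<in> carrier R" "v \<in> carrier ?F" for a v
    unfolding free_simps(4) by (rule FI) (simp add: that(1) c[OF that(2)])
  show ?thesis
  proof (rule moduleI)
    show "cring R" by unfold_locales
    show "abelian_group ?F"
    proof (rule abelian_groupI)
      fix v assume v: "v \<in> carrier ?F"
      have neg: "(\<lambda>i\<in>{..<n}. \<ominus> v i) \<in> carrier ?F" by (rule FI) (simp add: c[OF v])
      show "\<exists>w\<in>carrier ?F. w \<oplus>\<^bsub>?F\<^esub> v = \<zero>\<^bsub>?F\<^esub>"
        by (rule bexI[OF _ neg], unfold free_simps, rule restrict_ext) (simp add: c[OF v] l_neg)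
      have zero: "\<zero>\<^bsub>?F\<^esub> \<in> carrier ?F" by (simp add: free_simps)
      show "\<zero>\<^bsub>?F\<^esub> \<oplus>\<^bsub>?F\<^esub> v = v"
        by (rule eqI[OF add[OF zero v] v]) (unfold free_simps, simp add: c[OF v])
      fix w assume w: "w \<in> carrier ?F"
      show "v \<oplus>\<^bsub>?F\<^esub> w = w \<oplus>\<^bsub>?F\<^esub> v"
        unfolding free_simps by (rule restrict_ext) (simp add: c[OF v] c[OF w] a_comm)
      show "v \<oplus>\<^bsub>?F\<^esub> w \<in> carrier ?F" by (rule add[OF v w])
      fix u assume u: "u \<in> carrier ?F"
      show "v \<oplus>\<^bsub>?F\<^esub> w \<oplus>\<^bsub>?F\<^esub> u = v \<oplus>\<^bsub>?F\<^esub> (w \<oplus>\<^bsub>?F\<^esub> u)"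
        unfolding free_simps by (rule restrict_ext) (simp add: c[OF v] c[OF w] c[OF u] a_assoc)
    qed (simp add: free_simps)
    fix v assume v: "v \<in> carrier ?F"
    show "\<one> \<odot>\<^bsub>?F\<^esub> v = v"
      by (rule eqI[OF smult[OF one_closed v] v]) (unfold free_simps, simp add: c[OF v])
    fix a assume a: "a \<in> carrier R"
    show "a \<odot>\<^bsub>?F\<^esub> v \<in> carrier ?F" by (rule smult[OF a v])
    show "(a \<oplus> b) \<odot>\<^bsub>?F\<^esub> v = a \<odot>\<^bsub>?F\<^esub> v \<oplus>\<^bsub>?F\<^esub> b \<odot>\<^bsub>?F\<^esub> v" if "b \<in> carrier R" for b
      unfolding free_simps by (rule restrict_ext) (simp add: a that c[OF v] l_distr)
    show "(a \<otimes> b) \<odot>\<^bsub>?F\<^esub> v = a \<odot>\<^bsub>?F\<^esub> (b \<odot>\<^bsub>?F\<^esub> v)" if "b \<in> carrier R" for b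
      unfolding free_simps by (rule restrict_ext) (simp add: a that c[OF v] m_assoc)
    show "a \<odot>\<^bsub>?F\<^esub> (v \<oplus>\<^bsub>?F\<^esub> w) = a \<odot>\<^bsub>?F\<^esub> v \<oplus>\<^bsub>?F\<^esub> a \<odot>\<^bsub>?F\<^esub> w" if "w \<in> carrier ?F" for w
      unfolding free_simps by (rule restrict_ext) (simp add: a c[OF v] c[OF that] r_distr)
  qed
qed

lemma img_submodule:
  assumes P: "\<And>i j. i < n \<Longrightarrow> j < n \<Longrightarrow> P i j \<in> carrier R"
  shows "submodule (carrier (img R n P)) R (free_module R n)"
proof -
  interpret F: module R "free_module R n" by (rule free_module_module)
  have smult: "a \<odot>\<^bsub>free_module R n\<^esub> v \<in> carrier (img R n P)" if a: "a \<in> carrier R" and v: "v \<in> carrier (img R n P)" for a v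
  proof -
    have vc: "v i \<in> carrier R" if "i < n" for i using v that PiE_lt[of v n "carrier R" i] by (simp add: img_simps)
    have "a \<otimes> v i = (\<Oplus>j\<in>{..<n}. P i j \<otimes> (\<lambda>i\<in>{..<n}. a \<otimes> v i) j)" if i: "i < n" for i
    proof -
      have "a \<otimes> v i = a \<otimes> (\<Oplus>j\<in>{..<n}. P i j \<otimes> v j)" using v i by (simp add: img_simps)
      also have "\<dots> = (\<Oplus>j\<in>{..<n}. a \<otimes> (P i j \<otimes> v j))"
        using a P i vc by (intro finsum_rdistr) auto
      also have "\<dots> = (\<Oplus>j\<in>{..<n}. P i j \<otimes> (\<lambda>i\<in>{..<n}. a \<otimes> v i) j)"
        using a P i vc by (intro finsum_cong') (auto simp: m_lcomm)
      finally show ?thesis .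
    qed
    then show ?thesis using a vc by (auto simp: img_simps free_simps)
  qed
  show ?thesis
  proof (rule F.submoduleI)
    show "carrier (img R n P) \<subseteq> carrier (free_module R n)" by (auto simp: img_simps free_simps)
    show "\<zero>\<^bsub>free_module R n\<^esub> \<in> carrier (img R n P)"
    proof -
      have "(\<Oplus>j\<in>{..<n}. P i j \<otimes> (\<lambda>i\<in>{..<n}. \<zero>) j) = (\<Oplus>j\<in>{..<n}. \<zero>)" if "i < n" for i
        using P that by (intro finsum_cong') auto
      then show ?thesis by (simp add: img_simps free_simps)
    qed
    show "a \<odot>\<^bsub>free_module R n\<^esub> v \<in> carrier (img R n P)" if "a \<in> carrier R" "v \<in> carrier (img R n P)" for a v
      using smult that .
    show "\<ominus>\<^bsub>free_module R n\<^esub> v \<in> carrier (img R n P)" if v: "v \<in> carrier (img R n P)" for v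
    proof -
      have "v \<in> carrier (free_module R n)" using v by (auto simp: img_simps free_simps)
      then have "\<ominus>\<^bsub>free_module R n\<^esub> v = (\<ominus> \<one>) \<odot>\<^bsub>free_module R n\<^esub> v"
        using F.smult_l_minus[of \<one> v] by simp
      then show ?thesis using smult[OF _ v, of "\<ominus> \<one>"] by simp
    qed
    fix v w assume v: "v \<in> carrier (img R n P)" and w: "w \<in> carrier (img R n P)"
    have c: "v i \<in> carrier R" "w i \<in> carrier R" if "i < n" for i
      using v w that PiE_lt[of v n "carrier R" i] PiE_lt[of w n "carrier R" i] by (simp_all add: img_simps)
    have "v i \<oplus> w i = (\<Oplus>j\<in>{..<n}. P i j \<otimes> (\<lambda>i\<in>{..<n}. v i \<oplus> w i) j)" if i: "i < n" for i
    proof -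
      have "v i \<oplus> w i = (\<Oplus>j\<in>{..<n}. P i j \<otimes> v j) \<oplus> (\<Oplus>j\<in>{..<n}. P i j \<otimes> w j)"
        using v w i by (simp add: img_simps)
      also have "\<dots> = (\<Oplus>j\<in>{..<n}. P i j \<otimes> v j \<oplus> P i j \<otimes> w j)"
        using P i c by (intro finsum_addf[symmetric]) auto
      also have "\<dots> = (\<Oplus>j\<in>{..<n}. P i j \<otimes> (\<lambda>i\<in>{..<n}. v i \<oplus> w i) j)"
        using P i c by (intro finsum_cong') (auto simp: r_distr)
      finally show ?thesis .
    qed
    then show "v \<oplus>\<^bsub>free_module R n\<^esub> w \<in> carrier (img R n P)"
      using c by (auto simp: img_simps free_simps)
  qed
qed

lemma img_module:
  assumes "\<And>i j. i < n \<Longrightarrow> j < n \<Longrightarrow> P i j \<in> carrier R"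
  shows "module R (img R n P)"
  using submodule.submodule_is_module[OF img_submodule[OF assms] free_module_module]
  by (simp add: img_def)

lemma finsum_in_free:
  fixes n :: nat
  assumes "abelian_group Y" "\<And>v w. v \<oplus>\<^bsub>Y\<^esub> w = (\<lambda>i\<in>{..<n}. v i \<oplus> w i)" "carrier Y \<subseteq> {..<n} \<rightarrow>\<^sub>E carrier R"
    and "finite A" "\<And>i. i \<in> A \<Longrightarrow> f i \<in> carrier Y" "k < n"
  shows "(finsum Y f A) k = (\<Oplus>i\<in>A. f i k)"
  by (rule finsum_additive[OF assms(1) abelian_group_axioms, where f = "\<lambda>v. v k"])
     (use assms(2-) PiE_lt[of _ n "carrier R" k] in \<open>auto simp: subset_iff\<close>)

lemma img_represents:
  assumes P: "idempotent_matrix R n P"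
  shows "represents R (img R n P) n P"
proof -
  have Pc: "P i j \<in> carrier R" if "i < n" "j < n" for i j
    using P that by (auto simp: idempotent_matrix_def)
  have Pi: "P i k = (\<Oplus>j\<in>{..<n}. P i j \<otimes> P j k)" if "i < n" "k < n" for i k
    using P that unfolding idempotent_matrix_def by blast
  interpret Y: module R "img R n P" using Pc by (rule img_module)
  define e where "e j = (\<lambda>i\<in>{..<n}. P i j)" for j
  have e: "e j \<in> carrier (img R n P)" if j: "j < n" for j
  proof -
    have "P i j = (\<Oplus>k\<in>{..<n}. P i k \<otimes> (\<lambda>i\<in>{..<n}. P i j) k)" if i: "i < n" for i
      by (subst Pi[OF i j]) (use Pc i j in \<open>auto intro!: finsum_cong'\<close>)
    then show ?thesis using Pc j by (auto simp: e_def img_simps)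
  qed
  have "frame R (img R n P) n e (\<lambda>i v. v i)"
  proof
    fix v assume v: "v \<in> carrier (img R n P)"
    then have vc: "v i \<in> carrier R" if "i < n" for i using that PiE_lt[of v n "carrier R" i] by (simp add: img_simps)
    have ve: "v i \<odot>\<^bsub>img R n P\<^esub> e i \<in> carrier (img R n P)" if "i < n" for i
      using vc e that by auto
    show "v = (\<Oplus>\<^bsub>img R n P\<^esub>i\<in>{..<n}. v i \<odot>\<^bsub>img R n P\<^esub> e i)"
    proof (rule PiE_eqI)
      show "v \<in> {..<n} \<rightarrow>\<^sub>E carrier R" using v by (simp add: img_simps)
      have "(\<Oplus>\<^bsub>img R n P\<^esub>i\<in>{..<n}. v i \<odot>\<^bsub>img R n P\<^esub> e i) \<in> carrier (img R n P)"
        using ve by (intro Y.finsum_closed) auto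
      then show "(\<Oplus>\<^bsub>img R n P\<^esub>i\<in>{..<n}. v i \<odot>\<^bsub>img R n P\<^esub> e i) \<in> {..<n} \<rightarrow>\<^sub>E carrier R"
        by (simp add: img_simps)
      fix k assume k: "k < n"
      have "(\<Oplus>\<^bsub>img R n P\<^esub>i\<in>{..<n}. v i \<odot>\<^bsub>img R n P\<^esub> e i) k = (\<Oplus>i\<in>{..<n}. (v i \<odot>\<^bsub>img R n P\<^esub> e i) k)"
        by (rule finsum_in_free[OF Y.abelian_group_axioms]) (use ve k in \<open>auto simp: img_simps\<close>)
      also have "\<dots> = (\<Oplus>i\<in>{..<n}. P k i \<otimes> v i)"
        using k Pc vc by (intro finsum_cong') (auto simp: img_simps e_def m_comm)
      also have "\<dots> = v k" using v k by (simp add: img_simps)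
      finally show "v k = (\<Oplus>\<^bsub>img R n P\<^esub>i\<in>{..<n}. v i \<odot>\<^bsub>img R n P\<^esub> e i) k" ..
    qed
  next
    fix i v assume "i < n" "v \<in> carrier (img R n P)"
    then show "v i \<in> carrier R" using PiE_lt[of v n "carrier R" i] by (simp add: img_simps)
  qed (use e in \<open>simp_all add: img_simps(2,4)\<close>)
  then show ?thesis
    unfolding represents_def by (intro exI conjI) (auto simp: e_def)
qed

end

context frame
begin

lemma l_finsum:
  "i < n \<Longrightarrow> finite A \<Longrightarrow> (\<And>j. j \<in> A \<Longrightarrow> f j \<in> carrier M) \<Longrightarrow> l i (finsum M f A) = (\<Oplus>j\<in>A. l i (f j))"
  by (rule finsum_additive[OF M.M.abelian_group_axioms M.R.abelian_group_axioms]) (auto simp: l l_add)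

lemma l_expand:
  assumes "i < n" "x \<in> carrier M"
  shows "l i x = (\<Oplus>j\<in>{..<n}. l i (e j) \<otimes> l j x)"
proof -
  have "l i x = l i (\<Oplus>\<^bsub>M\<^esub>j\<in>{..<n}. l j x \<odot>\<^bsub>M\<^esub> e j)" using expand[OF assms(2)] by simp
  also have "\<dots> = (\<Oplus>j\<in>{..<n}. l i (l j x \<odot>\<^bsub>M\<^esub> e j))"
    using assms by (intro l_finsum) (auto simp: l e)
  also have "\<dots> = (\<Oplus>j\<in>{..<n}. l i (e j) \<otimes> l j x)"
    using assms by (intro M.R.finsum_cong') (auto simp: l e l_smult M.R.m_comm)
  finally show ?thesis .
qed

lemma iso_img: "module_isomorphic R M (img R n (\<lambda>i j. l i (e j)))"
  unfolding module_isomorphic_def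
proof (rule bexI)
  let ?f = "\<lambda>x. \<lambda>i\<in>{..<n}. l i x"
  let ?X = "img R n (\<lambda>i j. l i (e j))"
  have fX: "?f x \<in> carrier ?X" if x: "x \<in> carrier M" for x
  proof -
    have "l i x = (\<Oplus>j\<in>{..<n}. l i (e j) \<otimes> ?f x j)" if i: "i < n" for i
      by (subst l_expand[OF i x]) (use i x in \<open>auto intro!: M.R.finsum_cong' simp: l e\<close>)
    then show ?thesis using x l by (auto simp: img_simps)
  qed
  show "?f \<in> module_hom R M ?X"
    by (rule module_homI[OF fX]) (auto simp: img_simps l_add l_smult intro!: restrict_ext)
  show "bij_betw ?f (carrier M) (carrier ?X)"
  proof (rule bij_betwI[OF _ _ _ _])
    let ?g = "\<lambda>v. \<Oplus>\<^bsub>M\<^esub>i\<in>{..<n}. v i \<odot>\<^bsub>M\<^esub> e i"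
    show "?f \<in> carrier M \<rightarrow> carrier ?X" using fX by auto
    show "?g \<in> carrier ?X \<rightarrow> carrier M"
    proof
      fix v assume v: "v \<in> carrier ?X"
      have vc: "v i \<in> carrier R" if "i < n" for i using v that PiE_lt[of v n "carrier R" i] by (simp add: img_simps)
      show "?g v \<in> carrier M" using vc by (auto simp: e intro!: M.M.finsum_closed)
    qed
    show "?g (?f x) = x" if x: "x \<in> carrier M" for x
    proof -
      have "?g (?f x) = (\<Oplus>\<^bsub>M\<^esub>i\<in>{..<n}. l i x \<odot>\<^bsub>M\<^esub> e i)"
        using x by (intro M.M.finsum_cong') (auto simp: l e)
      then show ?thesis using expand[OF x] by simp
    qed
    show "?f (?g v) = v" if v: "v \<in> carrier ?X" for v
    proof (rule PiE_eqI)
      have vc: "v i \<in> carrier R" if "i < n" for i using v that PiE_lt[of v n "carrier R" i] by (simp add: img_simps)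
      have gM: "?g v \<in> carrier M" using vc by (auto simp: e intro!: M.M.finsum_closed)
      show "?f (?g v) \<in> {..<n} \<rightarrow>\<^sub>E carrier R" using gM l by auto
      show "v \<in> {..<n} \<rightarrow>\<^sub>E carrier R" using v by (simp add: img_simps)
      fix i assume i: "i < n"
      have "l i (?g v) = (\<Oplus>j\<in>{..<n}. l i (v j \<odot>\<^bsub>M\<^esub> e j))"
        using i vc by (intro l_finsum) (auto simp: e)
      also have "\<dots> = (\<Oplus>j\<in>{..<n}. l i (e j) \<otimes> v j)"
        using i vc by (intro M.R.finsum_cong') (auto simp: l e l_smult M.R.m_comm)
      also have "\<dots> = v i" using v i by (simp add: img_simps)
      finally show "?f (?g v) i = v i" using i by simp
    qed
  qed
qed

end

section \<open>Finitely generated projective modules\<close>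

lemma represents_module: "represents R M n P \<Longrightarrow> module R M"
  unfolding represents_def frame_def by blast

lemma represents_idempotent: "represents R M n P \<Longrightarrow> idempotent_matrix R n P"
proof -
  assume "represents R M n P"
  then obtain e l where f: "frame R M n e l" and P: "\<And>i j. i < n \<Longrightarrow> j < n \<Longrightarrow> l i (e j) = P i j"
    unfolding represents_def by blast
  interpret frame R M n e l by fact
  have c: "P i j \<in> carrier R" if "i < n" "j < n" for i j
    using l[OF that(1) e[OF that(2)]] P[OF that] by simp
  have "P i k = (\<Oplus>\<^bsub>R\<^esub>j\<in>{..<n}. P i j \<otimes>\<^bsub>R\<^esub> P j k)" if ik: "i < n" "k < n" for i k
  proof -
    have "P i k = (\<Oplus>\<^bsub>R\<^esub>j\<in>{..<n}. l i (e j) \<otimes>\<^bsub>R\<^esub> l j (e k))"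
      using l_expand[OF ik(1) e[OF ik(2)]] P[OF ik] by simp
    also have "\<dots> = (\<Oplus>\<^bsub>R\<^esub>j\<in>{..<n}. P i j \<otimes>\<^bsub>R\<^esub> P j k)"
      using ik c P by (intro M.R.finsum_cong') auto
    finally show ?thesis .
  qed
  then show ?thesis using c by (auto simp: idempotent_matrix_def)
qed

lemma img_cong:
  assumes "cring R" and P: "\<And>i j. i < n \<Longrightarrow> j < n \<Longrightarrow> P i j \<in> carrier R"
    and eq: "\<And>i j. i < n \<Longrightarrow> j < n \<Longrightarrow> Q i j = P i j"
  shows "img R n Q = img R n P"
proof -
  interpret cring R by fact
  have "(\<forall>i<n. v i = (\<Oplus>\<^bsub>R\<^esub>j\<in>{..<n}. Q i j \<otimes>\<^bsub>R\<^esub> v j)) \<longleftrightarrow> (\<forall>i<n. v i = (\<Oplus>\<^bsub>R\<^esub>j\<in>{..<n}. P i j \<otimes>\<^bsub>R\<^esub> v j))"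
    if v: "v \<in> {..<n} \<rightarrow>\<^sub>E carrier R" for v
  proof -
    have "(\<Oplus>\<^bsub>R\<^esub>j\<in>{..<n}. Q i j \<otimes>\<^bsub>R\<^esub> v j) = (\<Oplus>\<^bsub>R\<^esub>j\<in>{..<n}. P i j \<otimes>\<^bsub>R\<^esub> v j)" if i: "i < n" for i
      using i P eq PiE_lt[OF v] by (intro finsum_cong') auto
    then show ?thesis by simp
  qed
  then have "{v \<in> {..<n} \<rightarrow>\<^sub>E carrier R. \<forall>i<n. v i = (\<Oplus>\<^bsub>R\<^esub>j\<in>{..<n}. Q i j \<otimes>\<^bsub>R\<^esub> v j)}
      = {v \<in> {..<n} \<rightarrow>\<^sub>E carrier R. \<forall>i<n. v i = (\<Oplus>\<^bsub>R\<^esub>j\<in>{..<n}. P i j \<otimes>\<^bsub>R\<^esub> v j)}"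
    by blast
  then show ?thesis by (simp only: img_def)
qed

lemma represents_iso: "represents R M n P \<Longrightarrow> module_isomorphic R M (img R n P)"
proof -
  assume r: "represents R M n P"
  then obtain e l where f: "frame R M n e l" and P: "\<And>i j. i < n \<Longrightarrow> j < n \<Longrightarrow> l i (e j) = P i j"
    unfolding represents_def by blast
  interpret frame R M n e l by fact
  have "img R n (\<lambda>i j. l i (e j)) = img R n P"
    using represents_idempotent[OF r] P by (intro img_cong) (auto simp: idempotent_matrix_def intro: M.R.is_cring)
  then show ?thesis using iso_img by simp
qed

text \<open>A dual basis can be carried along an isomorphism.\<close>

lemma represents_transport:
  assumes M: "module R M" and iso: "module_isomorphic R M N" and N: "represents R N n P"
  shows "represents R M n P"
proof -
  obtain e l where f: "frame R N n e l" and P: "\<And>i j. i < n \<Longrightarrow> j < n \<Longrightarrow> l i (e j) = P i j"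
    using N unfolding represents_def by blast
  interpret frame R N n e l by fact
  obtain f where f: "f \<in> module_hom R M N" "bij_betw f (carrier M) (carrier N)"
    using iso unfolding module_isomorphic_def by blast
  interpret M': module R M by fact
  define g where "g = inv_into (carrier M) f"
  note inv = module_iso_inverse[OF \<open>module R M\<close> f, folded g_def]
  have "frame R M n (\<lambda>i. g (e i)) (\<lambda>i x. l i (f x))"
  proof
    fix x assume x: "x \<in> carrier M"
    have fx: "f x \<in> carrier N" by (rule module_homD(1)[OF f(1) x])
    have "x = g (\<Oplus>\<^bsub>N\<^esub>i\<in>{..<n}. l i (f x) \<odot>\<^bsub>N\<^esub> e i)"
      using inv(3)[OF x] expand[OF fx] by simp
    also have "\<dots> = (\<Oplus>\<^bsub>M\<^esub>i\<in>{..<n}. g (l i (f x) \<odot>\<^bsub>N\<^esub> e i))"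
      by (rule finsum_additive[OF M.M.abelian_group_axioms M'.M.abelian_group_axioms])
         (use module_homD[OF inv(1)] l e fx in auto)
    also have "\<dots> = (\<Oplus>\<^bsub>M\<^esub>i\<in>{..<n}. l i (f x) \<odot>\<^bsub>M\<^esub> g (e i))"
      using module_homD[OF inv(1)] l e fx by (intro M'.M.finsum_cong') auto
    finally show "x = (\<Oplus>\<^bsub>M\<^esub>i\<in>{..<n}. l i (f x) \<odot>\<^bsub>M\<^esub> g (e i))" .
  qed (use module_homD[OF f(1)] module_homD(1)[OF inv(1)] l e l_add l_smult in auto)
  moreover have "\<forall>i<n. \<forall>j<n. l i (f (g (e j))) = P i j"
    using inv(4) e P by simp
  ultimately show ?thesis unfolding represents_def by blast
qed

lemma finsum_submodule:
  assumes "module R M" "submodule H R M" "finite A" "\<And>i. i \<in> A \<Longrightarrow> f i \<in> H"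
  shows "finsum (M\<lparr>carrier := H\<rparr>) f A = finsum M f A" "finsum M f A \<in> H"
proof -
  interpret M: module R M by fact
  interpret H: module R "M\<lparr>carrier := H\<rparr>"
    by (rule submodule.submodule_is_module[OF assms(2,1)])
  have HM: "H \<subseteq> carrier M" by (rule M.submoduleE(1)[OF assms(2)])
  show *: "finsum (M\<lparr>carrier := H\<rparr>) f A = finsum M f A"
    using finsum_additive[OF H.M.abelian_group_axioms M.M.abelian_group_axioms, where f = "\<lambda>x. x" and g = f and A = A]
      HM assms(3,4) by auto
  show "finsum M f A \<in> H"
    using H.M.finsum_closed[of f A] assms(4) unfolding * by auto
qed

text \<open>Project the standard basis onto the summand and restrict the coordinate forms to it.\<close>

lemma (in cring) summand_represented:
  assumes "direct_summand R (free_module R n) P"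
  shows "\<exists>Q. represents R ((free_module R n)\<lparr>carrier := P\<rparr>) n Q"
proof -
  let ?F = "free_module R n"
  interpret F: module R ?F by (rule free_module_module)
  obtain Q where P: "submodule P R ?F" and Q: "submodule Q R ?F"
    and PQ: "P <+>\<^bsub>?F\<^esub> Q = carrier ?F" "P \<inter> Q = {\<zero>\<^bsub>?F\<^esub>}"
    using assms unfolding direct_summand_def by blast
  note subP = F.submoduleE[OF P] and subQ = F.submoduleE[OF Q]
  interpret FP: module R "?F\<lparr>carrier := P\<rparr>"
    by (rule submodule.submodule_is_module[OF P]) unfold_locales
  define d where "d i = (\<lambda>k\<in>{..<n}. if k = i then \<one> else \<zero>)" for i
  have d: "d i \<in> carrier ?F" for i by (auto simp: d_def free_simps)
  have "\<exists>p q. p \<in> P \<and> q \<in> Q \<and> d i = p \<oplus>\<^bsub>?F\<^esub> q" for i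
  proof -
    have "d i \<in> P <+>\<^bsub>?F\<^esub> Q" using d[of i] PQ(1) by simp
    then show ?thesis unfolding set_add_def set_mult_def by auto
  qed
  then obtain p q where pq: "\<And>i. p i \<in> P" "\<And>i. q i \<in> Q" "\<And>i. d i = p i \<oplus>\<^bsub>?F\<^esub> q i"
    by metis
  have pF: "p i \<in> carrier ?F" and qF: "q i \<in> carrier ?F" for i
    using pq subP(1) subQ(1) by auto
  have expand: "v = (\<Oplus>\<^bsub>?F\<^esub>i\<in>{..<n}. v i \<odot>\<^bsub>?F\<^esub> p i)" if v: "v \<in> P" for v
  proof -
    have vF: "v \<in> carrier ?F" using v subP(1) by auto
    then have v': "v \<in> {..<n} \<rightarrow>\<^sub>E carrier R" by (simp add: free_simps)
    have vc: "v i \<in> carrier R" if "i < n" for i using PiE_lt[OF v' that] .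
    define s where "s = (\<Oplus>\<^bsub>?F\<^esub>i\<in>{..<n}. v i \<odot>\<^bsub>?F\<^esub> p i)"
    define r where "r = (\<Oplus>\<^bsub>?F\<^esub>i\<in>{..<n}. v i \<odot>\<^bsub>?F\<^esub> q i)"
    have sP: "s \<in> P" unfolding s_def
      by (rule finsum_submodule(2)[OF F.module_axioms P]) (use vc pq subP(4) in auto)
    have rQ: "r \<in> Q" unfolding r_def
      by (rule finsum_submodule(2)[OF F.module_axioms Q]) (use vc pq subQ(4) in auto)
    have vd: "v = (\<Oplus>\<^bsub>?F\<^esub>i\<in>{..<n}. v i \<odot>\<^bsub>?F\<^esub> d i)"
    proof (rule PiE_eqI[OF v'])
      have "(\<Oplus>\<^bsub>?F\<^esub>i\<in>{..<n}. v i \<odot>\<^bsub>?F\<^esub> d i) \<in> carrier ?F"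
        using vc d by (intro F.M.finsum_closed) auto
      then show "(\<Oplus>\<^bsub>?F\<^esub>i\<in>{..<n}. v i \<odot>\<^bsub>?F\<^esub> d i) \<in> {..<n} \<rightarrow>\<^sub>E carrier R" by (simp add: free_simps)
      fix k assume k: "k < n"
      have "(\<Oplus>\<^bsub>?F\<^esub>i\<in>{..<n}. v i \<odot>\<^bsub>?F\<^esub> d i) k = (\<Oplus>i\<in>{..<n}. (v i \<odot>\<^bsub>?F\<^esub> d i) k)"
        by (rule finsum_in_free[OF F.M.abelian_group_axioms free_simps(2) eq_refl[OF free_simps(1)] finite_lessThan _ k])
           (use vc d in auto)
      also have "\<dots> = (\<Oplus>i\<in>{..<n}. if k = i then v i else \<zero>)"
        using vc k by (intro finsum_cong') (auto simp: free_simps(4) d_def)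
      also have "\<dots> = v k"
        using vc k by (subst finsum_singleton[of k "{..<n}" v]) auto
      finally show "v k = (\<Oplus>\<^bsub>?F\<^esub>i\<in>{..<n}. v i \<odot>\<^bsub>?F\<^esub> d i) k" ..
    qed
    have "v = (\<Oplus>\<^bsub>?F\<^esub>i\<in>{..<n}. v i \<odot>\<^bsub>?F\<^esub> p i \<oplus>\<^bsub>?F\<^esub> v i \<odot>\<^bsub>?F\<^esub> q i)"
      using vc pF qF by (subst vd, intro F.M.finsum_cong') (auto simp: pq(3) F.smult_r_distr)
    also have "\<dots> = s \<oplus>\<^bsub>?F\<^esub> r"
      unfolding s_def r_def using vc pF qF by (intro F.M.finsum_addf) auto
    finally have sr: "v = s \<oplus>\<^bsub>?F\<^esub> r" .
    have sF: "s \<in> carrier ?F" and rF: "r \<in> carrier ?F" using sP rQ subP(1) subQ(1) by auto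
    have "r = v \<oplus>\<^bsub>?F\<^esub> \<ominus>\<^bsub>?F\<^esub> s"
      using sF rF F.M.a_comm[OF sF rF] by (simp add: sr F.M.a_assoc F.M.r_neg)
    then have "r \<in> P" using subP(5)[OF v subP(3)[OF sP]] by simp
    then have "r = \<zero>\<^bsub>?F\<^esub>" using rQ PQ(2) by blast
    then show ?thesis using sr sF unfolding s_def by simp
  qed
  have "frame R (?F\<lparr>carrier := P\<rparr>) n p (\<lambda>i v. v i)"
  proof
    fix v assume "v \<in> carrier (?F\<lparr>carrier := P\<rparr>)"
    then have v: "v \<in> P" by simp
    then have vF: "v \<in> carrier ?F" using subP(1) by auto
    then have v': "v \<in> {..<n} \<rightarrow>\<^sub>E carrier R" by (simp add: free_simps)
    show "v i \<in> carrier R" if "i < n" for i using PiE_lt[OF v' that] .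
    have "(\<Oplus>\<^bsub>?F\<lparr>carrier := P\<rparr>\<^esub>i\<in>{..<n}. v i \<odot>\<^bsub>?F\<^esub> p i) = (\<Oplus>\<^bsub>?F\<^esub>i\<in>{..<n}. v i \<odot>\<^bsub>?F\<^esub> p i)"
      by (rule finsum_submodule(1)[OF F.module_axioms P]) (use PiE_lt[OF v'] pq subP(4) in auto)
    then show "v = (\<Oplus>\<^bsub>?F\<lparr>carrier := P\<rparr>\<^esub>i\<in>{..<n}. v i \<odot>\<^bsub>?F\<lparr>carrier := P\<rparr>\<^esub> p i)"
      using expand[OF v] by simp
  qed (auto simp: pq free_simps(2,4))
  then have "represents R (?F\<lparr>carrier := P\<rparr>) n (\<lambda>i j. p j i)"
    unfolding represents_def by blast
  then show ?thesis by blast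
qed

text \<open>A complement is the kernel, consisting of the vectors \<open>v - P v\<close>.\<close>

lemma (in cring) img_summand:
  assumes P: "idempotent_matrix R n P"
  shows "direct_summand R (free_module R n) (carrier (img R n P))"
proof -
  let ?F = "free_module R n"
  interpret F: module R ?F by (rule free_module_module)
  have Pc: "P i j \<in> carrier R" if "i < n" "j < n" for i j
    using P that by (auto simp: idempotent_matrix_def)
  have sub: "submodule (carrier (img R n P)) R ?F" using Pc by (rule img_submodule)
  obtain e l where f: "frame R (img R n P) n e l" and Pe: "\<And>i j. i < n \<Longrightarrow> j < n \<Longrightarrow> l i (e j) = P i j"
    using img_represents[OF P] unfolding represents_def by blast
  define pr where "pr v = (\<lambda>i\<in>{..<n}. \<Oplus>j\<in>{..<n}. P i j \<otimes> v j)" for v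
  have pr_F: "pr v \<in> carrier ?F" if "v \<in> carrier ?F" for v
  proof -
    have "v j \<in> carrier R" if "j < n" for j
      using \<open>v \<in> carrier ?F\<close> PiE_lt[of v n "carrier R" j] that by (simp add: free_simps)
    then show ?thesis using Pc by (auto simp: pr_def free_simps intro!: finsum_closed)
  qed
  have pr_fix: "pr v = v" if "v \<in> carrier (img R n P)" for v
    by (rule PiE_eqI[of _ n UNIV _ UNIV]) (use that in \<open>auto simp: pr_def img_simps\<close>)
  have fix_img: "v \<in> carrier (img R n P)" if "v \<in> carrier ?F" "pr v = v" for v
  proof -
    have "v i = (\<Oplus>j\<in>{..<n}. P i j \<otimes> v j)" if "i < n" for i
      using fun_cong[OF \<open>pr v = v\<close>, of i] that by (simp add: pr_def)
    then show ?thesis using that(1) by (simp add: img_simps free_simps)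
  qed
  have c: "v j \<in> carrier R" if "v \<in> carrier ?F" "j < n" for v j
    using PiE_lt[of v n "carrier R" j] that by (simp add: free_simps)
  have pr_add: "pr (v \<oplus>\<^bsub>?F\<^esub> w) = pr v \<oplus>\<^bsub>?F\<^esub> pr w" if v: "v \<in> carrier ?F" and w: "w \<in> carrier ?F" for v w
  proof -
    have "(\<Oplus>j\<in>{..<n}. P i j \<otimes> (\<lambda>i\<in>{..<n}. v i \<oplus> w i) j) = (\<Oplus>j\<in>{..<n}. P i j \<otimes> v j) \<oplus> (\<Oplus>j\<in>{..<n}. P i j \<otimes> w j)"
      if i: "i < n" for i
    proof -
      have "(\<Oplus>j\<in>{..<n}. P i j \<otimes> (\<lambda>i\<in>{..<n}. v i \<oplus> w i) j) = (\<Oplus>j\<in>{..<n}. P i j \<otimes> v j \<oplus> P i j \<otimes> w j)"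
        using Pc i c[OF v] c[OF w] by (intro finsum_cong') (auto simp: r_distr)
      also have "\<dots> = (\<Oplus>j\<in>{..<n}. P i j \<otimes> v j) \<oplus> (\<Oplus>j\<in>{..<n}. P i j \<otimes> w j)"
        using Pc i c[OF v] c[OF w] by (intro finsum_addf) auto
      finally show ?thesis .
    qed
    then show ?thesis unfolding pr_def free_simps by (intro restrict_ext) simp
  qed
  have pr_smult: "pr (a \<odot>\<^bsub>?F\<^esub> v) = a \<odot>\<^bsub>?F\<^esub> pr v" if a: "a \<in> carrier R" and v: "v \<in> carrier ?F" for a v
  proof -
    have "(\<Oplus>j\<in>{..<n}. P i j \<otimes> (\<lambda>i\<in>{..<n}. a \<otimes> v i) j) = a \<otimes> (\<Oplus>j\<in>{..<n}. P i j \<otimes> v j)" if i: "i < n" for i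
    proof -
      have "a \<otimes> (\<Oplus>j\<in>{..<n}. P i j \<otimes> v j) = (\<Oplus>j\<in>{..<n}. a \<otimes> (P i j \<otimes> v j))"
        using Pc i c[OF v] a by (intro finsum_rdistr) auto
      also have "\<dots> = (\<Oplus>j\<in>{..<n}. P i j \<otimes> (\<lambda>i\<in>{..<n}. a \<otimes> v i) j)"
        using Pc i c[OF v] a by (intro finsum_cong') (auto simp: m_lcomm)
      finally show ?thesis ..
    qed
    then show ?thesis unfolding pr_def free_simps by (intro restrict_ext) simp
  qed
  have pr_img: "pr v \<in> carrier (img R n P)" if v: "v \<in> carrier ?F" for v
  proof -
    interpret fr: frame R "img R n P" n e l by fact
    have img_e: "(\<lambda>i\<in>{..<n}. P i j) \<in> carrier (img R n P)" if j: "j < n" for j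
    proof -
      have "P i j = (\<Oplus>k\<in>{..<n}. P i k \<otimes> (\<lambda>i\<in>{..<n}. P i j) k)" if i: "i < n" for i
      proof -
        have "P i j = (\<Oplus>k\<in>{..<n}. P i k \<otimes> P k j)" using P i j unfolding idempotent_matrix_def by blast
        also have "\<dots> = (\<Oplus>k\<in>{..<n}. P i k \<otimes> (\<lambda>i\<in>{..<n}. P i j) k)"
          using Pc i j by (intro finsum_cong') auto
        finally show ?thesis .
      qed
      then show ?thesis using Pc j by (auto simp: img_simps)
    qed
    have mem: "v j \<odot>\<^bsub>?F\<^esub> (\<lambda>i\<in>{..<n}. P i j) \<in> carrier (img R n P)" if "j < n" for j
      by (rule F.submoduleE(4)[OF sub c[OF v that] img_e[OF that]])
    have "(\<Oplus>\<^bsub>?F\<^esub>j\<in>{..<n}. v j \<odot>\<^bsub>?F\<^esub> (\<lambda>i\<in>{..<n}. P i j)) = pr v"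
    proof (rule PiE_eqI)
      have "(\<Oplus>\<^bsub>?F\<^esub>j\<in>{..<n}. v j \<odot>\<^bsub>?F\<^esub> (\<lambda>i\<in>{..<n}. P i j)) \<in> carrier ?F"
        using mem F.submoduleE(1)[OF sub] by (intro F.M.finsum_closed) auto
      then show "(\<Oplus>\<^bsub>?F\<^esub>j\<in>{..<n}. v j \<odot>\<^bsub>?F\<^esub> (\<lambda>i\<in>{..<n}. P i j)) \<in> {..<n} \<rightarrow>\<^sub>E carrier R" by (simp add: free_simps)
      show "pr v \<in> {..<n} \<rightarrow>\<^sub>E carrier R" using pr_F[OF v] by (simp add: free_simps)
      fix k assume k: "k < n"
      have "(\<Oplus>\<^bsub>?F\<^esub>j\<in>{..<n}. v j \<odot>\<^bsub>?F\<^esub> (\<lambda>i\<in>{..<n}. P i j)) k = (\<Oplus>j\<in>{..<n}. (v j \<odot>\<^bsub>?F\<^esub> (\<lambda>i\<in>{..<n}. P i j)) k)"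
        by (rule finsum_in_free[OF F.M.abelian_group_axioms free_simps(2) eq_refl[OF free_simps(1)] finite_lessThan _ k])
           (use mem F.submoduleE(1)[OF sub] in auto)
      also have "\<dots> = (\<Oplus>j\<in>{..<n}. P k j \<otimes> v j)"
        using k Pc c[OF v] by (intro finsum_cong') (auto simp: free_simps(4) m_comm)
      finally show "(\<Oplus>\<^bsub>?F\<^esub>j\<in>{..<n}. v j \<odot>\<^bsub>?F\<^esub> (\<lambda>i\<in>{..<n}. P i j)) k = pr v k"
        using k by (simp add: pr_def)
    qed
    moreover have "(\<Oplus>\<^bsub>?F\<^esub>j\<in>{..<n}. v j \<odot>\<^bsub>?F\<^esub> (\<lambda>i\<in>{..<n}. P i j)) \<in> carrier (img R n P)"
      by (rule finsum_submodule(2)[OF F.module_axioms sub]) (use mem in auto)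
    ultimately show ?thesis by simp
  qed
  define Q where "Q = {v \<in> carrier ?F. pr v = \<zero>\<^bsub>?F\<^esub>}"
  have pr_neg: "pr (\<ominus>\<^bsub>?F\<^esub> v) = \<ominus>\<^bsub>?F\<^esub> pr v" if v: "v \<in> carrier ?F" for v
    using pr_smult[of "\<ominus> \<one>" v] F.smult_l_minus[of \<one> v] F.smult_l_minus[of \<one> "pr v"] v pr_F[OF v] by simp
  have pr0: "pr \<zero>\<^bsub>?F\<^esub> = \<zero>\<^bsub>?F\<^esub>"
    using pr_smult[of \<zero> "\<zero>\<^bsub>?F\<^esub>"] pr_F[of "\<zero>\<^bsub>?F\<^esub>"] by simp
  have Q: "submodule Q R ?F"
    by (rule F.submoduleI) (auto simp: Q_def pr0 pr_neg pr_add pr_smult)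
  have "carrier (img R n P) <+>\<^bsub>?F\<^esub> Q = carrier ?F"
  proof
    show "carrier (img R n P) <+>\<^bsub>?F\<^esub> Q \<subseteq> carrier ?F"
      using F.submoduleE(1)[OF sub] F.submoduleE(1)[OF Q] unfolding set_add_def set_mult_def by auto
    show "carrier ?F \<subseteq> carrier (img R n P) <+>\<^bsub>?F\<^esub> Q"
    proof
      fix v assume v: "v \<in> carrier ?F"
      define w where "w = v \<oplus>\<^bsub>?F\<^esub> \<ominus>\<^bsub>?F\<^esub> pr v"
      have wF: "w \<in> carrier ?F" using v pr_F[OF v] by (simp add: w_def)
      have "pr w = \<zero>\<^bsub>?F\<^esub>"
        unfolding w_def using v pr_F[OF v] pr_fix[OF pr_img[OF v]] by (simp add: pr_add pr_neg F.M.r_neg)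
      then have "w \<in> Q" using wF by (simp add: Q_def)
      moreover have "v = pr v \<oplus>\<^bsub>?F\<^esub> w"
        unfolding w_def using v pr_F[OF v] by (simp add: F.M.a_lcomm F.M.r_neg)
      ultimately show "v \<in> carrier (img R n P) <+>\<^bsub>?F\<^esub> Q"
        using pr_img[OF v] unfolding set_add_def set_mult_def by auto
    qed
  qed
  moreover have "carrier (img R n P) \<inter> Q = {\<zero>\<^bsub>?F\<^esub>}"
  proof -
    have "v = \<zero>\<^bsub>?F\<^esub>" if "v \<in> carrier (img R n P)" "v \<in> Q" for v
      using pr_fix[OF that(1)] that(2) by (simp add: Q_def)
    moreover have "\<zero>\<^bsub>?F\<^esub> \<in> carrier (img R n P)" by (rule fix_img) (simp_all add: pr0)
    moreover have "\<zero>\<^bsub>?F\<^esub> \<in> Q" by (simp add: Q_def pr0)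
    ultimately show ?thesis by blast
  qed
  ultimately show ?thesis unfolding direct_summand_def using sub Q by blast
qed

lemma fg_projective_iff:
  assumes "cring R"
  shows "fg_projective R M \<longleftrightarrow> (\<exists>n P. represents R M n P)"
proof
  interpret cring R by fact
  assume "fg_projective R M"
  then obtain n P where M: "module R M" and P: "direct_summand R (free_module R n) P"
    and iso: "module_isomorphic R M ((free_module R n)\<lparr>carrier := P\<rparr>)"
    unfolding fg_projective_def by blast
  then show "\<exists>n P. represents R M n P"
    using summand_represented[OF P] represents_transport[OF M iso] by blast
next
  interpret cring R by fact
  assume "\<exists>n P. represents R M n P"
  then obtain n P where r: "represents R M n P" by blast
  have "module_isomorphic R M ((free_module R n)\<lparr>carrier := carrier (img R n P)\<rparr>)"
    using represents_iso[OF r] by (simp add: img_def)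
  then show "fg_projective R M"
    unfolding fg_projective_def
    using represents_module[OF r] img_summand[OF represents_idempotent[OF r]] by blast
qed

section \<open>Rank one matrices\<close>

text \<open>Vanishing minors and trace 1. Idempotency follows, and these conditions, unlike rank
  conditions at primes, are equations and so preserved by every ring homomorphism.\<close>

definition rank_one_matrix :: "('a, 'r) ring_scheme \<Rightarrow> nat \<Rightarrow> (nat \<Rightarrow> nat \<Rightarrow> 'a) \<Rightarrow> bool" where
  "rank_one_matrix R n P \<longleftrightarrow> (\<forall>i<n. \<forall>j<n. P i j \<in> carrier R) \<and>
     (\<forall>i<n. \<forall>j<n. \<forall>k<n. \<forall>l<n. P i j \<otimes>\<^bsub>R\<^esub> P k l = P i l \<otimes>\<^bsub>R\<^esub> P k j) \<and>
     (\<Oplus>\<^bsub>R\<^esub>i\<in>{..<n}. P i i) = \<one>\<^bsub>R\<^esub>"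

lemma rank_one_matrixD:
  assumes "rank_one_matrix R n P"
  shows "i < n \<Longrightarrow> j < n \<Longrightarrow> P i j \<in> carrier R"
    and "i < n \<Longrightarrow> j < n \<Longrightarrow> k < n \<Longrightarrow> l < n \<Longrightarrow> P i j \<otimes>\<^bsub>R\<^esub> P k l = P i l \<otimes>\<^bsub>R\<^esub> P k j"
    and "(\<Oplus>\<^bsub>R\<^esub>i\<in>{..<n}. P i i) = \<one>\<^bsub>R\<^esub>"
  using assms unfolding rank_one_matrix_def by blast+

context cring
begin

lemma rank_one_idempotent:
  assumes P: "rank_one_matrix R n P" shows "idempotent_matrix R n P"
  unfolding idempotent_matrix_def
proof (intro conjI allI impI)
  note D = rank_one_matrixD[OF P]
  show "P i j \<in> carrier R" if "i < n" "j < n" for i j by (rule D(1)[OF that])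
  fix i k assume ik: "i < n" "k < n"
  have "(\<Oplus>j\<in>{..<n}. P i j \<otimes> P j k) = (\<Oplus>j\<in>{..<n}. P i k \<otimes> P j j)"
    using ik D by (intro finsum_cong') auto
  also have "\<dots> = P i k \<otimes> (\<Oplus>j\<in>{..<n}. P j j)"
    using ik D by (intro finsum_rdistr[symmetric]) auto
  also have "\<dots> = P i k" using ik D by simp
  finally show "P i k = (\<Oplus>j\<in>{..<n}. P i j \<otimes> P j k)" ..
qed

lemma finsum_zero_eq:
  assumes "finite A" "\<And>i. i \<in> A \<Longrightarrow> f i = \<zero>" shows "(\<Oplus>i\<in>A. f i) = \<zero>"
proof -
  have "(\<Oplus>i\<in>A. f i) = (\<Oplus>i\<in>A. \<zero>)" using assms by (intro finsum_cong') auto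
  then show ?thesis by simp
qed

text \<open>The columns of \<open>x\<close> lie in the image of \<open>P\<close> and the rows of \<open>y\<close> are forms on it: setting \<open>i = j\<close> and summing shows that \<open>y x = Q\<close>, and
  setting \<open>k = l\<close> and summing shows that \<open>x y = P\<close>. So they form a dual basis with matrix \<open>Q\<close>.\<close>

lemma represents_of_factorization:
  assumes P: "rank_one_matrix R n P" and Q: "rank_one_matrix R m Q"
    and x: "\<And>i k. i < n \<Longrightarrow> k < m \<Longrightarrow> x i k \<in> carrier R"
    and y: "\<And>l j. l < m \<Longrightarrow> j < n \<Longrightarrow> y l j \<in> carrier R"
    and xy: "\<And>i k l j. \<lbrakk>i < n; k < m; l < m; j < n\<rbrakk> \<Longrightarrow> x i k \<otimes> y l j = P i j \<otimes> Q l k"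
  shows "represents R (img R n P) m Q"
proof -
  note P' = rank_one_matrixD[OF P] and Q' = rank_one_matrixD[OF Q]
  interpret M: module R "img R n P" using P'(1) by (rule img_module)
  have kill: "z = \<zero>" if z: "z \<in> carrier R" and zy: "\<And>l j. l < m \<Longrightarrow> j < n \<Longrightarrow> z \<otimes> y l j = \<zero>" for z
  proof -
    have "P j j \<otimes> (Q l l \<otimes> z) = \<zero>" if jl: "j < n" "l < m" for j l
    proof -
      have "P j j \<otimes> (Q l l \<otimes> z) = (x j l \<otimes> y l j) \<otimes> z"
        using jl z P'(1,3) Q'(1,3) xy by (simp add: m_assoc)
      also have "\<dots> = x j l \<otimes> (z \<otimes> y l j)" using jl z x y by (simp add: m_ac)
      finally show ?thesis using zy[OF jl(2,1)] x jl by simp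
    qed
    then have "(\<Oplus>j\<in>{..<n}. P j j \<otimes> (Q l l \<otimes> z)) = \<zero>" if "l < m" for l
      using that by (intro finsum_zero_eq) auto
    then have "(\<Oplus>j\<in>{..<n}. P j j) \<otimes> (Q l l \<otimes> z) = \<zero>" if l: "l < m" for l
      using l P'(1,3) Q'(1,3) z by (subst finsum_ldistr) auto
    then have "Q l l \<otimes> z = \<zero>" if l: "l < m" for l using l P'(1,3) Q'(1,3) z by simp
    then have "(\<Oplus>l\<in>{..<m}. Q l l \<otimes> z) = \<zero>" by (intro finsum_zero_eq) auto
    then have "(\<Oplus>l\<in>{..<m}. Q l l) \<otimes> z = \<zero>" using Q'(1,3) z by (subst finsum_ldistr) auto
    then show ?thesis using Q'(1,3) z by simp
  qed
  have xP: "P i j \<otimes> x j k = P j j \<otimes> x i k" if ijk: "i < n" "j < n" "k < m" for i j k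
  proof -
    have c: "P i j \<in> carrier R" "P j j \<in> carrier R" "x j k \<in> carrier R" "x i k \<in> carrier R"
      using ijk by (auto intro: P'(1) x)
    have zy: "(P i j \<otimes> x j k \<ominus> P j j \<otimes> x i k) \<otimes> y l q = \<zero>" if lq: "l < m" "q < n" for l q
    proof -
      have yc: "y l q \<in> carrier R" and Pq: "P j q \<in> carrier R" "P i q \<in> carrier R" and Qc: "Q l k \<in> carrier R"
        using ijk lq by (auto intro: P'(1) Q'(1) y)
      have "P i j \<otimes> P j q = P i q \<otimes> P j j"
        by (rule P'(2)) (use ijk lq in auto)
      also have "\<dots> = P j j \<otimes> P i q"
        by (rule m_comm[OF Pq(2) c(2)])
      finally have PP: "P i j \<otimes> P j q = P j j \<otimes> P i q" .
      have "P i j \<otimes> (x j k \<otimes> y l q) = (P i j \<otimes> P j q) \<otimes> Q l k"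
        unfolding xy[OF ijk(2,3) lq] by (rule m_assoc[symmetric, OF c(1) Pq(1) Qc])
      also have "\<dots> = P j j \<otimes> (x i k \<otimes> y l q)"
        unfolding PP xy[OF ijk(1,3) lq] by (rule m_assoc[OF c(2) Pq(2) Qc])
      finally have eq: "P i j \<otimes> (x j k \<otimes> y l q) = P j j \<otimes> (x i k \<otimes> y l q)" .
      have "(P i j \<otimes> x j k \<ominus> P j j \<otimes> x i k) \<otimes> y l q
          = P i j \<otimes> (x j k \<otimes> y l q) \<ominus> P j j \<otimes> (x i k \<otimes> y l q)"
        using c yc by (simp add: a_minus_def l_distr l_minus m_assoc)
      also have "\<dots> = \<zero>"
        unfolding eq using c yc by (simp add: a_minus_def r_neg)
      finally show ?thesis .
    qed
    have diff: "P i j \<otimes> x j k \<ominus> P j j \<otimes> x i k = \<zero>"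
      by (rule kill[OF minus_closed[OF m_closed[OF c(1,3)] m_closed[OF c(2,4)]] zy])
    have "P i j \<otimes> x j k = (P i j \<otimes> x j k \<ominus> P j j \<otimes> x i k) \<oplus> P j j \<otimes> x i k"
      using c by (simp add: a_minus_def a_assoc l_neg)
    also have "\<dots> = P j j \<otimes> x i k"
      unfolding diff using c by simp
    finally show ?thesis .
  qed
  define e where "e k = (\<lambda>i\<in>{..<n}. x i k)" for k
  define l where "l q v = (\<Oplus>j\<in>{..<n}. y q j \<otimes> v j)" for q and v :: "nat \<Rightarrow> 'a"
  have vc: "v j \<in> carrier R" if "v \<in> carrier (img R n P)" "j < n" for v j
    using that PiE_lt[of v n "carrier R" j] by (simp add: img_simps)
  have e: "e k \<in> carrier (img R n P)" if k: "k < m" for k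
  proof -
    have fix_x: "(\<Oplus>j\<in>{..<n}. P i j \<otimes> (\<lambda>i\<in>{..<n}. x i k) j) = x i k" if i: "i < n" for i
    proof -
      have "(\<Oplus>j\<in>{..<n}. P i j \<otimes> (\<lambda>i\<in>{..<n}. x i k) j) = (\<Oplus>j\<in>{..<n}. P j j \<otimes> x i k)"
        using i k x P'(1,3) by (intro finsum_cong') (auto intro!: xP)
      also have "\<dots> = (\<Oplus>j\<in>{..<n}. P j j) \<otimes> x i k"
        using i k x P'(1,3) by (intro finsum_ldistr[symmetric]) auto
      also have "\<dots> = x i k" using x[OF i k] by (simp add: P'(3))
      finally show ?thesis .
    qed
    have "e k \<in> {..<n} \<rightarrow>\<^sub>E carrier R" using k x by (auto simp: e_def)
    then show ?thesis using fix_x by (simp add: e_def img_simps)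
  qed
  have "frame R (img R n P) m e l"
  proof
    show "e k \<in> carrier (img R n P)" if "k < m" for k by (rule e[OF that])
    show "l q v \<in> carrier R" if "q < m" "v \<in> carrier (img R n P)" for q v
      using that y vc by (auto simp: l_def intro!: finsum_closed)
    show "l q (v \<oplus>\<^bsub>img R n P\<^esub> w) = l q v \<oplus> l q w"
      if "q < m" and v: "v \<in> carrier (img R n P)" and w: "w \<in> carrier (img R n P)" for q v w
    proof -
      have "l q (v \<oplus>\<^bsub>img R n P\<^esub> w) = (\<Oplus>j\<in>{..<n}. y q j \<otimes> v j \<oplus> y q j \<otimes> w j)"
        unfolding l_def using that y vc[OF v] vc[OF w] by (intro finsum_cong') (auto simp: img_simps(2) r_distr)
      then show ?thesis
        unfolding l_def using that y vc[OF v] vc[OF w] by (subst (asm) finsum_addf) auto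
    qed
    show "l q (a \<odot>\<^bsub>img R n P\<^esub> v) = a \<otimes> l q v"
      if "q < m" "a \<in> carrier R" and v: "v \<in> carrier (img R n P)" for q a v
    proof -
      have "l q (a \<odot>\<^bsub>img R n P\<^esub> v) = (\<Oplus>j\<in>{..<n}. a \<otimes> (y q j \<otimes> v j))"
        unfolding l_def using that y vc[OF v] by (intro finsum_cong') (auto simp: img_simps(4) m_lcomm)
      then show ?thesis
        unfolding l_def using that y vc[OF v] by (subst finsum_rdistr) auto
    qed
    fix v assume v: "v \<in> carrier (img R n P)"
    have lv: "l q v \<in> carrier R" if "q < m" for q
      using that y vc[OF v] by (auto simp: l_def intro!: finsum_closed)
    have le: "l q v \<odot>\<^bsub>img R n P\<^esub> e q \<in> carrier (img R n P)" if "q < m" for q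
      using lv e that by auto
    show "v = (\<Oplus>\<^bsub>img R n P\<^esub>q\<in>{..<m}. l q v \<odot>\<^bsub>img R n P\<^esub> e q)"
    proof (rule PiE_eqI)
      show "v \<in> {..<n} \<rightarrow>\<^sub>E carrier R" using v by (simp add: img_simps)
      have "(\<Oplus>\<^bsub>img R n P\<^esub>q\<in>{..<m}. l q v \<odot>\<^bsub>img R n P\<^esub> e q) \<in> carrier (img R n P)"
        using le by (intro M.M.finsum_closed) auto
      then show "(\<Oplus>\<^bsub>img R n P\<^esub>q\<in>{..<m}. l q v \<odot>\<^bsub>img R n P\<^esub> e q) \<in> {..<n} \<rightarrow>\<^sub>E carrier R"
        by (simp add: img_simps)
      fix i assume i: "i < n"
      have part: "l q v \<otimes> x i q = Q q q \<otimes> v i" if q: "q < m" for q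
      proof -
        have "l q v \<otimes> x i q = (\<Oplus>j\<in>{..<n}. (y q j \<otimes> v j) \<otimes> x i q)"
          unfolding l_def using i q x y vc[OF v] by (intro finsum_ldistr) auto
        also have "\<dots> = (\<Oplus>j\<in>{..<n}. Q q q \<otimes> (P i j \<otimes> v j))"
        proof (rule finsum_cong')
          fix j assume "j \<in> {..<n}"
          then have j: "j < n" by simp
          have "(y q j \<otimes> v j) \<otimes> x i q = (x i q \<otimes> y q j) \<otimes> v j"
            using i j q x y vc[OF v] by (simp add: m_ac)
          also have "\<dots> = Q q q \<otimes> (P i j \<otimes> v j)"
            using i j q P'(1,3) Q'(1,3) vc[OF v] by (simp add: xy m_ac)
          finally show "(y q j \<otimes> v j) \<otimes> x i q = Q q q \<otimes> (P i j \<otimes> v j)" .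
        qed (use i q P'(1,3) Q'(1,3) vc[OF v] in auto)
        also have "\<dots> = Q q q \<otimes> (\<Oplus>j\<in>{..<n}. P i j \<otimes> v j)"
          using i q P'(1,3) Q'(1,3) vc[OF v] by (intro finsum_rdistr[symmetric]) auto
        finally show ?thesis using v i by (simp add: img_simps)
      qed
      have "(\<Oplus>\<^bsub>img R n P\<^esub>q\<in>{..<m}. l q v \<odot>\<^bsub>img R n P\<^esub> e q) i = (\<Oplus>q\<in>{..<m}. (l q v \<odot>\<^bsub>img R n P\<^esub> e q) i)"
        by (rule finsum_in_free[OF M.M.abelian_group_axioms img_simps(2) _ finite_lessThan _ i])
           (use le in \<open>auto simp: img_simps(1)\<close>)
      also have "\<dots> = (\<Oplus>q\<in>{..<m}. Q q q \<otimes> v i)"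
        using i part Q'(1,3) vc[OF v] by (intro finsum_cong') (auto simp: img_simps(4) e_def)
      also have "\<dots> = (\<Oplus>q\<in>{..<m}. Q q q) \<otimes> v i"
        using i Q'(1,3) vc[OF v] by (intro finsum_ldistr[symmetric]) auto
      finally show "v i = (\<Oplus>\<^bsub>img R n P\<^esub>q\<in>{..<m}. l q v \<odot>\<^bsub>img R n P\<^esub> e q) i"
        using i Q'(1,3) vc[OF v] by simp
    qed
  qed
  moreover have "l q (e k) = Q q k" if qk: "q < m" "k < m" for q k
  proof -
    have "l q (e k) = (\<Oplus>j\<in>{..<n}. P j j \<otimes> Q q k)"
      unfolding l_def using qk x y xy P'(1,3) Q'(1,3) by (intro finsum_cong') (auto simp: e_def m_comm)
    also have "\<dots> = (\<Oplus>j\<in>{..<n}. P j j) \<otimes> Q q k"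
      using qk P'(1,3) Q'(1,3) by (intro finsum_ldistr[symmetric]) auto
    finally show ?thesis using qk P'(1,3) Q'(1,3) by simp
  qed
  ultimately show ?thesis unfolding represents_def by blast
qed

text \<open>Let \<open>y\<close> and \<open>x\<close> be the matrices of the isomorphism and of its inverse. The columns of \<open>Q\<close> are proportional because its
  minors vanish, hence so are their images: \<open>Q l r \<otimes> x i k = Q l k \<otimes> x i r\<close>. Multiplying by \<open>y r j\<close> and summing over \<open>r\<close> turns the
  composition \<open>x y = P\<close> into the factorization.\<close>

lemma factorization_of_iso:
  assumes P: "rank_one_matrix R n P" and Q: "rank_one_matrix R m Q"
    and iso: "module_isomorphic R (img R n P) (img R m Q)"
  shows "\<exists>x y. (\<forall>i<n. \<forall>k<m. x i k \<in> carrier R) \<and> (\<forall>l<m. \<forall>j<n. y l j \<in> carrier R) \<and>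
    (\<forall>i<n. \<forall>k<m. \<forall>l<m. \<forall>j<n. x i k \<otimes> y l j = P i j \<otimes> Q l k)"
proof -
  note P' = rank_one_matrixD[OF P] and Q' = rank_one_matrixD[OF Q]
  interpret MP: module R "img R n P" using P'(1) by (rule img_module)
  interpret MQ: module R "img R m Q" using Q'(1) by (rule img_module)
  obtain f where f: "f \<in> module_hom R (img R n P) (img R m Q)" "bij_betw f (carrier (img R n P)) (carrier (img R m Q))"
    using iso unfolding module_isomorphic_def by blast
  define g where "g = inv_into (carrier (img R n P)) f"
  note inv = module_iso_inverse[OF MP.module_axioms f, folded g_def]
  have col: "(\<lambda>i\<in>{..<r}. A i j) \<in> carrier (img R r A)" if A: "rank_one_matrix R r A" and j: "j < r" for r A j
  proof -
    have fix_A: "(\<Oplus>k\<in>{..<r}. A i k \<otimes> (\<lambda>i\<in>{..<r}. A i j) k) = A i j" if i: "i < r" for i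
    proof -
      have "A i j = (\<Oplus>k\<in>{..<r}. A i k \<otimes> A k j)"
        using rank_one_idempotent[OF A] i j unfolding idempotent_matrix_def by blast
      also have "\<dots> = (\<Oplus>k\<in>{..<r}. A i k \<otimes> (\<lambda>i\<in>{..<r}. A i j) k)"
        using rank_one_matrixD(1)[OF A] i j by (intro finsum_cong') auto
      finally show ?thesis by (rule sym)
    qed
    have "(\<lambda>i\<in>{..<r}. A i j) \<in> {..<r} \<rightarrow>\<^sub>E carrier R"
      using rank_one_matrixD(1)[OF A] j by auto
    then show ?thesis using fix_A by (simp add: img_simps)
  qed
  define p where "p j = (\<lambda>i\<in>{..<n}. P i j)" for j
  define q where "q k = (\<lambda>i\<in>{..<m}. Q i k)" for k
  have p: "p j \<in> carrier (img R n P)" if "j < n" for j unfolding p_def by (rule col[OF P that])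
  have q: "q k \<in> carrier (img R m Q)" if "k < m" for k unfolding q_def by (rule col[OF Q that])
  define x where "x i k = g (q k) i" for i k
  define y where "y l j = f (p j) l" for l j
  have fp: "f (p j) \<in> carrier (img R m Q)" if "j < n" for j by (rule module_homD(1)[OF f(1) p[OF that]])
  have gq: "g (q k) \<in> carrier (img R n P)" if "k < m" for k by (rule module_homD(1)[OF inv(1) q[OF that]])
  have c: "v i \<in> carrier R" if "v \<in> carrier (img R r A)" "i < r" for v r A i
    using that PiE_lt[of v r "carrier R" i] by (simp add: img_simps)
  have x: "x i k \<in> carrier R" if "i < n" "k < m" for i k
    unfolding x_def by (rule c[OF gq[OF that(2)] that(1)])
  have y: "y l j \<in> carrier R" if "l < m" "j < n" for l j
    unfolding y_def by (rule c[OF fp[OF that(2)] that(1)])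
  have swap: "Q l r \<otimes> x i k = Q l k \<otimes> x i r" if "l < m" "r < m" "k < m" "i < n" for l r k i
  proof -
    have "Q l r \<odot>\<^bsub>img R m Q\<^esub> q k = Q l k \<odot>\<^bsub>img R m Q\<^esub> q r"
    proof -
      have eq: "Q l r \<otimes> Q i k = Q l k \<otimes> Q i r" if "i < m" for i
        by (rule Q'(2)) (fact \<open>l < m\<close> \<open>r < m\<close> \<open>k < m\<close> that)+
      show ?thesis
        unfolding img_simps q_def by (intro restrict_ext) (simp add: eq)
    qed
    then have "Q l r \<odot>\<^bsub>img R n P\<^esub> g (q k) = Q l k \<odot>\<^bsub>img R n P\<^esub> g (q r)"
      using module_homD(3)[OF inv(1)] Q'(1) q that by metis
    from fun_cong[OF this, of i] show ?thesis using that by (simp add: img_simps(4) x_def)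
  qed
  have yx: "(\<Oplus>r\<in>{..<m}. y r j \<otimes> x i r) = P i j" if ij: "i < n" "j < n" for i j
  proof -
    have v: "f (p j) \<in> carrier (img R m Q)" by (rule fp[OF ij(2)])
    obtain e l where fr: "frame R (img R m Q) m e l" and le: "\<forall>i<m. \<forall>j<m. l i (e j) = Q i j"
      using img_represents[OF rank_one_idempotent[OF Q]] unfolding represents_def by blast
    have yq: "y r j \<odot>\<^bsub>img R m Q\<^esub> q r \<in> carrier (img R m Q)" if "r < m" for r using y q ij that by auto
    have yg: "y r j \<odot>\<^bsub>img R n P\<^esub> g (q r) \<in> carrier (img R n P)" if "r < m" for r using y gq ij that by auto
    have "f (p j) = (\<Oplus>\<^bsub>img R m Q\<^esub>r\<in>{..<m}. y r j \<odot>\<^bsub>img R m Q\<^esub> q r)"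
    proof (rule PiE_eqI)
      show "f (p j) \<in> {..<m} \<rightarrow>\<^sub>E carrier R" using v by (simp add: img_simps)
      have "(\<Oplus>\<^bsub>img R m Q\<^esub>r\<in>{..<m}. y r j \<odot>\<^bsub>img R m Q\<^esub> q r) \<in> carrier (img R m Q)"
        using yq by (intro MQ.M.finsum_closed) auto
      then show "(\<Oplus>\<^bsub>img R m Q\<^esub>r\<in>{..<m}. y r j \<odot>\<^bsub>img R m Q\<^esub> q r) \<in> {..<m} \<rightarrow>\<^sub>E carrier R"
        by (simp add: img_simps)
      fix k assume k: "k < m"
      have "(\<Oplus>\<^bsub>img R m Q\<^esub>r\<in>{..<m}. y r j \<odot>\<^bsub>img R m Q\<^esub> q r) k = (\<Oplus>r\<in>{..<m}. (y r j \<odot>\<^bsub>img R m Q\<^esub> q r) k)"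
        by (rule finsum_in_free[OF MQ.M.abelian_group_axioms img_simps(2) _ finite_lessThan _ k])
           (use yq in \<open>auto simp: img_simps(1)\<close>)
      also have "\<dots> = (\<Oplus>r\<in>{..<m}. Q k r \<otimes> y r j)"
        using k y Q'(1,3) ij by (intro finsum_cong') (auto simp: img_simps(4) q_def m_comm)
      also have "\<dots> = f (p j) k" using v k by (simp add: img_simps y_def)
      finally show "f (p j) k = (\<Oplus>\<^bsub>img R m Q\<^esub>r\<in>{..<m}. y r j \<odot>\<^bsub>img R m Q\<^esub> q r) k" ..
    qed
    then have "p j = g (\<Oplus>\<^bsub>img R m Q\<^esub>r\<in>{..<m}. y r j \<odot>\<^bsub>img R m Q\<^esub> q r)"
      using inv(3)[OF p[OF ij(2)]] by simp
    also have "\<dots> = (\<Oplus>\<^bsub>img R n P\<^esub>r\<in>{..<m}. g (y r j \<odot>\<^bsub>img R m Q\<^esub> q r))"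
      by (rule finsum_additive[OF MQ.M.abelian_group_axioms MP.M.abelian_group_axioms])
         (use module_homD[OF inv(1)] yq in auto)
    also have "\<dots> = (\<Oplus>\<^bsub>img R n P\<^esub>r\<in>{..<m}. y r j \<odot>\<^bsub>img R n P\<^esub> g (q r))"
      using module_homD(3)[OF inv(1)] y q yg ij by (intro MP.M.finsum_cong') auto
    finally have "p j i = (\<Oplus>\<^bsub>img R n P\<^esub>r\<in>{..<m}. y r j \<odot>\<^bsub>img R n P\<^esub> g (q r)) i" by simp
    also have "\<dots> = (\<Oplus>r\<in>{..<m}. (y r j \<odot>\<^bsub>img R n P\<^esub> g (q r)) i)"
      by (rule finsum_in_free[OF MP.M.abelian_group_axioms img_simps(2) _ finite_lessThan _ ij(1)])
         (use yg in \<open>auto simp: img_simps(1)\<close>)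
    also have "\<dots> = (\<Oplus>r\<in>{..<m}. y r j \<otimes> x i r)"
      using ij y x by (intro finsum_cong') (auto simp: img_simps(4) x_def)
    finally show ?thesis using ij by (simp add: p_def)
  qed
  have "x i k \<otimes> y l j = P i j \<otimes> Q l k" if h: "i < n" "k < m" "l < m" "j < n" for i k l j
  proof -
    have "y l j = (\<Oplus>r\<in>{..<m}. Q l r \<otimes> y r j)"
      using fp[OF h(4)] h by (simp add: img_simps y_def)
    then have "x i k \<otimes> y l j = (\<Oplus>r\<in>{..<m}. x i k \<otimes> (Q l r \<otimes> y r j))"
      using h x y Q'(1,3) by (simp add: finsum_rdistr Pi_def)
    also have "\<dots> = (\<Oplus>r\<in>{..<m}. Q l k \<otimes> (y r j \<otimes> x i r))"
    proof (rule finsum_cong')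
      fix r assume "r \<in> {..<m}"
      then have r: "r < m" by simp
      have "x i k \<otimes> (Q l r \<otimes> y r j) = (Q l r \<otimes> x i k) \<otimes> y r j" using h r x y Q'(1,3) by (simp add: m_ac)
      also have "\<dots> = Q l k \<otimes> (y r j \<otimes> x i r)" using h r x y Q'(1,3) by (simp add: swap m_ac)
      finally show "x i k \<otimes> (Q l r \<otimes> y r j) = Q l k \<otimes> (y r j \<otimes> x i r)" .
    qed (use h x y Q'(1,3) in auto)
    also have "\<dots> = Q l k \<otimes> (\<Oplus>r\<in>{..<m}. y r j \<otimes> x i r)"
      using h x y Q'(1,3) by (intro finsum_rdistr[symmetric]) auto
    finally show ?thesis using yx h P'(1,3) Q'(1,3) by (simp add: m_comm)
  qed
  then show ?thesis using x y by blast
qed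

end

section \<open>Base change and Kronecker products\<close>

definition kronecker :: "('a, 'r) ring_scheme \<Rightarrow> nat \<Rightarrow> (nat \<Rightarrow> nat \<Rightarrow> 'a) \<Rightarrow> (nat \<Rightarrow> nat \<Rightarrow> 'a) \<Rightarrow> nat \<Rightarrow> nat \<Rightarrow> 'a" where
  "kronecker R m P Q i j = P (i div m) (j div m) \<otimes>\<^bsub>R\<^esub> Q (i mod m) (j mod m)"

lemma ring_as_module_simps:
  "carrier (ring_as_module S \<phi>) = carrier S" "(\<oplus>\<^bsub>ring_as_module S \<phi>\<^esub>) = (\<oplus>\<^bsub>S\<^esub>)"
  "\<zero>\<^bsub>ring_as_module S \<phi>\<^esub> = \<zero>\<^bsub>S\<^esub>" "(\<odot>\<^bsub>ring_as_module S (\<lambda>x. x)\<^esub>) = (\<otimes>\<^bsub>S\<^esub>)"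
  "a \<odot>\<^bsub>ring_as_module S \<phi>\<^esub> s = \<phi> a \<otimes>\<^bsub>S\<^esub> s"
  by (simp_all add: ring_as_module_def)

lemma ring_as_module_module:
  assumes R: "cring R" and S: "cring S" and \<phi>: "\<phi> \<in> ring_hom R S"
  shows "module R (ring_as_module S \<phi>)"
proof -
  interpret S: cring S by fact
  interpret R: cring R by fact
  have c: "\<phi> a \<in> carrier S" if "a \<in> carrier R" for a by (rule ring_hom_closed[OF \<phi> that])
  show ?thesis
  proof (rule moduleI)
    show "abelian_group (ring_as_module S \<phi>)"
      by (rule abelian_groupI) (auto simp: ring_as_module_simps S.a_assoc intro: S.a_comm S.l_neg)
  qed (simp_all add: R ring_as_module_simps c S.l_distr S.r_distr S.m_assoc ring_hom_add[OF \<phi>] ring_hom_mult[OF \<phi>] ring_hom_one[OF \<phi>])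
qed

text \<open>Apply the dual basis of the tensor product to \<open>S\<close> with the basis 1.\<close>

lemma represents_extend:
  assumes R: "cring R" and S: "cring S" and \<phi>: "\<phi> \<in> ring_hom R S" and r: "represents R M n P"
  shows "represents S (extend_scalars R S \<phi> M) n (\<lambda>i j. \<phi> (P i j))"
proof -
  obtain e l where f: "frame R M n e l" and P: "\<forall>i<n. \<forall>j<n. l i (e j) = P i j"
    using r unfolding represents_def by blast
  interpret S: cring S by fact
  interpret f: frame R M n e l by fact
  let ?N = "ring_as_module S \<phi>" and ?N' = "ring_as_module S (\<lambda>x. x)"
  have id: "(\<lambda>x. x) \<in> ring_hom S S" by (rule ring_hom_memI) auto
  interpret N: module R ?N by (rule ring_as_module_module[OF R S \<phi>])
  interpret N': module S ?N' by (rule ring_as_module_module[OF S S id])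
  have c: "\<phi> a \<in> carrier S" if "a \<in> carrier R" for a by (rule ring_hom_closed[OF \<phi> that])
  interpret t: tensor_frame R M n e l ?N S ?N' 1 "\<lambda>_. \<one>\<^bsub>S\<^esub>" "\<lambda>_ x. x"
  proof
    fix x assume x: "x \<in> carrier ?N'"
    have "(\<Oplus>\<^bsub>?N'\<^esub>i\<in>{..<1::nat}. x \<odot>\<^bsub>?N'\<^esub> \<one>\<^bsub>S\<^esub>) = x \<odot>\<^bsub>?N'\<^esub> \<one>\<^bsub>S\<^esub>"
      using x by (simp add: lessThan_Suc ring_as_module_simps)
    then show "x = (\<Oplus>\<^bsub>?N'\<^esub>i\<in>{..<1::nat}. x \<odot>\<^bsub>?N'\<^esub> \<one>\<^bsub>S\<^esub>)"
      using x by (simp add: ring_as_module_simps)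
  qed (use c in \<open>simp_all add: ring_as_module_simps S.m_lcomm\<close>)
  have T: "t.T = extend_scalars R S \<phi> M"
    unfolding t.T_def extend_scalars_def Let_def by (simp add: ring_as_module_simps)
  have "frame S (extend_scalars R S \<phi> M) n t.basis t.coords"
    using t.frame_T unfolding T by simp
  moreover have "t.coords i (t.basis j) = \<phi> (P i j)" if "i < n" "j < n" for i j
  proof -
    have "P i j \<in> carrier R" using f.l[OF that(1) f.e[OF that(2)]] P that by simp
    then show ?thesis using t.coords_basis[of i j] that P c by (simp add: ring_as_module_simps)
  qed
  ultimately show ?thesis unfolding represents_def by blast
qed

lemma represents_tensor:
  assumes M: "represents R M n P" and N: "represents R N m Q"
  shows "represents R (tensor_product R M N) (n * m) (kronecker R m P Q)"
proof -
  obtain e l where f: "frame R M n e l" and P: "\<forall>i<n. \<forall>j<n. l i (e j) = P i j"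
    using M unfolding represents_def by blast
  obtain e' l' where f': "frame R N m e' l'" and Q: "\<forall>i<m. \<forall>j<m. l' i (e' j) = Q i j"
    using N unfolding represents_def by blast
  interpret f: frame R M n e l by fact
  interpret f': frame R N m e' l' by fact
  interpret t: tensor_frame R M n e l N R N m e' l'
  proof
    fix s a y assume "s \<in> carrier R" "a \<in> carrier R" "y \<in> carrier N"
    then show "s \<odot>\<^bsub>N\<^esub> (a \<odot>\<^bsub>N\<^esub> y) = a \<odot>\<^bsub>N\<^esub> (s \<odot>\<^bsub>N\<^esub> y)"
      using f'.M.smult_assoc1[of s a y] f'.M.smult_assoc1[of a s y] f.M.R.m_comm[of s a] by simp
  qed simp_all
  have T: "t.T = tensor_product R M N"
    unfolding t.T_def tensor_product_def by simp
  have "t.coords i (t.basis j) = kronecker R m P Q i j" if ij: "i < n * m" "j < n * m" for i j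
  proof -
    note i = t.index[OF ij(1)] and j = t.index[OF ij(2)]
    have "l (i div m) (e (j div m)) \<in> carrier R" by (rule f.l) (use i j f.e in auto)
    then show ?thesis
      using t.coords_basis[OF ij] i j P Q f'.e by (simp add: kronecker_def f'.l_smult)
  qed
  then show ?thesis
    using t.frame_T unfolding T represents_def by blast
qed

context cring
begin

lemma rank_one_kronecker:
  assumes P: "rank_one_matrix R n P" and Q: "rank_one_matrix R m Q"
  shows "rank_one_matrix R (n * m) (kronecker R m P Q)"
proof -
  note P' = rank_one_matrixD[OF P] and Q' = rank_one_matrixD[OF Q]
  have ix: "k div m < n \<and> k mod m < m" if "k < n * m" for k
    using that by (cases "m = 0") (auto simp: less_mult_imp_div_less)
  show ?thesis
    unfolding rank_one_matrix_def
  proof (intro conjI allI impI)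
    show "kronecker R m P Q i j \<in> carrier R" if "i < n * m" "j < n * m" for i j
      using ix[OF that(1)] ix[OF that(2)] P'(1) Q'(1) by (simp add: kronecker_def)
    fix i j k l assume ijkl: "i < n * m" "j < n * m" "k < n * m" "l < n * m"
    note ix' = ix[OF ijkl(1)] ix[OF ijkl(2)] ix[OF ijkl(3)] ix[OF ijkl(4)]
    have 4: "(a \<otimes> b) \<otimes> (c \<otimes> d) = (a \<otimes> c) \<otimes> (b \<otimes> d)"
      if "a \<in> carrier R" "b \<in> carrier R" "c \<in> carrier R" "d \<in> carrier R" for a b c d
      using that by (simp add: m_ac)
    have PP: "P (i div m) (j div m) \<otimes> P (k div m) (l div m) = P (i div m) (l div m) \<otimes> P (k div m) (j div m)"
      by (rule P'(2)) (use ix' in auto)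
    have QQ: "Q (i mod m) (j mod m) \<otimes> Q (k mod m) (l mod m) = Q (i mod m) (l mod m) \<otimes> Q (k mod m) (j mod m)"
      by (rule Q'(2)) (use ix' in auto)
    show "kronecker R m P Q i j \<otimes> kronecker R m P Q k l = kronecker R m P Q i l \<otimes> kronecker R m P Q k j"
      unfolding kronecker_def using ix' P'(1) Q'(1) by (subst (1 2) 4) (simp_all add: PP QQ)
  next
    define p where "p i = free_gen (P i i)" for i
    define q where "q i = free_gen (Q i i)" for i
    have p: "free_eval R (p i) = P i i" if "i < n" for i using P'(1) that by (simp add: p_def free_eval_gen)
    have q: "free_eval R (q i) = Q i i" if "i < m" for i using Q'(1) that by (simp add: q_def free_eval_gen)
    have "(\<Oplus>k\<in>{..<n * m}. kronecker R m P Q k k) = (\<Oplus>k\<in>{..<n * m}. free_eval R (p (k div m) * q (k mod m)))"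
      using ix p q P'(1) Q'(1) by (intro finsum_cong') (auto simp: kronecker_def free_eval_mult)
    also have "\<dots> = free_eval R (\<Sum>k<n * m. p (k div m) * q (k mod m))"
      by (simp add: free_eval_sum)
    also have "(\<Sum>k<n * m. p (k div m) * q (k mod m)) = (\<Sum>a<n. p a) * (\<Sum>b<m. q b)"
      by (simp add: sum_div_mod[where f = "\<lambda>a b. p a * q b"] sum_product)
    also have "free_eval R \<dots> = (\<Oplus>a\<in>{..<n}. free_eval R (p a)) \<otimes> (\<Oplus>b\<in>{..<m}. free_eval R (q b))"
      by (simp add: free_eval_mult free_eval_sum)
    also have "(\<Oplus>a\<in>{..<n}. free_eval R (p a)) = (\<Oplus>a\<in>{..<n}. P a a)"
      using p P'(1) by (intro finsum_cong') auto
    also have "(\<Oplus>b\<in>{..<m}. free_eval R (q b)) = (\<Oplus>b\<in>{..<m}. Q b b)"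
      using q Q'(1) by (intro finsum_cong') auto
    finally show "(\<Oplus>k\<in>{..<n * m}. kronecker R m P Q k k) = \<one>"
      using P'(3) Q'(3) by simp
  qed
qed

lemma rank_one_map:
  assumes S: "cring S" and \<phi>: "\<phi> \<in> ring_hom R S" and P: "rank_one_matrix R n P"
  shows "rank_one_matrix S n (\<lambda>i j. \<phi> (P i j))"
proof -
  interpret S: cring S by fact
  note P' = rank_one_matrixD[OF P]
  show ?thesis
    unfolding rank_one_matrix_def
  proof (intro conjI allI impI)
    show "\<phi> (P i j) \<in> carrier S" if "i < n" "j < n" for i j
      by (rule ring_hom_closed[OF \<phi> P'(1)[OF that]])
    show "\<phi> (P i j) \<otimes>\<^bsub>S\<^esub> \<phi> (P k l) = \<phi> (P i l) \<otimes>\<^bsub>S\<^esub> \<phi> (P k j)" if "i < n" "j < n" "k < n" "l < n" for i j k l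
      using P'(1) P'(2)[OF that] that by (simp flip: ring_hom_mult[OF \<phi>])
    have "\<phi> (\<Oplus>i\<in>{..<n}. P i i) = (\<Oplus>\<^bsub>S\<^esub>i\<in>{..<n}. \<phi> (P i i))"
      by (rule finsum_additive[OF abelian_group_axioms S.abelian_group_axioms])
         (use P'(1) ring_hom_closed[OF \<phi>] ring_hom_add[OF \<phi>] in auto)
    then show "(\<Oplus>\<^bsub>S\<^esub>i\<in>{..<n}. \<phi> (P i i)) = \<one>\<^bsub>S\<^esub>"
      using P'(3) ring_hom_one[OF \<phi>] by simp
  qed
qed

lemma free_one: "free_module R 1 = img R 1 (\<lambda>_ _. \<one>)"
proof -
  have "{..<1} \<rightarrow>\<^sub>E carrier R = {v \<in> {..<1} \<rightarrow>\<^sub>E carrier R. \<forall>i<1. v i = (\<Oplus>j\<in>{..<1::nat}. \<one> \<otimes> v j)}"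
    by (auto simp: lessThan_Suc PiE_def Pi_def)
  then show ?thesis by (simp add: img_def) (simp add: free_module_def)
qed

lemma rank_one_unit: "rank_one_matrix R 1 (\<lambda>_ _. \<one>)"
  by (simp add: rank_one_matrix_def lessThan_Suc)

text \<open>The column through the invertible diagonal entry generates the image.\<close>

lemma free_of_unit_entry:
  assumes P: "rank_one_matrix R n P" and i: "i < n" and u: "u \<in> carrier R" "P i i \<otimes> u = \<one>"
  shows "module_isomorphic R (img R n P) (free_module R 1)"
proof -
  note P' = rank_one_matrixD[OF P]
  have "represents R (img R n P) 1 (\<lambda>_ _. \<one>)"
  proof (rule represents_of_factorization[OF P rank_one_unit, where x = "\<lambda>a _. P a i" and y = "\<lambda>_ b. P i b \<otimes> u"])
    fix a b assume ab: "a < n" "b < n"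
    have "P a i \<otimes> (P i b \<otimes> u) = (P a i \<otimes> P i b) \<otimes> u" using ab i u P'(1) by (simp add: m_assoc)
    also have "P a i \<otimes> P i b = P a b \<otimes> P i i" by (rule P'(2)) (use ab i in auto)
    also have "P a b \<otimes> P i i \<otimes> u = P a b \<otimes> \<one>" using ab i u P'(1) by (simp add: m_assoc)
    finally show "P a i \<otimes> (P i b \<otimes> u) = P a b \<otimes> \<one>" .
  qed (use P'(1) i u in auto)
  then show ?thesis using represents_iso by (simp only: free_one)
qed

text \<open>An isomorphism with the free module of rank one writes \<open>P\<close> as a column times a row whose product in the other order is 1;
  then the minors vanish and the trace is that product.\<close>

lemma rank_one_of_free:
  assumes P: "idempotent_matrix R n P" and iso: "module_isomorphic R (img R n P) (free_module R 1)"
  shows "rank_one_matrix R n P"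
proof -
  obtain e l where fr: "frame R (img R n P) n e l" and le: "\<forall>i<n. \<forall>j<n. l i (e j) = P i j"
    using img_represents[OF P] unfolding represents_def by blast
  interpret fr: frame R "img R n P" n e l by fact
  obtain f where f: "f \<in> module_hom R (img R n P) (free_module R 1)"
    "bij_betw f (carrier (img R n P)) (carrier (free_module R 1))"
    using iso unfolding module_isomorphic_def by blast
  define g where "g = inv_into (carrier (img R n P)) f"
  note inv = module_iso_inverse[OF fr.M.module_axioms f, folded g_def]
  define d where "d = (\<lambda>_\<in>{..<1::nat}. \<one>)"
  have d: "d \<in> carrier (free_module R 1)" by (auto simp: d_def free_simps)
  have gd: "g d \<in> carrier (img R n P)" by (rule module_homD(1)[OF inv(1) d])
  have c0: "v 0 \<in> carrier R" if "v \<in> carrier (free_module R 1)" for v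
    using PiE_lt[of v 1 "carrier R" 0] that by (simp add: free_simps)
  define lam where "lam v = f v 0" for v
  have lamc: "lam v \<in> carrier R" if "v \<in> carrier (img R n P)" for v
    unfolding lam_def by (rule c0[OF module_homD(1)[OF f(1) that]])
  have rep: "v = lam v \<odot>\<^bsub>img R n P\<^esub> g d" if v: "v \<in> carrier (img R n P)" for v
  proof -
    have fv: "f v \<in> carrier (free_module R 1)" by (rule module_homD(1)[OF f(1) v])
    have "f v = lam v \<odot>\<^bsub>free_module R 1\<^esub> d"
    proof (rule PiE_eqI[of _ 1 "carrier R" _ "carrier R"])
      show "f v \<in> {..<1} \<rightarrow>\<^sub>E carrier R" using fv by (simp add: free_simps)
      show "lam v \<odot>\<^bsub>free_module R 1\<^esub> d \<in> {..<1} \<rightarrow>\<^sub>E carrier R"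
        using lamc[OF v] by (auto simp: free_simps d_def)
      show "f v i = (lam v \<odot>\<^bsub>free_module R 1\<^esub> d) i" if "i < 1" for i
        using lamc[OF v] that by (simp add: free_simps d_def lam_def)
    qed
    then show ?thesis
      using inv(3)[OF v] module_homD(3)[OF inv(1) lamc[OF v] d] by simp
  qed
  define x where "x i = l i (g d)" for i
  define y where "y j = lam (e j)" for j
  have x: "x i \<in> carrier R" if "i < n" for i unfolding x_def by (rule fr.l[OF that gd])
  have y: "y j \<in> carrier R" if "j < n" for j unfolding y_def by (rule lamc[OF fr.e[OF that]])
  have Pxy: "P i j = y j \<otimes> x i" if ij: "i < n" "j < n" for i j
  proof -
    have "P i j = l i (lam (e j) \<odot>\<^bsub>img R n P\<^esub> g d)"
      using rep[OF fr.e[OF ij(2)]] le ij by simp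
    then show ?thesis using fr.l_smult[OF ij(1) lamc[OF fr.e[OF ij(2)]] gd] by (simp add: x_def y_def)
  qed
  have "lam (g d) = \<one>" using inv(4)[OF d] by (simp add: lam_def d_def)
  moreover have "lam (g d) = (\<Oplus>i\<in>{..<n}. x i \<otimes> y i)"
  proof -
    have "lam (g d) = lam (\<Oplus>\<^bsub>img R n P\<^esub>i\<in>{..<n}. l i (g d) \<odot>\<^bsub>img R n P\<^esub> e i)"
      using fr.expand[OF gd] by simp
    also have "\<dots> = (\<Oplus>i\<in>{..<n}. lam (l i (g d) \<odot>\<^bsub>img R n P\<^esub> e i))"
    proof (rule finsum_additive[OF fr.M.M.abelian_group_axioms abelian_group_axioms])
      show "lam (v \<oplus>\<^bsub>img R n P\<^esub> w) = lam v \<oplus> lam w"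
        if "v \<in> carrier (img R n P)" "w \<in> carrier (img R n P)" for v w
        unfolding lam_def module_homD(2)[OF f(1) that] by (simp add: free_simps)
    qed (use lamc fr.l[OF _ gd] fr.e in auto)
    also have "\<dots> = (\<Oplus>i\<in>{..<n}. x i \<otimes> y i)"
    proof (rule finsum_cong')
      fix i assume "i \<in> {..<n}"
      then have i: "i < n" by simp
      show "lam (l i (g d) \<odot>\<^bsub>img R n P\<^esub> e i) = x i \<otimes> y i"
        unfolding lam_def module_homD(3)[OF f(1) fr.l[OF i gd] fr.e[OF i]]
        by (simp add: free_simps x_def y_def lam_def)
    qed (use x y in auto)
    finally show ?thesis .
  qed
  ultimately have tr: "(\<Oplus>i\<in>{..<n}. x i \<otimes> y i) = \<one>" by simp
  show ?thesis
    unfolding rank_one_matrix_def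
  proof (intro conjI allI impI)
    show "P i j \<in> carrier R" if "i < n" "j < n" for i j using Pxy that x y by simp
    show "P i j \<otimes> P k q = P i q \<otimes> P k j" if "i < n" "j < n" "k < n" "q < n" for i j k q
      using that x y by (simp add: Pxy m_ac)
    have "(\<Oplus>i\<in>{..<n}. P i i) = (\<Oplus>i\<in>{..<n}. x i \<otimes> y i)"
      using x y by (intro finsum_cong') (auto simp: Pxy m_comm)
    then show "(\<Oplus>i\<in>{..<n}. P i i) = \<one>" using tr by simp
  qed
qed

end

section \<open>Localization and constant rank\<close>

lemma UN_eq_const: "A \<noteq> {} \<Longrightarrow> (\<And>x. x \<in> A \<Longrightarrow> f x = c) \<Longrightarrow> (\<Union>x\<in>A. f x) = c"
  by auto

lemma UN_pair_constant:
  assumes "A \<noteq> {}" "B \<noteq> {}" and eq: "\<And>a s b t. (a, s) \<in> A \<Longrightarrow> (b, t) \<in> B \<Longrightarrow> f a s b t = c"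
  shows "(\<Union>(a, s)\<in>A. \<Union>(b, t)\<in>B. f a s b t) = c"
proof (rule UN_eq_const[OF assms(1)])
  fix z assume z: "z \<in> A"
  obtain a s where as: "z = (a, s)" by (cases z)
  have "(\<Union>(b, t)\<in>B. f a s b t) = c"
  proof (rule UN_eq_const[OF assms(2)])
    fix w assume "w \<in> B"
    then show "(case w of (b, t) \<Rightarrow> f a s b t) = c" using eq z as by (cases w) simp
  qed
  then show "(case z of (a, s) \<Rightarrow> \<Union>(b, t)\<in>B. f a s b t) = c" by (simp add: as)
qed

locale mult_set = cring R for R :: "('a, 'r) ring_scheme" (structure) +
  fixes S :: "'a set"
  assumes S_carrier: "S \<subseteq> carrier R" and S_one: "\<one> \<in> S" and S_mult: "s \<in> S \<Longrightarrow> t \<in> S \<Longrightarrow> s \<otimes> t \<in> S"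
begin

abbreviation "L \<equiv> localization R S"
abbreviation "fr \<equiv> fraction R S"

lemma S_c [simp]: "s \<in> S \<Longrightarrow> s \<in> carrier R"
  using S_carrier by blast

lemma fr_mem: "(b, t) \<in> fr a s \<longleftrightarrow> a \<in> carrier R \<and> s \<in> S \<and> b \<in> carrier R \<and> t \<in> S \<and>
    (\<exists>u\<in>S. u \<otimes> (a \<otimes> t) = u \<otimes> (b \<otimes> s))"
  by (simp add: fraction_def fraction_rel_def)

lemma fr_self: "a \<in> carrier R \<Longrightarrow> s \<in> S \<Longrightarrow> (a, s) \<in> fr a s"
  unfolding fr_mem using S_one by blast

lemma fr_subset:
  assumes "a \<in> carrier R" "s \<in> S" "b \<in> carrier R" "t \<in> S" "u \<in> S" "u \<otimes> (a \<otimes> t) = u \<otimes> (b \<otimes> s)"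
  shows "fr b t \<subseteq> fr a s"
proof
  fix z assume "z \<in> fr b t"
  then obtain c r v where z: "z = (c, r)" and c: "c \<in> carrier R" "r \<in> S" and v: "v \<in> S" "v \<otimes> (b \<otimes> r) = v \<otimes> (c \<otimes> t)"
    by (cases z) (auto simp: fr_mem)
  have "(u \<otimes> v \<otimes> t) \<otimes> (a \<otimes> r) = (u \<otimes> (a \<otimes> t)) \<otimes> (v \<otimes> r)"
    using assms(1-5) c v(1) by (simp add: m_ac)
  also have "\<dots> = (u \<otimes> s) \<otimes> (v \<otimes> (b \<otimes> r))"
    unfolding assms(6) using assms(1-5) c v(1) by (simp add: m_ac)
  also have "\<dots> = (u \<otimes> v \<otimes> t) \<otimes> (c \<otimes> s)"
    unfolding v(2) using assms(1-5) c v(1) by (simp add: m_ac)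
  finally show "z \<in> fr a s"
    unfolding z fr_mem using assms c v(1) S_mult by blast
qed

lemma fr_eq:
  assumes "a \<in> carrier R" "s \<in> S" "b \<in> carrier R" "t \<in> S"
  shows "fr a s = fr b t \<longleftrightarrow> (\<exists>u\<in>S. u \<otimes> (a \<otimes> t) = u \<otimes> (b \<otimes> s))"
proof
  assume "fr a s = fr b t"
  then have "(b, t) \<in> fr a s" using fr_self assms by simp
  then show "\<exists>u\<in>S. u \<otimes> (a \<otimes> t) = u \<otimes> (b \<otimes> s)" by (simp add: fr_mem)
next
  assume "\<exists>u\<in>S. u \<otimes> (a \<otimes> t) = u \<otimes> (b \<otimes> s)"
  then obtain u where u: "u \<in> S" "u \<otimes> (a \<otimes> t) = u \<otimes> (b \<otimes> s)" by blast
  show "fr a s = fr b t"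
    using fr_subset[OF assms u] fr_subset[OF assms(3,4,1,2) u(1) u(2)[symmetric]] by (rule equalityI[rotated])
qed

lemma fr_eqI:
  assumes "a \<in> carrier R" "s \<in> S" "b \<in> carrier R" "t \<in> S" "a \<otimes> t = b \<otimes> s"
  shows "fr a s = fr b t"
  using fr_eq[OF assms(1-4)] assms(5) S_one by auto

lemma carrier_L: "x \<in> carrier L \<longleftrightarrow> (\<exists>a s. a \<in> carrier R \<and> s \<in> S \<and> x = fr a s)"
  by (auto simp: localization_def quotient_def fraction_def)

lemma L_cases:
  assumes "x \<in> carrier L" obtains a s where "a \<in> carrier R" "s \<in> S" "x = fr a s"
  using assms carrier_L by blast

lemma fr_closed [simp]: "a \<in> carrier R \<Longrightarrow> s \<in> S \<Longrightarrow> fr a s \<in> carrier L"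
  using carrier_L by blast

lemma fr_mult:
  assumes as: "a \<in> carrier R" "s \<in> S" and bt: "b \<in> carrier R" "t \<in> S"
  shows "fr a s \<otimes>\<^bsub>L\<^esub> fr b t = fr (a \<otimes> b) (s \<otimes> t)"
proof -
  have "fr (a' \<otimes> b') (s' \<otimes> t') = fr (a \<otimes> b) (s \<otimes> t)" if 1: "(a', s') \<in> fr a s" and 2: "(b', t') \<in> fr b t" for a' s' b' t'
  proof -
    obtain u where u: "u \<in> S" "u \<otimes> (a \<otimes> s') = u \<otimes> (a' \<otimes> s)" and c: "a' \<in> carrier R" "s' \<in> S"
      using 1 by (auto simp: fr_mem)
    obtain v where v: "v \<in> S" "v \<otimes> (b \<otimes> t') = v \<otimes> (b' \<otimes> t)" and d: "b' \<in> carrier R" "t' \<in> S"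
      using 2 by (auto simp: fr_mem)
    have "(u \<otimes> v) \<otimes> (a' \<otimes> b' \<otimes> (s \<otimes> t)) = (u \<otimes> (a' \<otimes> s)) \<otimes> (v \<otimes> (b' \<otimes> t))"
      using as bt c d u(1) v(1) by (simp add: m_ac)
    also have "\<dots> = (u \<otimes> v) \<otimes> (a \<otimes> b \<otimes> (s' \<otimes> t'))"
      unfolding u(2)[symmetric] v(2)[symmetric] using as bt c d u(1) v(1) by (simp add: m_ac)
    finally show ?thesis
      using as bt c d S_mult[OF u(1) v(1)] by (subst fr_eq) (auto simp: S_mult)
  qed
  then have "(\<Union>(a', s')\<in>fr a s. \<Union>(b', t')\<in>fr b t. fr (a' \<otimes> b') (s' \<otimes> t')) = fr (a \<otimes> b) (s \<otimes> t)"
    using fr_self[OF as] fr_self[OF bt] by (intro UN_pair_constant) blast+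
  then show ?thesis by (simp add: localization_def)
qed

lemma fr_add:
  assumes as: "a \<in> carrier R" "s \<in> S" and bt: "b \<in> carrier R" "t \<in> S"
  shows "fr a s \<oplus>\<^bsub>L\<^esub> fr b t = fr ((a \<otimes> t) \<oplus> (b \<otimes> s)) (s \<otimes> t)"
proof -
  have "fr ((a' \<otimes> t') \<oplus> (b' \<otimes> s')) (s' \<otimes> t') = fr ((a \<otimes> t) \<oplus> (b \<otimes> s)) (s \<otimes> t)"
    if 1: "(a', s') \<in> fr a s" and 2: "(b', t') \<in> fr b t" for a' s' b' t'
  proof -
    obtain u where u: "u \<in> S" "u \<otimes> (a \<otimes> s') = u \<otimes> (a' \<otimes> s)" and c: "a' \<in> carrier R" "s' \<in> S"
      using 1 by (auto simp: fr_mem)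
    obtain v where v: "v \<in> S" "v \<otimes> (b \<otimes> t') = v \<otimes> (b' \<otimes> t)" and d: "b' \<in> carrier R" "t' \<in> S"
      using 2 by (auto simp: fr_mem)
    have "(u \<otimes> v) \<otimes> (((a' \<otimes> t') \<oplus> (b' \<otimes> s')) \<otimes> (s \<otimes> t))
        = (u \<otimes> (a' \<otimes> s)) \<otimes> (v \<otimes> t \<otimes> t') \<oplus> (v \<otimes> (b' \<otimes> t)) \<otimes> (u \<otimes> s \<otimes> s')"
      using as bt c d u(1) v(1) by (simp add: m_ac l_distr r_distr)
    also have "\<dots> = (u \<otimes> v) \<otimes> (((a \<otimes> t) \<oplus> (b \<otimes> s)) \<otimes> (s' \<otimes> t'))"
      unfolding u(2)[symmetric] v(2)[symmetric] using as bt c d u(1) v(1) by (simp add: m_ac l_distr r_distr)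
    finally show ?thesis
      using as bt c d S_mult[OF u(1) v(1)] by (subst fr_eq) (auto simp: S_mult)
  qed
  then have "(\<Union>(a', s')\<in>fr a s. \<Union>(b', t')\<in>fr b t. fr ((a' \<otimes> t') \<oplus> (b' \<otimes> s')) (s' \<otimes> t')) = fr ((a \<otimes> t) \<oplus> (b \<otimes> s)) (s \<otimes> t)"
    using fr_self[OF as] fr_self[OF bt] by (intro UN_pair_constant) blast+
  then show ?thesis by (simp add: localization_def)
qed

lemma L_zero: "\<zero>\<^bsub>L\<^esub> = fr \<zero> \<one>" and L_one: "\<one>\<^bsub>L\<^esub> = fr \<one> \<one>"
  by (simp_all add: localization_def)

lemma L_cring: "cring L"
proof (rule cringI)
  show "abelian_group L"
  proof (rule abelian_groupI)
    fix x y assume "x \<in> carrier L" "y \<in> carrier L"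
    then obtain a s b t where x: "a \<in> carrier R" "s \<in> S" "x = fr a s" and y: "b \<in> carrier R" "t \<in> S" "y = fr b t"
      by (auto elim!: L_cases)
    show "x \<oplus>\<^bsub>L\<^esub> y \<in> carrier L" using x y by (simp add: fr_add S_mult)
    have "a \<otimes> t \<oplus> b \<otimes> s = b \<otimes> s \<oplus> a \<otimes> t" "s \<otimes> t = t \<otimes> s"
      using x y by (simp_all add: a_comm m_comm)
    then show "x \<oplus>\<^bsub>L\<^esub> y = y \<oplus>\<^bsub>L\<^esub> x" using x y by (simp add: fr_add)
    fix z assume "z \<in> carrier L"
    then obtain c r where z: "c \<in> carrier R" "r \<in> S" "z = fr c r" by (rule L_cases)
    have "(a \<otimes> t \<oplus> b \<otimes> s) \<otimes> r \<oplus> c \<otimes> (s \<otimes> t) = a \<otimes> (t \<otimes> r) \<oplus> (b \<otimes> r \<oplus> c \<otimes> t) \<otimes> s"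
      using x y z by (simp add: l_distr r_distr m_ac a_ac)
    moreover have "s \<otimes> t \<otimes> r = s \<otimes> (t \<otimes> r)" using x y z by (simp add: m_assoc)
    ultimately show "x \<oplus>\<^bsub>L\<^esub> y \<oplus>\<^bsub>L\<^esub> z = x \<oplus>\<^bsub>L\<^esub> (y \<oplus>\<^bsub>L\<^esub> z)" using x y z by (simp add: fr_add S_mult)
  next
    fix x assume "x \<in> carrier L"
    then obtain a s where x: "a \<in> carrier R" "s \<in> S" "x = fr a s" by (rule L_cases)
    show "\<zero>\<^bsub>L\<^esub> \<oplus>\<^bsub>L\<^esub> x = x" using x S_one by (simp add: L_zero fr_add)
    have "fr (\<ominus> a) s \<oplus>\<^bsub>L\<^esub> x = fr (\<ominus> a \<otimes> s \<oplus> a \<otimes> s) (s \<otimes> s)" using x by (simp add: fr_add)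
    also have "\<dots> = fr \<zero> \<one>" using x S_one by (intro fr_eqI) (auto simp: S_mult l_minus l_neg)
    finally show "\<exists>y\<in>carrier L. y \<oplus>\<^bsub>L\<^esub> x = \<zero>\<^bsub>L\<^esub>" using x by (auto simp: L_zero intro!: bexI[of _ "fr (\<ominus> a) s"])
  qed (simp add: L_zero S_one)
  show "comm_monoid L"
  proof (rule comm_monoidI)
    fix x y assume "x \<in> carrier L" "y \<in> carrier L"
    then obtain a s b t where x: "a \<in> carrier R" "s \<in> S" "x = fr a s" and y: "b \<in> carrier R" "t \<in> S" "y = fr b t"
      by (auto elim!: L_cases)
    show "x \<otimes>\<^bsub>L\<^esub> y \<in> carrier L" using x y by (simp add: fr_mult S_mult)
    show "x \<otimes>\<^bsub>L\<^esub> y = y \<otimes>\<^bsub>L\<^esub> x" using x y by (simp add: fr_mult m_comm)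
    fix z assume "z \<in> carrier L"
    then obtain c r where z: "c \<in> carrier R" "r \<in> S" "z = fr c r" by (rule L_cases)
    show "x \<otimes>\<^bsub>L\<^esub> y \<otimes>\<^bsub>L\<^esub> z = x \<otimes>\<^bsub>L\<^esub> (y \<otimes>\<^bsub>L\<^esub> z)" using x y z by (simp add: fr_mult S_mult m_assoc)
  next
    fix x assume "x \<in> carrier L"
    then obtain a s where x: "a \<in> carrier R" "s \<in> S" "x = fr a s" by (rule L_cases)
    then show "\<one>\<^bsub>L\<^esub> \<otimes>\<^bsub>L\<^esub> x = x" using S_one by (simp add: L_one fr_mult)
  qed (simp add: L_one S_one)
  fix x y z assume "x \<in> carrier L" "y \<in> carrier L" "z \<in> carrier L"
  then obtain a s b t c r where x: "a \<in> carrier R" "s \<in> S" "x = fr a s" and y: "b \<in> carrier R" "t \<in> S" "y = fr b t"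
    and z: "c \<in> carrier R" "r \<in> S" "z = fr c r"
    by (auto elim!: L_cases)
  have "fr ((a \<otimes> t \<oplus> b \<otimes> s) \<otimes> c) (s \<otimes> t \<otimes> r) = fr (a \<otimes> c \<otimes> (t \<otimes> r) \<oplus> b \<otimes> c \<otimes> (s \<otimes> r)) (s \<otimes> r \<otimes> (t \<otimes> r))"
    using x y z by (intro fr_eqI) (auto simp: S_mult l_distr r_distr m_ac)
  then show "(x \<oplus>\<^bsub>L\<^esub> y) \<otimes>\<^bsub>L\<^esub> z = x \<otimes>\<^bsub>L\<^esub> z \<oplus>\<^bsub>L\<^esub> y \<otimes>\<^bsub>L\<^esub> z"
    using x y z by (simp add: fr_add fr_mult S_mult)
qed

lemma L_hom: "(\<lambda>a. fr a \<one>) \<in> ring_hom R L"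
  by (rule ring_hom_memI) (simp_all add: S_one fr_mult fr_add L_one)

lemma L_unit: "s \<in> S \<Longrightarrow> fr s \<one> \<otimes>\<^bsub>L\<^esub> fr \<one> s = \<one>\<^bsub>L\<^esub>"
  using S_one by (simp add: fr_mult L_one) (intro fr_eqI; simp)

end

context cring
begin

lemma prime_mult_set:
  assumes "primeideal p R" shows "mult_set R (carrier R - p)"
proof -
  interpret p: primeideal p R by fact
  show ?thesis
  proof
    show "\<one> \<in> carrier R - p" using p.I_notcarr p.one_imp_carrier by auto
    show "s \<otimes> t \<in> carrier R - p" if "s \<in> carrier R - p" "t \<in> carrier R - p" for s t
      using p.I_prime[of s t] that by auto
  qed auto
qed

text \<open>A maximal ideal above the annihilator of \<open>a\<close>, obtained in the free ring and mapped back to \<open>R\<close>.\<close>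

lemma prime_avoiding:
  assumes a: "a \<in> carrier R" "a \<noteq> \<zero>"
  obtains p where "primeideal p R" "\<And>u. u \<in> carrier R \<Longrightarrow> u \<otimes> a = \<zero> \<Longrightarrow> u \<in> p"
proof -
  define N where "N = {q. free_eval R q \<otimes> a = \<zero>}"
  have "cideal UNIV N"
    by standard (use a in \<open>auto simp: N_def free_eval_zero free_eval_add free_eval_mult l_distr m_assoc\<close>)
  moreover have "1 \<notin> N" using a by (simp add: N_def free_eval_one)
  ultimately obtain m where m: "cideal UNIV m" "N \<subseteq> m" "1 \<notin> m" "\<And>x. x \<notin> m \<Longrightarrow> \<exists>y. x * y - 1 \<in> m"
    by (rule exists_maximal_ideal) blast
  interpret m: cideal UNIV m by fact
  define p where "p = free_eval R ` m"
  have mem: "free_eval R q \<in> p \<longleftrightarrow> q \<in> m" for q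
  proof
    assume "free_eval R q \<in> p"
    then obtain r where r: "r \<in> m" "free_eval R q = free_eval R r" by (auto simp: p_def)
    then have "q - r \<in> m" using m(2) a by (auto simp: N_def free_eval_diff r_neg a_minus_def)
    then show "q \<in> m" using m.add_ideal[OF _ r(1), of "q - r"] by simp
  qed (simp add: p_def)
  have gen: "\<exists>q. x = free_eval R q" if "x \<in> carrier R" for x
    using free_eval_gen[OF that] by metis
  have "primeideal p R"
  proof (rule primeidealI)
    show "ideal p R"
    proof (rule idealI)
      show "subgroup p (add_monoid R)"
      proof (rule add.subgroupI)
        show "p \<subseteq> carrier R" by (auto simp: p_def)
        show "p \<noteq> {}" using m.zero_ideal by (auto simp: p_def)
        show "\<ominus> x \<in> p" if x: "x \<in> p" for x
        proof -
          obtain q where q: "q \<in> m" "x = free_eval R q" using x by (auto simp: p_def)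
          have "free_eval R (0 - q) = \<zero> \<ominus> free_eval R q" by (simp only: free_eval_diff free_eval_zero)
          then have "\<ominus> x = free_eval R (0 - q)" unfolding q(2) by (simp only:) (simp add: a_minus_def)
          then show ?thesis using m.minus_ideal[OF q(1)] mem by simp
        qed
        show "x \<oplus> y \<in> p" if "x \<in> p" "y \<in> p" for x y
          using that m.add_ideal by (auto simp: p_def simp flip: free_eval_add)
      qed
      show "y \<otimes> x \<in> p" if "x \<in> p" "y \<in> carrier R" for x y
        using that gen[OF that(2)] m.mult_ideal[OF UNIV_I] by (auto simp: p_def simp flip: free_eval_mult)
      show "x \<otimes> y \<in> p" if "x \<in> p" "y \<in> carrier R" for x y
        using that gen[OF that(2)] m.mult_ideal'[OF UNIV_I] by (auto simp: p_def simp flip: free_eval_mult)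
    qed unfold_locales
    show "carrier R \<noteq> p" using mem[of 1] m(3) by (auto simp: free_eval_one)
    fix x y assume "x \<in> carrier R" "y \<in> carrier R" and xy: "x \<otimes> y \<in> p"
    then obtain q r where qr: "x = free_eval R q" "y = free_eval R r" using gen by metis
    then have "q * r \<in> m" using xy mem[of "q * r"] by (simp add: free_eval_mult)
    show "x \<in> p \<or> y \<in> p"
    proof (rule disjCI)
      assume "y \<notin> p"
      then have "r \<notin> m" using mem qr by simp
      then obtain z where z: "r * z - 1 \<in> m" using m(4) by blast
      have "q = z * (q * r) - q * (r * z - 1)" by (simp add: algebra_simps)
      also have "\<dots> \<in> m" by (rule m.diff_ideal[OF m.mult_ideal[OF UNIV_I \<open>q * r \<in> m\<close>] m.mult_ideal[OF UNIV_I z]])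
      finally show "x \<in> p" using mem qr by simp
    qed
  qed unfold_locales
  moreover have "u \<in> p" if "u \<in> carrier R" "u \<otimes> a = \<zero>" for u
  proof -
    have "free_gen u \<in> N" using that by (simp add: N_def free_eval_gen)
    then show ?thesis using m(2) mem[of "free_gen u"] that by (auto simp: free_eval_gen)
  qed
  ultimately show thesis by (rule that)
qed

text \<open>If \<open>a \<noteq> b\<close>, a prime containing the annihilator of \<open>a - b\<close> keeps the two apart.\<close>

lemma eq_locally:
  assumes ab: "a \<in> carrier R" "b \<in> carrier R"
    and loc: "\<And>p. primeideal p R \<Longrightarrow> fraction R (carrier R - p) a \<one> = fraction R (carrier R - p) b \<one>"
  shows "a = b"
proof (rule ccontr)
  assume "a \<noteq> b"
  have "a \<ominus> b \<noteq> \<zero>"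
  proof
    assume z: "a \<ominus> b = \<zero>"
    have "a = (a \<ominus> b) \<oplus> b" using ab by (simp add: a_minus_def a_assoc l_neg)
    also have "\<dots> = b" unfolding z using ab by simp
    finally show False using \<open>a \<noteq> b\<close> by simp
  qed
  then obtain p where p: "primeideal p R" "\<And>u. u \<in> carrier R \<Longrightarrow> u \<otimes> (a \<ominus> b) = \<zero> \<Longrightarrow> u \<in> p"
    using prime_avoiding[of "a \<ominus> b"] ab by auto
  have killed: "u \<in> p" if u: "u \<in> carrier R" "u \<otimes> (a \<otimes> \<one>) = u \<otimes> (b \<otimes> \<one>)" for u
  proof (rule p(2)[OF u(1)])
    have "u \<otimes> (a \<ominus> b) = u \<otimes> a \<oplus> \<ominus> (u \<otimes> b)" using u(1) ab by (simp add: a_minus_def r_distr r_minus)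
    also have "u \<otimes> a = u \<otimes> b" using u(2) ab by simp
    also have "u \<otimes> b \<oplus> \<ominus> (u \<otimes> b) = \<zero>" using u(1) ab by (simp add: r_neg)
    finally show "u \<otimes> (a \<ominus> b) = \<zero>" .
  qed
  interpret mult_set R "carrier R - p" by (rule prime_mult_set[OF p(1)])
  obtain u where "u \<in> carrier R - p" "u \<otimes> (a \<otimes> \<one>) = u \<otimes> (b \<otimes> \<one>)"
    using loc[OF p(1)] fr_eq[OF ab(1) S_one ab(2) S_one] by blast
  then show False using killed by blast
qed

text \<open>The conditions on a rank one matrix are equations, so they hold if they hold at every prime, where the module is free of rank
  one. Conversely, as the trace is 1, at every prime some diagonal entry is invertible, and then the image is free.\<close>

theorem rank_one_projective_iff:
  "rank_one_projective R M \<longleftrightarrow> (\<exists>n P. represents R M n P \<and> rank_one_matrix R n P)"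
proof
  have R: "cring R" by unfold_locales
  assume "rank_one_projective R M"
  then obtain n P where r: "represents R M n P" and rk: "constant_rank R 1 M"
    unfolding rank_one_projective_def fg_projective_iff[OF R] by blast
  have Pc: "P i j \<in> carrier R" if "i < n" "j < n" for i j
    using represents_idempotent[OF r] that by (auto simp: idempotent_matrix_def)
  have local: "rank_one_matrix (localization R (carrier R - p)) n (\<lambda>i j. fraction R (carrier R - p) (P i j) \<one>)"
    if p: "primeideal p R" for p
  proof -
    interpret mult_set R "carrier R - p" by (rule prime_mult_set[OF p])
    interpret L: cring L by (rule L_cring)
    have r': "represents L (extend_scalars R L (\<lambda>a. fr a \<one>) M) n (\<lambda>i j. fr (P i j) \<one>)"
      by (rule represents_extend[OF R L_cring L_hom r])
    have "module_isomorphic L (extend_scalars R L (\<lambda>a. fr a \<one>) M) (free_module L 1)"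
      using rk p unfolding constant_rank_def Let_def by blast
    then have "module_isomorphic L (img L n (\<lambda>i j. fr (P i j) \<one>)) (free_module L 1)"
      using module_isomorphic_sym[OF represents_module[OF r'] represents_iso[OF r']] module_isomorphic_trans by blast
    then show ?thesis
      using L.rank_one_of_free[OF represents_idempotent[OF r']] by simp
  qed
  have "rank_one_matrix R n P"
    unfolding rank_one_matrix_def
  proof (intro conjI allI impI)
    show "P i j \<in> carrier R" if "i < n" "j < n" for i j by (rule Pc[OF that])
    show "P i j \<otimes> P k l = P i l \<otimes> P k j" if ijkl: "i < n" "j < n" "k < n" "l < n" for i j k l
    proof (rule eq_locally)
      fix p assume p: "primeideal p R"
      interpret mult_set R "carrier R - p" by (rule prime_mult_set[OF p])
      show "fr (P i j \<otimes> P k l) \<one> = fr (P i l \<otimes> P k j) \<one>"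
        using rank_one_matrixD(2)[OF local[OF p] ijkl] ijkl Pc by (simp add: ring_hom_mult[OF L_hom])
    qed (use Pc ijkl in auto)
    show "(\<Oplus>i\<in>{..<n}. P i i) = \<one>"
    proof (rule eq_locally)
      fix p assume p: "primeideal p R"
      interpret mult_set R "carrier R - p" by (rule prime_mult_set[OF p])
      interpret L: cring L by (rule L_cring)
      have "fr (\<Oplus>i\<in>{..<n}. P i i) \<one> = (\<Oplus>\<^bsub>L\<^esub>i\<in>{..<n}. fr (P i i) \<one>)"
        by (rule finsum_additive[OF abelian_group_axioms L.abelian_group_axioms, where f = "\<lambda>a. fr a \<one>"])
           (use Pc ring_hom_closed[OF L_hom] ring_hom_add[OF L_hom] in auto)
      then show "fr (\<Oplus>i\<in>{..<n}. P i i) \<one> = fr \<one> \<one>"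
        using rank_one_matrixD(3)[OF local[OF p]] by (simp add: L_one)
    qed (use Pc in auto)
  qed
  then show "\<exists>n P. represents R M n P \<and> rank_one_matrix R n P" using r by blast
next
  have R: "cring R" by unfold_locales
  assume "\<exists>n P. represents R M n P \<and> rank_one_matrix R n P"
  then obtain n P where r: "represents R M n P" and P: "rank_one_matrix R n P" by blast
  note P' = rank_one_matrixD[OF P]
  have "constant_rank R 1 M"
    unfolding constant_rank_def Let_def
  proof (intro allI impI)
    fix p assume p: "primeideal p R"
    interpret p: primeideal p R by fact
    interpret mult_set R "carrier R - p" by (rule prime_mult_set[OF p])
    interpret L: cring L by (rule L_cring)
    have "\<exists>i<n. P i i \<notin> p"
    proof (rule ccontr)
      assume neg: "\<not> ?thesis"
      have "(\<Oplus>i\<in>A. P i i) \<in> p" if "finite A" "A \<subseteq> {..<n}" for A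
        using that
      proof (induction rule: finite_induct)
        case (insert i A)
        then show ?case using neg P'(1) by (simp add: Pi_def subset_iff)
      qed simp
      from this[of "{..<n}"] have "\<one> \<in> p" using P'(3) by simp
      then show False using S_one by simp
    qed
    then obtain i where i: "i < n" "P i i \<notin> p" by blast
    then have Pii: "P i i \<in> carrier R - p" using P'(1) by simp
    have r': "represents L (extend_scalars R L (\<lambda>a. fr a \<one>) M) n (\<lambda>i j. fr (P i j) \<one>)"
      by (rule represents_extend[OF R L_cring L_hom r])
    have "module_isomorphic L (img L n (\<lambda>i j. fr (P i j) \<one>)) (free_module L 1)"
      by (rule L.free_of_unit_entry[OF rank_one_map[OF L_cring L_hom P] i(1) _ L_unit[OF Pii]]) (rule fr_closed[OF one_closed Pii])
    then show "module_isomorphic L (extend_scalars R L (\<lambda>a. fr a \<one>) M) (free_module L 1)"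
      using represents_iso[OF r'] module_isomorphic_trans by blast
  qed
  then show "rank_one_projective R M"
    unfolding rank_one_projective_def fg_projective_iff[OF R] using r by blast
qed

end

section \<open>The Picard group\<close>

lemma pic_class_cong:
  assumes M: "module R M" and iso: "module_isomorphic R M N"
  shows "pic_class R M = pic_class R N"
  using module_isomorphic_trans[OF _ iso] module_isomorphic_trans[OF _ module_isomorphic_sym[OF M iso]]
  unfolding pic_class_def by blast

context cring
begin

lemma img_rank_one:
  assumes "rank_one_matrix R n P"
  shows "represents R (img R n P) n P" "rank_one_projective R (img R n P)"
    "img R n P \<in> pic_class R (img R n P)"
proof -
  show r: "represents R (img R n P) n P" by (rule img_represents[OF rank_one_idempotent[OF assms]])
  then show "rank_one_projective R (img R n P)" using rank_one_projective_iff assms by blast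
  then show "img R n P \<in> pic_class R (img R n P)" by (simp add: pic_class_def module_isomorphic_refl)
qed

lemma pic_class_represents:
  assumes "represents R M n P" shows "pic_class R M = pic_class R (img R n P)"
  by (rule pic_class_cong[OF represents_module[OF assms] represents_iso[OF assms]])

text \<open>The matrix of one member of a class represents all members, since an isomorphism carries dual bases along. So the unions over
  representatives in the operations of the Picard group are unions of a constant family.\<close>

lemma pic_class_member:
  assumes P: "rank_one_matrix R n P" and M: "M \<in> pic_class R (img R n P)"
  shows "represents R M n P"
proof (rule represents_transport[OF _ _ img_rank_one(1)[OF P]])
  show "module_isomorphic R M (img R n P)" using M by (simp add: pic_class_def)
  obtain m Q where "represents R M m Q" using M rank_one_projective_iff[of M] unfolding pic_class_def by blast
  then show "module R M" by (rule represents_module)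
qed

lemma pic_class_img_eq:
  assumes P: "rank_one_matrix R n P" and eq: "pic_class R (img R n P) = pic_class R (img R m Q)"
  shows "module_isomorphic R (img R n P) (img R m Q)"
  using img_rank_one(3)[OF P] unfolding eq by (simp add: pic_class_def)

lemma Pic_cases:
  assumes "C \<in> carrier (Pic R)"
  obtains n P where "rank_one_matrix R n P" "C = pic_class R (img R n P)"
proof -
  obtain M :: "('a, nat \<Rightarrow> 'a) module" where M: "rank_one_projective R M" "C = pic_class R M"
    using assms by (auto simp: Pic_def)
  then show thesis using that rank_one_projective_iff[of M] pic_class_represents[of M] by metis
qed

lemma Pic_carrierI: "rank_one_matrix R n P \<Longrightarrow> pic_class R (img R n P) \<in> carrier (Pic R)"
  using img_rank_one(2) by (auto simp: Pic_def)

lemma Pic_mult: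
  assumes P: "rank_one_matrix R n P" and Q: "rank_one_matrix R m Q"
  shows "pic_class R (img R n P) \<otimes>\<^bsub>Pic R\<^esub> pic_class R (img R m Q) = pic_class R (img R (n * m) (kronecker R m P Q))"
proof -
  have inner: "(\<Union>N\<in>pic_class R (img R m Q). pic_class R (tensor_product R M N)) = pic_class R (img R (n * m) (kronecker R m P Q))"
    if M: "M \<in> pic_class R (img R n P)" for M
  proof (rule UN_eq_const)
    show "pic_class R (img R m Q) \<noteq> {}" using img_rank_one(3)[OF Q] by blast
    show "pic_class R (tensor_product R M N) = pic_class R (img R (n * m) (kronecker R m P Q))"
      if N: "N \<in> pic_class R (img R m Q)" for N
      by (rule pic_class_represents[OF represents_tensor[OF pic_class_member[OF P M] pic_class_member[OF Q N]]])
  qed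
  have "pic_class R (img R n P) \<noteq> {}" using img_rank_one(3)[OF P] by blast
  then have "(\<Union>M\<in>pic_class R (img R n P). \<Union>N\<in>pic_class R (img R m Q). pic_class R (tensor_product R M N))
      = pic_class R (img R (n * m) (kronecker R m P Q))"
    by (rule UN_eq_const[OF _ inner])
  then show ?thesis by (simp add: Pic_def)
qed

lemma Pic_map_img:
  assumes S: "cring S" and \<phi>: "\<phi> \<in> ring_hom R S" and P: "rank_one_matrix R n P"
  shows "Pic_map R S \<phi> (pic_class R (img R n P)) = pic_class S (img S n (\<lambda>i j. \<phi> (P i j)))"
  unfolding Pic_map_def
proof (rule UN_eq_const)
  interpret S: cring S by fact
  show "pic_class R (img R n P) \<noteq> {}" using img_rank_one(3)[OF P] by blast
  show "pic_class S (extend_scalars R S \<phi> M) = pic_class S (img S n (\<lambda>i j. \<phi> (P i j)))"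
    if M: "M \<in> pic_class R (img R n P)" for M
    by (rule S.pic_class_represents[OF represents_extend[OF is_cring S \<phi> pic_class_member[OF P M]]])
qed

lemma Pic_map_hom:
  assumes S: "cring S" and \<phi>: "\<phi> \<in> ring_hom R S"
  shows "Pic_map R S \<phi> \<in> hom (Pic R) (Pic S)"
proof (rule homI)
  interpret S: cring S by fact
  fix C assume "C \<in> carrier (Pic R)"
  then obtain n P where P: "rank_one_matrix R n P" "C = pic_class R (img R n P)" by (rule Pic_cases)
  show "Pic_map R S \<phi> C \<in> carrier (Pic S)"
    unfolding P(2) Pic_map_img[OF S \<phi> P(1)] by (rule S.Pic_carrierI[OF rank_one_map[OF S \<phi> P(1)]])
  fix D assume "D \<in> carrier (Pic R)"
  then obtain m Q where Q: "rank_one_matrix R m Q" "D = pic_class R (img R m Q)" by (rule Pic_cases)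
  have ix: "k div m < n \<and> k mod m < m" if "k < n * m" for k
    using that by (cases "m = 0") (auto simp: less_mult_imp_div_less)
  have "img S (n * m) (\<lambda>i j. \<phi> (kronecker R m P Q i j)) = img S (n * m) (kronecker S m (\<lambda>i j. \<phi> (P i j)) (\<lambda>i j. \<phi> (Q i j)))"
  proof (rule img_cong[OF S])
    fix i j assume ij: "i < n * m" "j < n * m"
    show "kronecker S m (\<lambda>i j. \<phi> (P i j)) (\<lambda>i j. \<phi> (Q i j)) i j \<in> carrier S"
      using ix[OF ij(1)] ix[OF ij(2)] rank_one_matrixD(1)[OF P(1)] rank_one_matrixD(1)[OF Q(1)]
      by (simp add: kronecker_def ring_hom_closed[OF \<phi>])
    show "\<phi> (kronecker R m P Q i j) = kronecker S m (\<lambda>i j. \<phi> (P i j)) (\<lambda>i j. \<phi> (Q i j)) i j"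
      using ix[OF ij(1)] ix[OF ij(2)] rank_one_matrixD(1)[OF P(1)] rank_one_matrixD(1)[OF Q(1)]
      by (simp add: kronecker_def ring_hom_mult[OF \<phi>])
  qed
  then show "Pic_map R S \<phi> (C \<otimes>\<^bsub>Pic R\<^esub> D) = Pic_map R S \<phi> C \<otimes>\<^bsub>Pic S\<^esub> Pic_map R S \<phi> D"
    unfolding P(2) Q(2) Pic_mult[OF P(1) Q(1)] Pic_map_img[OF S \<phi> P(1)] Pic_map_img[OF S \<phi> Q(1)]
      Pic_map_img[OF S \<phi> rank_one_kronecker[OF P(1) Q(1)]]
      S.Pic_mult[OF rank_one_map[OF S \<phi> P(1)] rank_one_map[OF S \<phi> Q(1)]] by simp
qed

text \<open>Isomorphic modules have isomorphic extensions; compared here through a second matrix of the first module.\<close>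

lemma iso_map:
  assumes S: "cring S" and \<phi>: "\<phi> \<in> ring_hom R S"
    and P: "rank_one_matrix R n P" and Q: "rank_one_matrix R m Q"
    and iso: "module_isomorphic R (img R n P) (img R m Q)"
  shows "module_isomorphic S (img S n (\<lambda>i j. \<phi> (P i j))) (img S m (\<lambda>i j. \<phi> (Q i j)))"
proof -
  have r: "represents R (img R n P) m Q"
    by (rule represents_transport[OF represents_module[OF img_rank_one(1)[OF P]] iso img_rank_one(1)[OF Q]])
  note 1 = represents_extend[OF is_cring S \<phi> img_rank_one(1)[OF P]]
  note 2 = represents_extend[OF is_cring S \<phi> r]
  show ?thesis
    by (rule module_isomorphic_trans[OF module_isomorphic_sym[OF represents_module[OF 1] represents_iso[OF 1]] represents_iso[OF 2]])
qed

abbreviation "const \<equiv> \<lambda>a. up_ring.monom (UP R) a 0"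

lemma UP_is_cring: "cring (UP R)"
proof -
  interpret UP_cring R "UP R" by (simp add: UP_cring_def is_cring)
  show ?thesis by (rule UP_cring)
qed

lemma const_hom: "const \<in> ring_hom R (UP R)"
proof -
  interpret UP_cring R "UP R" by (simp add: UP_cring_def is_cring)
  show ?thesis by (rule const_ring_hom)
qed

lemma const_at_0: "a \<in> carrier R \<Longrightarrow> const a 0 = a"
  by (simp add: UP_def)

lemma eval_0_hom: "(\<lambda>p. p 0) \<in> ring_hom (UP R) R"
  by (rule ring_hom_memI) (auto simp: UP_def mem_upD)

lemma free_eval_const: "free_eval_poly [:q:] = const (free_eval R q)"
  by (auto simp: free_eval_poly_def UP_def coeff_pCons free_eval_zero fun_eq_iff split: nat.splits)

lemma free_eval_poly_at_0: "free_eval_poly p 0 = free_eval R (poly.coeff p 0)"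
  by (simp add: free_eval_poly_def)

lemma free_eval_poly_sum:
  assumes "finite A"
  shows "free_eval_poly (sum f A) = (\<Oplus>\<^bsub>UP R\<^esub>i\<in>A. free_eval_poly (f i))"
proof -
  interpret U: cring "UP R" by (rule UP_is_cring)
  show ?thesis
    using assms by (induction rule: finite_induct) (simp_all add: free_eval_poly_zero free_eval_poly_add)
qed

lemma UP_rank_one_at_0: "rank_one_matrix (UP R) n M \<Longrightarrow> rank_one_matrix R n (\<lambda>i j. M i j 0)"
  using cring.rank_one_map[OF UP_is_cring is_cring eval_0_hom] by simp

lemma free_kernel_radical:
  assumes "reduced_ring R" shows "radical_in UNIV free_kernel"
proof -
  have "free_eval R q = \<zero>" if "free_eval R q \<otimes> free_eval R q = \<zero>" for q
  proof -
    have "free_eval R q [^] (2::nat) = \<zero>" using that by (simp add: numeral_2_eq_2)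
    then show ?thesis using assms unfolding reduced_ring_def by (meson free_eval_closed)
  qed
  then show ?thesis by (auto simp: radical_in_def free_kernel_def free_eval_mult)
qed

text \<open>The family to be factorized is \<open>N\<close> with \<open>N (i, k) (j, l) = M i j * M(0) l k\<close>. Its constant term is the product of \<open>M(0) i k\<close> and
  \<open>M(0) l j\<close> because the minors of \<open>M(0)\<close> vanish, and its trace is the product of two traces.\<close>

lemma seminormal_factors:
  assumes red: "reduced_ring R" and semi: "seminormal R" and M: "rank_one_matrix (UP R) n M"
  shows "module_isomorphic (UP R) (img (UP R) n M) (img (UP R) n (\<lambda>i j. const (M i j 0)))"
proof -
  interpret U: cring "UP R" by (rule UP_is_cring)
  note M' = rank_one_matrixD[OF M] and M0 = UP_rank_one_at_0[OF M]
  note M0' = rank_one_matrixD[OF M0]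
  interpret I: cideal UNIV free_kernel by (rule free_kernel_ideal)
  interpret PI: cideal UNIV "polys free_kernel" using cideal_polys[OF free_kernel_ideal] by simp
  have "\<exists>p. free_eval_poly p = M i j" if "i < n" "j < n" for i j
    using free_eval_poly_surj[OF M'(1)[OF that]] by metis
  then obtain A where A: "\<And>i j. i < n \<Longrightarrow> j < n \<Longrightarrow> free_eval_poly (A i j) = M i j" by metis
  define a where "a i j = poly.coeff (A i j) 0" for i j
  have a: "free_eval R (a i j) = M i j 0" if "i < n" "j < n" for i j
    using free_eval_poly_at_0[of "A i j"] A[OF that] by (simp add: a_def)
  define S where "S = {..<n} \<times> {..<n}"
  define N where "N = (\<lambda>(i, k) (j, l). A i j * [:a l k:])"
  have evN: "free_eval_poly (N (i, k) (j, l)) = M i j \<otimes>\<^bsub>UP R\<^esub> const (M l k 0)"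
    if "i < n" "j < n" "k < n" "l < n" for i j k l
    using that by (simp only: N_def case_prod_conv free_eval_poly_mult free_eval_const A a)
  have constc: "const (M l k 0) \<in> carrier (UP R)" if "l < n" "k < n" for l k
    by (rule ring_hom_closed[OF const_hom M0'(1)[OF that]])
  have "\<exists>f g. \<forall>z\<in>S. \<forall>w\<in>S. f z * g w - N z w \<in> polys free_kernel"
  proof (rule seminormal_factorization[OF free_kernel_ideal free_kernel_radical[OF red],
        where x = "\<lambda>(i, k). a i k" and y = "\<lambda>(j, l). a l j"])
    show "\<exists>a. a ^ 3 - b \<in> free_kernel \<and> a ^ 2 - c \<in> free_kernel" if "b ^ 2 - c ^ 3 \<in> free_kernel" for b c
    proof -
      have "free_eval R b [^] (2::nat) = free_eval R c [^] (3::nat)"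
        using that by (simp add: free_kernel_diff free_eval_power)
      then obtain d where "d \<in> carrier R" "d [^] (3::nat) = free_eval R b" "d [^] (2::nat) = free_eval R c"
        using semi unfolding seminormal_def by (meson free_eval_closed)
      then show ?thesis
        by (intro exI[of _ "free_gen d"]) (simp add: free_kernel_diff free_eval_power free_eval_gen)
    qed
    show "finite S" by (simp add: S_def)
    show "N z w * N z' w' - N z w' * N z' w \<in> polys free_kernel" if zw: "z \<in> S" "w \<in> S" "z' \<in> S" "w' \<in> S" for z w z' w'
    proof -
      obtain i k j l i' k' j' l' where *: "z = (i, k)" "w = (j, l)" "z' = (i', k')" "w' = (j', l')"
        by (metis surj_pair)
      have lt: "i < n" "k < n" "j < n" "l < n" "i' < n" "k' < n" "j' < n" "l' < n"
        using zw by (auto simp: * S_def)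
      note c = M'(1)[OF lt(1,3)] M'(1)[OF lt(5,7)] M'(1)[OF lt(1,7)] M'(1)[OF lt(5,3)]
        constc[OF lt(4,2)] constc[OF lt(8,6)] constc[OF lt(8,2)] constc[OF lt(4,6)]
      have 4: "(p \<otimes>\<^bsub>UP R\<^esub> q) \<otimes>\<^bsub>UP R\<^esub> (r \<otimes>\<^bsub>UP R\<^esub> s) = (p \<otimes>\<^bsub>UP R\<^esub> r) \<otimes>\<^bsub>UP R\<^esub> (q \<otimes>\<^bsub>UP R\<^esub> s)"
        if "p \<in> carrier (UP R)" "q \<in> carrier (UP R)" "r \<in> carrier (UP R)" "s \<in> carrier (UP R)" for p q r s
        using that by (simp add: U.m_ac)
      have MM: "M i j \<otimes>\<^bsub>UP R\<^esub> M i' j' = M i j' \<otimes>\<^bsub>UP R\<^esub> M i' j" by (rule M'(2)) (fact lt)+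
      have "M l k 0 \<otimes> M l' k' 0 = M l k' 0 \<otimes> M l' k 0" by (rule M0'(2)) (fact lt)+
      also have "\<dots> = M l' k 0 \<otimes> M l k' 0" by (rule m_comm[OF M0'(1)[OF lt(4,6)] M0'(1)[OF lt(8,2)]])
      finally have "const (M l k 0) \<otimes>\<^bsub>UP R\<^esub> const (M l' k' 0) = const (M l' k 0) \<otimes>\<^bsub>UP R\<^esub> const (M l k' 0)"
        using ring_hom_mult[OF const_hom] M0'(1) lt by metis
      then have "free_eval_poly (N z w * N z' w') = free_eval_poly (N z w' * N z' w)"
        unfolding * free_eval_poly_mult evN[OF lt(1,3,2,4)] evN[OF lt(5,7,6,8)] evN[OF lt(1,7,2,8)] evN[OF lt(5,3,6,4)]
          4[OF c(1,5,2,6)] 4[OF c(3,7,4,8)] MM by simp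
      then show ?thesis by (simp add: free_kernel_poly_diff)
    qed
    show "(\<Sum>z\<in>S. N z z) - 1 \<in> polys free_kernel"
    proof -
      have "free_eval_poly (\<Sum>i<n. A i i) = (\<Oplus>\<^bsub>UP R\<^esub>i\<in>{..<n}. M i i)"
        unfolding free_eval_poly_sum[OF finite_lessThan] using A M'(1) by (intro U.finsum_cong') auto
      then have 1: "(\<Sum>i<n. A i i) - 1 \<in> polys free_kernel"
        using M'(3) by (simp add: free_kernel_poly_diff free_eval_poly_one)
      have "(\<Sum>k<n. a k k) - 1 \<in> free_kernel"
        using polysD[OF 1, of 0] by (simp add: coeff_sum a_def)
      then have "[:(\<Sum>k<n. a k k) - 1:] \<in> polys free_kernel"
        by (auto simp: polys_def coeff_pCons I.zero_ideal split: nat.splits)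
      also have "[:(\<Sum>k<n. a k k) - 1:] = (\<Sum>k<n. [:a k k:]) - 1"
        by (rule poly_eqI) (auto simp: coeff_sum coeff_pCons coeff_1 split: nat.splits)
      finally have "(\<Sum>i<n. A i i) * (\<Sum>k<n. [:a k k:]) - 1 * 1 \<in> polys free_kernel"
        by (intro PI.cong_mult 1) auto
      also have "(\<Sum>i<n. A i i) * (\<Sum>k<n. [:a k k:]) = (\<Sum>z\<in>S. N z z)"
        unfolding S_def N_def sum_product sum.cartesian_product by (simp add: case_prod_beta)
      finally show ?thesis by simp
    qed
    show "poly.coeff (N z w) 0 - (case z of (i, k) \<Rightarrow> a i k) * (case w of (j, l) \<Rightarrow> a l j) \<in> free_kernel"
      if zw: "z \<in> S" "w \<in> S" for z w
    proof -
      obtain i k j l where *: "z = (i, k)" "w = (j, l)" by (metis surj_pair)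
      have lt: "i < n" "k < n" "j < n" "l < n" using zw by (auto simp: * S_def)
      have "M l k 0 \<otimes> M i j 0 = M l j 0 \<otimes> M i k 0" by (rule M0'(2)) (fact lt)+
      also have "\<dots> = M i k 0 \<otimes> M l j 0" by (rule m_comm[OF M0'(1)[OF lt(4,3)] M0'(1)[OF lt(1,2)]])
      finally show ?thesis using lt by (auto simp: * N_def free_kernel_diff free_eval_mult a coeff_mult_0 simp flip: a_def)
    qed
  qed
  then obtain f g where fg: "\<And>z w. z \<in> S \<Longrightarrow> w \<in> S \<Longrightarrow> free_eval_poly (f z * g w) = free_eval_poly (N z w)"
    unfolding free_kernel_poly_diff by blast
  have "represents (UP R) (img (UP R) n M) n (\<lambda>i j. const (M i j 0))"
  proof (rule U.represents_of_factorization[OF M rank_one_map[OF UP_is_cring const_hom M0],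
        where x = "\<lambda>i k. free_eval_poly (f (i, k))" and y = "\<lambda>l j. free_eval_poly (g (j, l))"])
    show "free_eval_poly (f (i, k)) \<otimes>\<^bsub>UP R\<^esub> free_eval_poly (g (j, l)) = M i j \<otimes>\<^bsub>UP R\<^esub> const (M l k 0)"
      if "i < n" "k < n" "l < n" "j < n" for i k l j
      using fg[of "(i, k)" "(j, l)"] that by (simp add: S_def free_eval_poly_mult evN)
  qed simp_all
  then show ?thesis by (rule represents_iso)
qed

text \<open>Schanuel's matrix \<open>M\<close> has the constant term with single entry 1, so an isomorphism with the extension of \<open>M(0)\<close> writes \<open>M\<close> as a column
  times a row, to which \<open>schanuel_descent\<close> applies.\<close>

lemma seminormal_of_extended:
  assumes red: "reduced_ring R"
    and ext: "\<And>M. rank_one_matrix (UP R) 2 M \<Longrightarrow>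
      module_isomorphic (UP R) (img (UP R) 2 M) (img (UP R) 2 (\<lambda>i j. const (M i j 0)))"
  shows "seminormal R"
  unfolding seminormal_def
proof (intro ballI impI)
  fix b c assume b: "b \<in> carrier R" and c: "c \<in> carrier R" and bc: "b [^] (2::nat) = c [^] (3::nat)"
  interpret U: cring "UP R" by (rule UP_is_cring)
  interpret I: cideal UNIV free_kernel by (rule free_kernel_ideal)
  interpret PI: cideal UNIV "polys free_kernel" using cideal_polys[OF free_kernel_ideal] by simp
  define \<beta> where "\<beta> = free_gen b"
  define \<gamma> where "\<gamma> = free_gen c"
  have ev: "free_eval R \<beta> = b" "free_eval R \<gamma> = c" using b c by (simp_all add: \<beta>_def \<gamma>_def free_eval_gen)
  have \<beta>\<gamma>: "\<beta>^2 - \<gamma>^3 \<in> free_kernel" using bc by (simp add: free_kernel_diff free_eval_power ev)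
  define T :: "'a free_ring poly" where "T = [:0, 1:]"
  (* Schanuel's matrix; its determinant is T^6 * (1 + c*T^2) * (b^2 - c^3) and its trace is 1 *)
  define N where "N i j = (if i = 0 then if j = 0 then 1 - [:\<gamma>:]^2*T^4 else T^2 * ([:\<gamma>:] + [:\<beta>:]*T)
    else if j = 0 then T^2 * ([:\<gamma>:] - [:\<beta>:]*T) * (1 + [:\<gamma>:]*T^2) else [:\<gamma>:]^2*T^4)" for i j :: nat
  define M where "M i j = free_eval_poly (N i j)" for i j
  have det: "N 0 0 * N 1 1 - N 0 1 * N 1 0 \<in> polys free_kernel"
  proof -
    have split: "(1 - u^2*t^4) * (u^2*t^4) - (t^2 * (u + v*t)) * (t^2 * (u - v*t) * (1 + u*t^2)) = (t^6 * (1 + u*t^2)) * (v^2 - u^3)"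
      for u v t :: "'a free_ring poly"
      by (simp add: algebra_simps power2_eq_square power3_eq_cube eval_nat_numeral)
    have "[:\<beta>^2 - \<gamma>^3:] \<in> polys free_kernel"
      using \<beta>\<gamma> by (auto simp: polys_def coeff_pCons I.zero_ideal split: nat.splits)
    also have "[:\<beta>^2 - \<gamma>^3:] = [:\<beta>:]^2 - [:\<gamma>:]^3"
      by (simp add: power2_eq_square power3_eq_cube mult.assoc)
    finally have e: "[:\<beta>:]^2 - [:\<gamma>:]^3 \<in> polys free_kernel" .
    show ?thesis
      unfolding N_def by (simp only: if_True if_False zero_neq_one[symmetric] one_neq_zero refl split) (rule PI.mult_ideal[OF UNIV_I e])
  qed
  have D: "M 0 0 \<otimes>\<^bsub>UP R\<^esub> M 1 1 = M 0 1 \<otimes>\<^bsub>UP R\<^esub> M 1 0"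
    using det by (simp add: M_def free_kernel_poly_diff free_eval_poly_mult)
  have Mc: "M i j \<in> carrier (UP R)" for i j by (simp add: M_def)
  have M: "rank_one_matrix (UP R) 2 M"
    unfolding rank_one_matrix_def
  proof (intro conjI allI impI)
    fix i j k l :: nat assume "i < 2" "j < 2" "k < 2" "l < 2"
    then have *: "i = 0 \<or> i = 1" "j = 0 \<or> j = 1" "k = 0 \<or> k = 1" "l = 0 \<or> l = 1" by auto
    have "M 1 1 \<otimes>\<^bsub>UP R\<^esub> M 0 0 = M 0 0 \<otimes>\<^bsub>UP R\<^esub> M 1 1" by (rule U.m_comm[OF Mc Mc])
    also note D
    also have "M 0 1 \<otimes>\<^bsub>UP R\<^esub> M 1 0 = M 1 0 \<otimes>\<^bsub>UP R\<^esub> M 0 1" by (rule U.m_comm[OF Mc Mc])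
    finally have D': "M 1 1 \<otimes>\<^bsub>UP R\<^esub> M 0 0 = M 1 0 \<otimes>\<^bsub>UP R\<^esub> M 0 1" .
    consider "i = k" | "j = l" | "i = 0 \<and> j = 0 \<and> k = 1 \<and> l = 1" | "i = 0 \<and> j = 1 \<and> k = 1 \<and> l = 0"
      | "i = 1 \<and> j = 0 \<and> k = 0 \<and> l = 1" | "i = 1 \<and> j = 1 \<and> k = 0 \<and> l = 0"
      using * by (elim disjE) simp_all
    then show "M i j \<otimes>\<^bsub>UP R\<^esub> M k l = M i l \<otimes>\<^bsub>UP R\<^esub> M k j"
    proof cases
      case 1 show ?thesis unfolding 1 by (rule U.m_comm[OF Mc Mc])
    next
      case 2 show ?thesis by (simp only: 2)
    qed (metis D D')+
  next
    have "(\<Oplus>\<^bsub>UP R\<^esub>i\<in>{..<2::nat}. M i i) = free_eval_poly (\<Sum>i<2. N i i)"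
      by (simp only: free_eval_poly_sum[OF finite_lessThan] M_def)
    also have "(\<Sum>i<2. N i i) = 1" by (simp add: N_def numeral_2_eq_2)
    finally show "(\<Oplus>\<^bsub>UP R\<^esub>i\<in>{..<2::nat}. M i i) = \<one>\<^bsub>UP R\<^esub>" by (simp add: free_eval_poly_one)
  qed (rule Mc)
  note M0 = UP_rank_one_at_0[OF M]
  obtain x y where x: "\<forall>i<2. \<forall>k<2. x i k \<in> carrier (UP R)" and y: "\<forall>l<2. \<forall>j<2. y l j \<in> carrier (UP R)"
    and xy: "\<forall>i<2. \<forall>k<2. \<forall>l<2. \<forall>j<2. x i k \<otimes>\<^bsub>UP R\<^esub> y l j = M i j \<otimes>\<^bsub>UP R\<^esub> const (M l k 0)"
    using U.factorization_of_iso[OF M rank_one_map[OF UP_is_cring const_hom M0] ext[OF M]] by blast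
  have "\<exists>p. free_eval_poly p = q" if "q \<in> carrier (UP R)" for q using free_eval_poly_surj[OF that] by metis
  then have "\<forall>i<2. \<exists>p. free_eval_poly p = x i 0" "\<forall>j<2. \<exists>p. free_eval_poly p = y 0 j" using x y by auto
  then obtain f g where f: "\<And>i. i < 2 \<Longrightarrow> free_eval_poly (f i) = x i 0" and g: "\<And>j. j < 2 \<Longrightarrow> free_eval_poly (g j) = y 0 j"
    by metis
  have N00: "poly.coeff (N 0 0) 0 = 1"
    by (simp add: N_def T_def coeff_mult_0 eval_nat_numeral)
  have "const (M 0 0 0) = \<one>\<^bsub>UP R\<^esub>"
    using ring_hom_one[OF const_hom] by (simp add: M_def free_eval_poly_at_0 N00 free_eval_one)
  then have fg: "f i * g j - N i j \<in> polys free_kernel" if "i < 2" "j < 2" for i j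
    using xy f g that Mc by (simp add: free_kernel_poly_diff free_eval_poly_mult M_def)
  define p where "p = poly.coeff (f 0) 0"
  define q where "q = poly.coeff (g 0) 0"
  have pq: "p * q - 1 \<in> free_kernel"
    using polysD[OF fg[of 0 0], of 0] N00 by (simp add: coeff_mult_0 p_def q_def)
  (* rescaled so that both factors have constant term 1 *)
  have fg': "smult q (f i) * smult p (g j) - N i j \<in> polys free_kernel" if "i < 2" "j < 2" for i j
  proof -
    have "[:p * q - 1:] \<in> polys free_kernel"
      using pq by (auto simp: polys_def coeff_pCons I.zero_ideal split: nat.splits)
    then have "(f i * g j) * [:p * q - 1:] + (f i * g j - N i j) \<in> polys free_kernel"
      by (intro PI.add_ideal PI.mult_ideal[OF UNIV_I] fg that)
    also have "(f i * g j) * [:p * q - 1:] + (f i * g j - N i j) = smult q (f i) * smult p (g j) - N i j"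
      by (simp add: smult_diff_left mult.commute)
    finally show ?thesis .
  qed
  have "\<exists>a. a^3 - \<beta> \<in> free_kernel \<and> a^2 - \<gamma> \<in> free_kernel"
  proof (rule schanuel_descent[OF free_kernel_ideal free_kernel_radical[OF red] \<beta>\<gamma>, folded T_def])
    show "smult q (f 0) * smult p (g 0) - (1 - [:\<gamma>:]^2*T^4) \<in> polys free_kernel" using fg'[of 0 0] by (simp add: N_def)
    show "smult q (f 0) * smult p (g 1) - T^2 * ([:\<gamma>:] + [:\<beta>:]*T) \<in> polys free_kernel" using fg'[of 0 1] by (simp add: N_def)
    show "smult q (f 1) * smult p (g 0) - T^2 * ([:\<gamma>:] - [:\<beta>:]*T) * (1 + [:\<gamma>:]*T^2) \<in> polys free_kernel" using fg'[of 1 0] by (simp add: N_def)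
    show "smult q (f 1) * smult p (g 1) - [:\<gamma>:]^2*T^4 \<in> polys free_kernel" using fg'[of 1 1] by (simp add: N_def)
    show "poly.coeff (smult q (f 0)) 0 - 1 \<in> free_kernel" "poly.coeff (smult p (g 0)) 0 - 1 \<in> free_kernel"
      using pq by (simp_all add: p_def q_def mult.commute)
  qed
  then obtain a where "a^3 - \<beta> \<in> free_kernel" "a^2 - \<gamma> \<in> free_kernel" by blast
  then show "\<exists>a\<in>carrier R. a [^] (3::nat) = b \<and> a [^] (2::nat) = c"
    by (intro bexI[of _ "free_eval R a"]) (simp_all add: free_kernel_diff free_eval_power ev)
qed

text \<open>Evaluation at 0 recovers the module from its extension.\<close>

lemma Pic_map_UP_inj: "inj_on (Pic_map R (UP R) const) (carrier (Pic R))"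
proof (rule inj_onI)
  interpret U: cring "UP R" by (rule UP_is_cring)
  fix C D assume "C \<in> carrier (Pic R)" "D \<in> carrier (Pic R)" and eq: "Pic_map R (UP R) const C = Pic_map R (UP R) const D"
  then obtain n P m Q where P: "rank_one_matrix R n P" "C = pic_class R (img R n P)"
    and Q: "rank_one_matrix R m Q" "D = pic_class R (img R m Q)"
    by (metis Pic_cases)
  note P' = rank_one_map[OF UP_is_cring const_hom P(1)] and Q' = rank_one_map[OF UP_is_cring const_hom Q(1)]
  have "module_isomorphic (UP R) (img (UP R) n (\<lambda>i j. const (P i j))) (img (UP R) m (\<lambda>i j. const (Q i j)))"
    using eq unfolding P(2) Q(2) Pic_map_img[OF UP_is_cring const_hom P(1)] Pic_map_img[OF UP_is_cring const_hom Q(1)]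
    by (rule U.pic_class_img_eq[OF P'])
  then have iso: "module_isomorphic R (img R n (\<lambda>i j. const (P i j) 0)) (img R m (\<lambda>i j. const (Q i j) 0))"
    by (rule U.iso_map[OF is_cring eval_0_hom P' Q'])
  have "img R n (\<lambda>i j. const (P i j) 0) = img R n P" "img R m (\<lambda>i j. const (Q i j) 0) = img R m Q"
    using rank_one_matrixD(1)[OF P(1)] rank_one_matrixD(1)[OF Q(1)]
    by (intro img_cong[OF is_cring]; simp add: const_at_0)+
  then show "C = D"
    unfolding P(2) Q(2) using iso pic_class_cong[OF represents_module[OF img_rank_one(1)[OF P(1)]]] by simp
qed

text \<open>If \<open>M\<close> is extended from some \<open>Q\<close>, evaluation at 0 identifies \<open>Q\<close> with \<open>M(0)\<close>.\<close>

lemma extended_of_surj: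
  assumes surj: "carrier (Pic (UP R)) \<subseteq> Pic_map R (UP R) const ` carrier (Pic R)"
    and M: "rank_one_matrix (UP R) n M"
  shows "module_isomorphic (UP R) (img (UP R) n M) (img (UP R) n (\<lambda>i j. const (M i j 0)))"
proof -
  interpret U: cring "UP R" by (rule UP_is_cring)
  obtain C where C: "C \<in> carrier (Pic R)" "pic_class (UP R) (img (UP R) n M) = Pic_map R (UP R) const C"
    using surj U.Pic_carrierI[OF M] by blast
  obtain m Q where Q: "rank_one_matrix R m Q" "C = pic_class R (img R m Q)" using C(1) by (rule Pic_cases)
  note Q' = rank_one_map[OF UP_is_cring const_hom Q(1)] and M0 = UP_rank_one_at_0[OF M]
  have iso: "module_isomorphic (UP R) (img (UP R) n M) (img (UP R) m (\<lambda>i j. const (Q i j)))"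
    using C(2) unfolding Q(2) Pic_map_img[OF UP_is_cring const_hom Q(1)] by (rule U.pic_class_img_eq[OF M])
  then have "module_isomorphic R (img R n (\<lambda>i j. M i j 0)) (img R m (\<lambda>i j. const (Q i j) 0))"
    by (rule U.iso_map[OF is_cring eval_0_hom M Q'])
  also have "img R m (\<lambda>i j. const (Q i j) 0) = img R m Q"
    using rank_one_matrixD(1)[OF Q(1)] by (intro img_cong[OF is_cring]) (simp_all add: const_at_0)
  finally have "module_isomorphic (UP R) (img (UP R) n (\<lambda>i j. const (M i j 0))) (img (UP R) m (\<lambda>i j. const (Q i j)))"
    by (rule iso_map[OF UP_is_cring const_hom M0 Q(1)])
  from module_isomorphic_sym[OF _ this] show ?thesis
    using module_isomorphic_trans[OF iso] represents_module[OF U.img_rank_one(1)[OF rank_one_map[OF UP_is_cring const_hom M0]]]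
    by blast
qed

end

theorem mainTheorem1:
  fixes R :: "('a, 'r) ring_scheme"
  assumes "cring R" and "reduced_ring R"
  shows "seminormal R \<longleftrightarrow>
    Pic_map R (UP R) (\<lambda>a. up_ring.monom (UP R) a 0) \<in> iso (Pic R) (Pic (UP R))"
proof -
  interpret cring R by fact
  interpret U: cring "UP R" by (rule UP_is_cring)
  note hom = Pic_map_hom[OF UP_is_cring const_hom]
  show ?thesis
  proof
    assume semi: "seminormal R"
    have "C \<in> Pic_map R (UP R) const ` carrier (Pic R)" if C: "C \<in> carrier (Pic (UP R))" for C
    proof -
      obtain n M where M: "rank_one_matrix (UP R) n M" "C = pic_class (UP R) (img (UP R) n M)"
        using C by (rule U.Pic_cases)
      note M0 = UP_rank_one_at_0[OF M(1)]
      have "C = pic_class (UP R) (img (UP R) n (\<lambda>i j. const (M i j 0)))"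
        unfolding M(2)
        by (rule pic_class_cong[OF represents_module[OF U.img_rank_one(1)[OF M(1)]] seminormal_factors[OF assms(2) semi M(1)]])
      also have "\<dots> = Pic_map R (UP R) const (pic_class R (img R n (\<lambda>i j. M i j 0)))"
        by (rule Pic_map_img[OF UP_is_cring const_hom M0, symmetric])
      finally show ?thesis using Pic_carrierI[OF M0] by blast
    qed
    then have "bij_betw (Pic_map R (UP R) const) (carrier (Pic R)) (carrier (Pic (UP R)))"
      using Pic_map_UP_inj hom_carrier[OF hom] unfolding bij_betw_def by blast
    then show "Pic_map R (UP R) const \<in> iso (Pic R) (Pic (UP R))"
      using hom by (simp add: iso_def)
  next
    assume "Pic_map R (UP R) const \<in> iso (Pic R) (Pic (UP R))"
    then have "carrier (Pic (UP R)) \<subseteq> Pic_map R (UP R) const ` carrier (Pic R)"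
      by (simp add: iso_def bij_betw_def)
    then show "seminormal R"
      by (intro seminormal_of_extended[OF assms(2)] extended_of_surj)
  qed
qed

end
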